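(* (Disjunction property of $BT$.) Let $\varphi$ and $\psi$ be closed formulas of $BT$. If $BT\vdash \varphi\vee\psi$, then $BT\vdash\varphi$ or $BT\vdash\psi$.
   Context: The theory $BT$ is the following many-typed first-order theory with intuitionistic logic. Types: $\omega$ (natural numbers) and $k=0,1,2,\ldots$; $\omega$ is regarded as smaller than every other type. Variables: numerical variables $m,n,\ldots$ of type $\omega$, and variables $X^k,Y^k,Z^k,\ldots$ of type $k$ for each $k\geqslant 0$; variables of type $0$ (operation variables) are also written $x,y,z,f,g,u,v,\ldots$. Constants: the numerical constant $0$ and the type-$0$ constants $\underline{k},\underline{s},\underline{d},\underline{p},\underline{p}_1,\underline{p}_2$ and $\underline{c}_n$ $(n\geqslant 0)$ (comprehension constants). There are no function symbols. Predicate symbols: $Ap(f,x,y)$, $x=_{0\omega}m$, $x=_{0k}Y^k$, $X^k\in_k Y^{k+1}$ $(k\geqslant 0)$. Formulas are built from atomic formulas and $\bot$ with $\wedge,\vee,\supset$ and quantifiers over variables of any type; $\neg\varphi$ abbreviates $\varphi\supset\bot$. A formula is $n$-elementary if it contains only types $\leqslant n$, no quantifiers over variables of type $n$ and no symbol $=_{0n}$. External terms: constants and variables are external terms, and if $t,\tau$ are external terms then so is $t\tau$; $t_1t_2\ldots t_n$ means $(\ldots(t_1t_2)\ldots)t_n$. For an external term $t$, the formula $t\simeq x$ is $x=_{0s}t$ if $t$ is a constant or variable of type $s$, and is $\exists y,z(t_1\simeq y\wedge t_2\simeq z\wedge Ap(y,z,x))$ if $t$ is $t_1t_2$. Abbreviations: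 $t\downarrow:=\exists x(t\simeq x)$; $t\simeq\tau:=\exists x(t\simeq x\wedge\tau\simeq x)$; $t\cong\tau:=\forall x(t\simeq x\equiv\tau\simeq x)$; $\varphi(t):=\exists x(t\simeq x\wedge\varphi(x))$. $\langle x_1\rangle:=x_1$, $\langle x_1,\ldots,x_{n+1}\rangle:=\underline{p}\langle x_1,\ldots,x_n\rangle x_{n+1}$, and $\tau(t_1,\ldots,t_n)$ means $\tau\langle t_1,\ldots,t_n\rangle$. Axioms of $BT$: 1. Intuitionistic predicate logic. 2. Equality: $x=_{00}x$; $u=_{0k}X^k\wedge v=_{0k}X\wedge u=_{0n}Y^n\supset v=_{0n}Y$ $(k,n\geqslant 0)$; $u=_{0\omega}m\wedge v=_{0\omega}m\supset u=_{00}v$; $u=_{0\omega}m\wedge u=_{00}v\supset v=_{0\omega}m$; $Ap(f,x,y)\wedge f=_{00}g\wedge x=_{00}u\wedge y=_{00}v\supset Ap(g,u,v)$; $X^k\in_kY^{k+1}\wedge X^k=_kU^k\wedge Y^{k+1}=_{k+1}Z^{k+1}\supset U\in_kZ$ $(k\geqslant0)$. 3. Combinatorial: $Ap(f,x,y)\wedge Ap(f,x,z)\supset y=z$; $\underline{k}xy\simeq x$; $\underline{s}xy\downarrow$; $\underline{s}xyz\cong xz(yz)$; $\underline{p}xy\downarrow$; $\neg(\underline{p}xy\simeq 0)$; $\underline{p}_ix\downarrow$ and $\underline{p}_i(\underline{p}x_1x_2)\simeq x_i$ $(i=1,2)$; $\exists m(\underline{p}n0\simeq m)$; $\exists Z^k(\underline{p}xY^k\simeq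 Z)$; $n=m\supset\underline{d}xynm\simeq x$; $n\neq m\supset\underline{d}xynm\simeq y$; $\exists x(x=_{0\omega}n)$; $\exists x(x=_{0k}Y^k)$. 4. Induction rule: from $\varphi[n/0]$ and $\varphi\supset\exists m(\underline{p}n0\simeq m\wedge\varphi[n/m])$ infer $\varphi$, for any formula $\varphi$. 5. Comprehension: $\exists U^{k+1}[\underline{c}_n(\widetilde X)\simeq U\wedge\forall Z^k(Z\in_kU\equiv\varphi)]$, where $\widetilde X$ is a finite list of variables of types $\leqslant k+1$, $\varphi$ is a $(k+1)$-elementary formula with all parameters among $Z^k,\widetilde X$, and $n$ is the Gödel number (in a fixed Gödel numbering of $BT$) of the expression $Z^k.\widetilde X.\varphi$. *)

theory Defs
  imports "HOL-Library.Nat_Bijection"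
begin

section \<open>Language\<close>

text \<open>
  A deep embedding with named, typed variables. Arguments of predicate symbols are constants or
  variables, as there are no function symbols. Typing discipline is imposed by the
  predicate \<open>wff\<close>.
\<close>

datatype ty = Omega | Ty nat

datatype var = V (vty: ty) (vidx: nat)

datatype const = Zero | CK | CS | CD | CP | CP1 | CP2 | CC nat

datatype trm = Var var | Con const

primrec const_ty :: "const \<Rightarrow> ty" where
  "const_ty Zero = Omega"
| "const_ty CK = Ty 0"
| "const_ty CS = Ty 0"
| "const_ty CD = Ty 0"
| "const_ty CP = Ty 0"
| "const_ty CP1 = Ty 0"
| "const_ty CP2 = Ty 0"
| "const_ty (CC n) = Ty 0"

primrec trm_ty :: "trm \<Rightarrow> ty" where
  "trm_ty (Var v) = vty v"
| "trm_ty (Con c) = const_ty c"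

text \<open>\<open>Eq s x y\<close> is the symbol \<open>x =\<^sub>0\<^sub>s y\<close> and \<open>Mem k X Y\<close> is \<open>X \<in>\<^sub>k Y\<close>.\<close>

datatype form =
    Ap trm trm trm
  | Eq ty trm trm
  | Mem nat trm trm
  | Bot  (\<open>\<^bold>\<bottom>\<close>)
  | And form form  (infixr \<open>\<^bold>\<and>\<close> 55)
  | Or form form  (infixr \<open>\<^bold>\<or>\<close> 54)
  | Imp form form  (infixr \<open>\<^bold>\<longrightarrow>\<close> 53)
  | Forall var form
  | Exists var form

abbreviation Neg :: "form \<Rightarrow> form"  (\<open>\<^bold>\<not> _\<close> [58] 58) where
  "\<^bold>\<not> \<phi> \<equiv> \<phi> \<^bold>\<longrightarrow> \<^bold>\<bottom>"

abbreviation Iff :: "form \<Rightarrow> form \<Rightarrow> form"  (infix \<open>\<^bold>\<longleftrightarrow>\<close> 52) where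
  "\<phi> \<^bold>\<longleftrightarrow> \<psi> \<equiv> (\<phi> \<^bold>\<longrightarrow> \<psi>) \<^bold>\<and> (\<psi> \<^bold>\<longrightarrow> \<phi>)"

primrec wff :: "form \<Rightarrow> bool" where
  "wff (Ap a b c) \<longleftrightarrow> trm_ty a = Ty 0 \<and> trm_ty b = Ty 0 \<and> trm_ty c = Ty 0"
| "wff (Eq s a b) \<longleftrightarrow> trm_ty a = Ty 0 \<and> trm_ty b = s"
| "wff (Mem k a b) \<longleftrightarrow> trm_ty a = Ty k \<and> trm_ty b = Ty (Suc k)"
| "wff \<^bold>\<bottom> \<longleftrightarrow> True"
| "wff (\<phi> \<^bold>\<and> \<psi>) \<longleftrightarrow> wff \<phi> \<and> wff \<psi>"
| "wff (\<phi> \<^bold>\<or> \<psi>) \<longleftrightarrow> wff \<phi> \<and> wff \<psi>"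
| "wff (\<phi> \<^bold>\<longrightarrow> \<psi>) \<longleftrightarrow> wff \<phi> \<and> wff \<psi>"
| "wff (Forall v \<phi>) \<longleftrightarrow> wff \<phi>"
| "wff (Exists v \<phi>) \<longleftrightarrow> wff \<phi>"

primrec trm_vars :: "trm \<Rightarrow> var set" where
  "trm_vars (Var v) = {v}"
| "trm_vars (Con c) = {}"

primrec fv :: "form \<Rightarrow> var set" where
  "fv (Ap a b c) = trm_vars a \<union> trm_vars b \<union> trm_vars c"
| "fv (Eq s a b) = trm_vars a \<union> trm_vars b"
| "fv (Mem k a b) = trm_vars a \<union> trm_vars b"
| "fv \<^bold>\<bottom> = {}"
| "fv (\<phi> \<^bold>\<and> \<psi>) = fv \<phi> \<union> fv \<psi>"
| "fv (\<phi> \<^bold>\<or> \<psi>) = fv \<phi> \<union> fv \<psi>"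
| "fv (\<phi> \<^bold>\<longrightarrow> \<psi>) = fv \<phi> \<union> fv \<psi>"
| "fv (Forall v \<phi>) = fv \<phi> - {v}"
| "fv (Exists v \<phi>) = fv \<phi> - {v}"

definition closed_form :: "form \<Rightarrow> bool" where
  "closed_form \<phi> \<longleftrightarrow> wff \<phi> \<and> fv \<phi> = {}"

primrec trm_subst :: "var \<Rightarrow> trm \<Rightarrow> trm \<Rightarrow> trm" where
  "trm_subst v t (Var w) = (if w = v then t else Var w)"
| "trm_subst v t (Con c) = Con c"

text \<open>
  Substitution of \<open>t\<close> for the free occurrences of \<open>v\<close>. Bound variables are not renamed, so that it
  is only used together with \<open>free_for\<close>.
\<close>

primrec subst :: "var \<Rightarrow> trm \<Rightarrow> form \<Rightarrow> form" where
  "subst v t (Ap a b c) = Ap (trm_subst v t a) (trm_subst v t b) (trm_subst v t c)"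
| "subst v t (Eq s a b) = Eq s (trm_subst v t a) (trm_subst v t b)"
| "subst v t (Mem k a b) = Mem k (trm_subst v t a) (trm_subst v t b)"
| "subst v t \<^bold>\<bottom> = \<^bold>\<bottom>"
| "subst v t (\<phi> \<^bold>\<and> \<psi>) = subst v t \<phi> \<^bold>\<and> subst v t \<psi>"
| "subst v t (\<phi> \<^bold>\<or> \<psi>) = subst v t \<phi> \<^bold>\<or> subst v t \<psi>"
| "subst v t (\<phi> \<^bold>\<longrightarrow> \<psi>) = subst v t \<phi> \<^bold>\<longrightarrow> subst v t \<psi>"
| "subst v t (Forall w \<phi>) = Forall w (if w = v then \<phi> else subst v t \<phi>)"
| "subst v t (Exists w \<phi>) = Exists w (if w = v then \<phi> else subst v t \<phi>)"

primrec free_for :: "trm \<Rightarrow> var \<Rightarrow> form \<Rightarrow> bool" where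
  "free_for t v (Ap a b c) \<longleftrightarrow> True"
| "free_for t v (Eq s a b) \<longleftrightarrow> True"
| "free_for t v (Mem k a b) \<longleftrightarrow> True"
| "free_for t v \<^bold>\<bottom> \<longleftrightarrow> True"
| "free_for t v (\<phi> \<^bold>\<and> \<psi>) \<longleftrightarrow> free_for t v \<phi> \<and> free_for t v \<psi>"
| "free_for t v (\<phi> \<^bold>\<or> \<psi>) \<longleftrightarrow> free_for t v \<phi> \<and> free_for t v \<psi>"
| "free_for t v (\<phi> \<^bold>\<longrightarrow> \<psi>) \<longleftrightarrow> free_for t v \<phi> \<and> free_for t v \<psi>"
| "free_for t v (Forall w \<phi>) \<longleftrightarrow> v \<notin> fv (Forall w \<phi>) \<or> (w \<notin> trm_vars t \<and> free_for t v \<phi>)"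
| "free_for t v (Exists w \<phi>) \<longleftrightarrow> v \<notin> fv (Exists w \<phi>) \<or> (w \<notin> trm_vars t \<and> free_for t v \<phi>)"

fun ty_le :: "ty \<Rightarrow> nat \<Rightarrow> bool" where
  "ty_le Omega n \<longleftrightarrow> True"
| "ty_le (Ty k) n \<longleftrightarrow> k \<le> n"

primrec elementary :: "nat \<Rightarrow> form \<Rightarrow> bool" where
  "elementary n (Ap a b c) \<longleftrightarrow>
     ty_le (trm_ty a) n \<and> ty_le (trm_ty b) n \<and> ty_le (trm_ty c) n"
| "elementary n (Eq s a b) \<longleftrightarrow>
     ty_le s n \<and> s \<noteq> Ty n \<and> ty_le (trm_ty a) n \<and> ty_le (trm_ty b) n"
| "elementary n (Mem k a b) \<longleftrightarrow>
     Suc k \<le> n \<and> ty_le (trm_ty a) n \<and> ty_le (trm_ty b) n"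
| "elementary n \<^bold>\<bottom> \<longleftrightarrow> True"
| "elementary n (\<phi> \<^bold>\<and> \<psi>) \<longleftrightarrow> elementary n \<phi> \<and> elementary n \<psi>"
| "elementary n (\<phi> \<^bold>\<or> \<psi>) \<longleftrightarrow> elementary n \<phi> \<and> elementary n \<psi>"
| "elementary n (\<phi> \<^bold>\<longrightarrow> \<psi>) \<longleftrightarrow> elementary n \<phi> \<and> elementary n \<psi>"
| "elementary n (Forall v \<phi>) \<longleftrightarrow> ty_le (vty v) n \<and> vty v \<noteq> Ty n \<and> elementary n \<phi>"
| "elementary n (Exists v \<phi>) \<longleftrightarrow> ty_le (vty v) n \<and> vty v \<noteq> Ty n \<and> elementary n \<phi>"


section \<open>External terms\<close>

datatype ext = At trm | App ext ext  (infixl \<open>\<cdot>\<close> 80)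

primrec ext_vars :: "ext \<Rightarrow> var set" where
  "ext_vars (At a) = trm_vars a"
| "ext_vars (t \<cdot> u) = ext_vars t \<union> ext_vars u"

definition fresh_idx :: "var set \<Rightarrow> nat" where
  "fresh_idx S = Suc (Max (insert 0 (vidx ` S)))"

text \<open>
  \<open>evalto t x\<close> is \<open>t \<simeq> x\<close> for a variable \<open>x\<close> of type 0. The bound variables are chosen fresh; the
  particular choice is irrelevant up to provable equivalence.
\<close>

primrec evalto :: "ext \<Rightarrow> var \<Rightarrow> form" where
  "evalto (At a) x = Eq (trm_ty a) (Var x) a"
| "evalto (t \<cdot> u) x =
    (let i = fresh_idx (insert x (ext_vars t \<union> ext_vars u));
         y = V (Ty 0) i; z = V (Ty 0) (Suc i)
     in Exists y (Exists z (evalto t y \<^bold>\<and> evalto u z \<^bold>\<and> Ap (Var y) (Var z) (Var x))))"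

definition defined :: "ext \<Rightarrow> form" where
  "defined t = (let x = V (Ty 0) (fresh_idx (ext_vars t)) in Exists x (evalto t x))"

text \<open>
  \<open>t \<simeq> u\<close> for arbitrary external terms. For \<open>t\<close> and \<open>u\<close> variables of one type \<open>s\<close> this is
  the defined equality \<open>t =\<^sub>s u\<close>.
\<close>

definition simeq :: "ext \<Rightarrow> ext \<Rightarrow> form"  (infix \<open>\<^bold>\<simeq>\<close> 60) where
  "t \<^bold>\<simeq> u = (let x = V (Ty 0) (fresh_idx (ext_vars t \<union> ext_vars u))
           in Exists x (evalto t x \<^bold>\<and> evalto u x))"

definition kleene_eq :: "ext \<Rightarrow> ext \<Rightarrow> form"  (infix \<open>\<^bold>\<cong>\<close> 60) where
  "t \<^bold>\<cong> u = (let x = V (Ty 0) (fresh_idx (ext_vars t \<union> ext_vars u))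
           in Forall x (evalto t x \<^bold>\<longleftrightarrow> evalto u x))"

abbreviation cst :: "const \<Rightarrow> ext" where
  "cst c \<equiv> At (Con c)"

abbreviation vr :: "var \<Rightarrow> ext" where
  "vr v \<equiv> At (Var v)"

text \<open>\<open>t(u\<^sub>1, \<dots>, u\<^sub>n)\<close>; with an empty list of arguments it is \<open>t\<close> itself.\<close>

fun app_tuple :: "ext \<Rightarrow> ext list \<Rightarrow> ext" where
  "app_tuple t [] = t"
| "app_tuple t (u # us) = t \<cdot> foldl (\<lambda>a b. cst CP \<cdot> a \<cdot> b) u us"


section \<open>Goedel numbering\<close>

primrec ty_code :: "ty \<Rightarrow> nat" where
  "ty_code Omega = 0"
| "ty_code (Ty k) = Suc k"

primrec var_code :: "var \<Rightarrow> nat" where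
  "var_code (V s i) = prod_encode (ty_code s, i)"

primrec const_code :: "const \<Rightarrow> nat" where
  "const_code Zero = prod_encode (0, 0)"
| "const_code CK = prod_encode (1, 0)"
| "const_code CS = prod_encode (2, 0)"
| "const_code CD = prod_encode (3, 0)"
| "const_code CP = prod_encode (4, 0)"
| "const_code CP1 = prod_encode (5, 0)"
| "const_code CP2 = prod_encode (6, 0)"
| "const_code (CC n) = prod_encode (7, n)"

primrec trm_code :: "trm \<Rightarrow> nat" where
  "trm_code (Var v) = prod_encode (0, var_code v)"
| "trm_code (Con c) = prod_encode (1, const_code c)"

primrec form_code :: "form \<Rightarrow> nat" where
  "form_code (Ap a b c) =
     prod_encode (0, prod_encode (trm_code a, prod_encode (trm_code b, trm_code c)))"
| "form_code (Eq s a b) =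
     prod_encode (1, prod_encode (ty_code s, prod_encode (trm_code a, trm_code b)))"
| "form_code (Mem k a b) =
     prod_encode (2, prod_encode (k, prod_encode (trm_code a, trm_code b)))"
| "form_code \<^bold>\<bottom> = prod_encode (3, 0)"
| "form_code (\<phi> \<^bold>\<and> \<psi>) = prod_encode (4, prod_encode (form_code \<phi>, form_code \<psi>))"
| "form_code (\<phi> \<^bold>\<or> \<psi>) = prod_encode (5, prod_encode (form_code \<phi>, form_code \<psi>))"
| "form_code (\<phi> \<^bold>\<longrightarrow> \<psi>) = prod_encode (6, prod_encode (form_code \<phi>, form_code \<psi>))"
| "form_code (Forall v \<phi>) = prod_encode (7, prod_encode (var_code v, form_code \<phi>))"
| "form_code (Exists v \<phi>) = prod_encode (8, prod_encode (var_code v, form_code \<phi>))"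

text \<open>The number of the expression \<open>Z.Xs.\<phi>\<close>.\<close>

definition goedel :: "var \<Rightarrow> var list \<Rightarrow> form \<Rightarrow> nat" where
  "goedel Z Xs \<phi> =
     prod_encode (var_code Z, prod_encode (list_encode (map var_code Xs), form_code \<phi>))"

lemma ty_code_inject: "ty_code s = ty_code t \<longleftrightarrow> s = t"
  by (cases s; cases t) auto

lemma var_code_inject: "var_code v = var_code w \<longleftrightarrow> v = w"
  by (cases v; cases w) (auto simp: ty_code_inject)

lemma const_code_inject: "const_code c = const_code d \<longleftrightarrow> c = d"
  by (cases c; cases d) auto

lemma trm_code_inject: "trm_code a = trm_code b \<longleftrightarrow> a = b"
  by (cases a; cases b) (auto simp: var_code_inject const_code_inject)

lemma form_code_inject: "form_code \<phi> = form_code \<psi> \<longleftrightarrow> \<phi> = \<psi>"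
proof (induction \<phi> arbitrary: \<psi>)
  case (Ap a b c) then show ?case by (cases \<psi>) (auto simp: trm_code_inject)
next
  case (Eq s a b) then show ?case by (cases \<psi>) (auto simp: trm_code_inject ty_code_inject)
next
  case (Mem k a b) then show ?case by (cases \<psi>) (auto simp: trm_code_inject)
next
  case Bot then show ?case by (cases \<psi>) auto
next
  case (And \<phi>1 \<phi>2) then show ?case by (cases \<psi>) auto
next
  case (Or \<phi>1 \<phi>2) then show ?case by (cases \<psi>) auto
next
  case (Imp \<phi>1 \<phi>2) then show ?case by (cases \<psi>) auto
next
  case (Forall v \<phi>) then show ?case by (cases \<psi>) (auto simp: var_code_inject)
next
  case (Exists v \<phi>) then show ?case by (cases \<psi>) (auto simp: var_code_inject)
qed

lemma goedel_inject:
  "goedel Z Xs \<phi> = goedel Z' Xs' \<phi>' \<longleftrightarrow> Z = Z' \<and> Xs = Xs' \<and> \<phi> = \<phi>'"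
proof -
  have "inj var_code" by (simp add: inj_def var_code_inject)
  then show ?thesis
    by (auto simp: goedel_def var_code_inject form_code_inject list_encode_eq inj_map_eq_map)
qed


section \<open>Axioms and provability\<close>

text \<open>
  Axiom schemata of the intuitionistic Hilbert calculus. Well-formedness of the instances is
  imposed in \<open>BT\<close>, for these and the other axioms.
\<close>

inductive logic_ax :: "form \<Rightarrow> bool" where
  ax_impK: "logic_ax (\<phi> \<^bold>\<longrightarrow> \<psi> \<^bold>\<longrightarrow> \<phi>)"
| ax_impS: "logic_ax ((\<phi> \<^bold>\<longrightarrow> \<psi> \<^bold>\<longrightarrow> \<chi>) \<^bold>\<longrightarrow> (\<phi> \<^bold>\<longrightarrow> \<psi>) \<^bold>\<longrightarrow> \<phi> \<^bold>\<longrightarrow> \<chi>)"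
| ax_andI: "logic_ax (\<phi> \<^bold>\<longrightarrow> \<psi> \<^bold>\<longrightarrow> \<phi> \<^bold>\<and> \<psi>)"
| ax_andE1: "logic_ax (\<phi> \<^bold>\<and> \<psi> \<^bold>\<longrightarrow> \<phi>)"
| ax_andE2: "logic_ax (\<phi> \<^bold>\<and> \<psi> \<^bold>\<longrightarrow> \<psi>)"
| ax_orI1: "logic_ax (\<phi> \<^bold>\<longrightarrow> \<phi> \<^bold>\<or> \<psi>)"
| ax_orI2: "logic_ax (\<psi> \<^bold>\<longrightarrow> \<phi> \<^bold>\<or> \<psi>)"
| ax_orE: "logic_ax ((\<phi> \<^bold>\<longrightarrow> \<chi>) \<^bold>\<longrightarrow> (\<psi> \<^bold>\<longrightarrow> \<chi>) \<^bold>\<longrightarrow> \<phi> \<^bold>\<or> \<psi> \<^bold>\<longrightarrow> \<chi>)"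
| ax_botE: "logic_ax (\<^bold>\<bottom> \<^bold>\<longrightarrow> \<phi>)"
| ax_allE: "trm_ty t = vty v \<Longrightarrow> free_for t v \<phi> \<Longrightarrow> logic_ax (Forall v \<phi> \<^bold>\<longrightarrow> subst v t \<phi>)"
| ax_exI: "trm_ty t = vty v \<Longrightarrow> free_for t v \<phi> \<Longrightarrow> logic_ax (subst v t \<phi> \<^bold>\<longrightarrow> Exists v \<phi>)"

abbreviation nvar :: "nat \<Rightarrow> var" where
  "nvar i \<equiv> V Omega i"

abbreviation ovar :: "nat \<Rightarrow> var" where
  "ovar i \<equiv> V (Ty 0) i"

inductive eq_ax :: "form \<Rightarrow> bool" where
  eq_refl: "x = ovar i \<Longrightarrow> eq_ax (Eq (Ty 0) (Var x) (Var x))"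
| eq_trans: "\<lbrakk>u = ovar i; v = ovar j; A = V (Ty k) a; B = V (Ty n) b\<rbrakk> \<Longrightarrow>
    eq_ax (Eq (Ty k) (Var u) (Var A) \<^bold>\<and> Eq (Ty k) (Var v) (Var A) \<^bold>\<and> Eq (Ty n) (Var u) (Var B)
      \<^bold>\<longrightarrow> Eq (Ty n) (Var v) (Var B))"
| eq_num: "\<lbrakk>u = ovar i; v = ovar j; m = nvar l\<rbrakk> \<Longrightarrow>
    eq_ax (Eq Omega (Var u) (Var m) \<^bold>\<and> Eq Omega (Var v) (Var m) \<^bold>\<longrightarrow> Eq (Ty 0) (Var u) (Var v))"
| eq_num_cong: "\<lbrakk>u = ovar i; v = ovar j; m = nvar l\<rbrakk> \<Longrightarrow>
    eq_ax (Eq Omega (Var u) (Var m) \<^bold>\<and> Eq (Ty 0) (Var u) (Var v) \<^bold>\<longrightarrow> Eq Omega (Var v) (Var m))"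
| eq_Ap: "\<lbrakk>f = ovar i\<^sub>1; x = ovar i\<^sub>2; y = ovar i\<^sub>3; g = ovar i\<^sub>4; u = ovar i\<^sub>5; v = ovar i\<^sub>6\<rbrakk> \<Longrightarrow>
    eq_ax (Ap (Var f) (Var x) (Var y) \<^bold>\<and> Eq (Ty 0) (Var f) (Var g) \<^bold>\<and> Eq (Ty 0) (Var x) (Var u)
      \<^bold>\<and> Eq (Ty 0) (Var y) (Var v) \<^bold>\<longrightarrow> Ap (Var g) (Var u) (Var v))"
| eq_Mem: "\<lbrakk>A = V (Ty k) a; U = V (Ty k) b; B = V (Ty (Suc k)) c; W = V (Ty (Suc k)) d\<rbrakk> \<Longrightarrow>
    eq_ax (Mem k (Var A) (Var B) \<^bold>\<and> vr A \<^bold>\<simeq> vr U \<^bold>\<and> vr B \<^bold>\<simeq> vr W \<^bold>\<longrightarrow> Mem k (Var U) (Var W))"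

inductive comb_ax :: "form \<Rightarrow> bool" where
  Ap_functional: "\<lbrakk>f = ovar h; x = ovar i; y = ovar j; z = ovar l\<rbrakk> \<Longrightarrow>
    comb_ax (Ap (Var f) (Var x) (Var y) \<^bold>\<and> Ap (Var f) (Var x) (Var z)
      \<^bold>\<longrightarrow> Eq (Ty 0) (Var y) (Var z))"
| k_eq: "\<lbrakk>x = ovar i; y = ovar j\<rbrakk> \<Longrightarrow> comb_ax (evalto (cst CK \<cdot> vr x \<cdot> vr y) x)"
| s_def: "\<lbrakk>x = ovar i; y = ovar j\<rbrakk> \<Longrightarrow> comb_ax (defined (cst CS \<cdot> vr x \<cdot> vr y))"
| s_eq: "\<lbrakk>x = ovar i; y = ovar j; z = ovar l\<rbrakk> \<Longrightarrow>
    comb_ax (cst CS \<cdot> vr x \<cdot> vr y \<cdot> vr z \<^bold>\<cong> vr x \<cdot> vr z \<cdot> (vr y \<cdot> vr z))"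
| p_def: "\<lbrakk>x = ovar i; y = ovar j\<rbrakk> \<Longrightarrow> comb_ax (defined (cst CP \<cdot> vr x \<cdot> vr y))"
| p_nonzero: "\<lbrakk>x = ovar i; y = ovar j\<rbrakk> \<Longrightarrow> comb_ax (\<^bold>\<not> (cst CP \<cdot> vr x \<cdot> vr y \<^bold>\<simeq> cst Zero))"
| p1_def: "x = ovar i \<Longrightarrow> comb_ax (defined (cst CP1 \<cdot> vr x))"
| p2_def: "x = ovar i \<Longrightarrow> comb_ax (defined (cst CP2 \<cdot> vr x))"
| p1_eq: "\<lbrakk>x = ovar i; y = ovar j\<rbrakk> \<Longrightarrow> comb_ax (evalto (cst CP1 \<cdot> (cst CP \<cdot> vr x \<cdot> vr y)) x)"
| p2_eq: "\<lbrakk>x = ovar i; y = ovar j\<rbrakk> \<Longrightarrow> comb_ax (evalto (cst CP2 \<cdot> (cst CP \<cdot> vr x \<cdot> vr y)) y)"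
| p_num: "\<lbrakk>n = nvar i; m = nvar j; m \<noteq> n\<rbrakk> \<Longrightarrow>
    comb_ax (Exists m (cst CP \<cdot> vr n \<cdot> cst Zero \<^bold>\<simeq> vr m))"
| p_type: "\<lbrakk>x = ovar i; A = V (Ty k) a; B = V (Ty k) b; B \<noteq> x; B \<noteq> A\<rbrakk> \<Longrightarrow>
    comb_ax (Exists B (cst CP \<cdot> vr x \<cdot> vr A \<^bold>\<simeq> vr B))"
| d_eq: "\<lbrakk>x = ovar i; y = ovar j; n = nvar h; m = nvar l\<rbrakk> \<Longrightarrow>
    comb_ax (vr n \<^bold>\<simeq> vr m \<^bold>\<longrightarrow> evalto (cst CD \<cdot> vr x \<cdot> vr y \<cdot> vr n \<cdot> vr m) x)"
| d_neq: "\<lbrakk>x = ovar i; y = ovar j; n = nvar h; m = nvar l\<rbrakk> \<Longrightarrow>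
    comb_ax (\<^bold>\<not> (vr n \<^bold>\<simeq> vr m) \<^bold>\<longrightarrow> evalto (cst CD \<cdot> vr x \<cdot> vr y \<cdot> vr n \<cdot> vr m) y)"
| num_op: "\<lbrakk>x = ovar i; n = nvar j\<rbrakk> \<Longrightarrow> comb_ax (Exists x (Eq Omega (Var x) (Var n)))"
| type_op: "\<lbrakk>x = ovar i; A = V (Ty k) a; x \<noteq> A\<rbrakk> \<Longrightarrow> comb_ax (Exists x (Eq (Ty k) (Var x) (Var A)))"

inductive compr_ax :: "form \<Rightarrow> bool" where
  comprehension:
    "\<lbrakk>Z = V (Ty k) i; U = V (Ty (Suc k)) j; \<forall>v \<in> set Xs. ty_le (vty v) (Suc k);
      distinct (Z # Xs); U \<notin> set Xs;
      elementary (Suc k) \<phi>; fv \<phi> \<subseteq> set (Z # Xs); n = goedel Z Xs \<phi>\<rbrakk> \<Longrightarrow>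
    compr_ax (Exists U (app_tuple (cst (CC n)) (map vr Xs) \<^bold>\<simeq> vr U
      \<^bold>\<and> Forall Z (Mem k (Var Z) (Var U) \<^bold>\<longleftrightarrow> \<phi>)))"

inductive BT :: "form \<Rightarrow> bool"  (\<open>\<turnstile>\<^sub>B\<^sub>T _\<close> [51] 50) where
  by_logic: "logic_ax \<phi> \<Longrightarrow> wff \<phi> \<Longrightarrow> \<turnstile>\<^sub>B\<^sub>T \<phi>"
| by_equality: "eq_ax \<phi> \<Longrightarrow> wff \<phi> \<Longrightarrow> \<turnstile>\<^sub>B\<^sub>T \<phi>"
| by_combinatorial: "comb_ax \<phi> \<Longrightarrow> wff \<phi> \<Longrightarrow> \<turnstile>\<^sub>B\<^sub>T \<phi>"
| by_comprehension: "compr_ax \<phi> \<Longrightarrow> wff \<phi> \<Longrightarrow> \<turnstile>\<^sub>B\<^sub>T \<phi>"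
| rule_mp: "\<turnstile>\<^sub>B\<^sub>T (\<phi> \<^bold>\<longrightarrow> \<psi>) \<Longrightarrow> \<turnstile>\<^sub>B\<^sub>T \<phi> \<Longrightarrow> \<turnstile>\<^sub>B\<^sub>T \<psi>"
| rule_all: "\<turnstile>\<^sub>B\<^sub>T (\<psi> \<^bold>\<longrightarrow> \<phi>) \<Longrightarrow> v \<notin> fv \<psi> \<Longrightarrow> \<turnstile>\<^sub>B\<^sub>T (\<psi> \<^bold>\<longrightarrow> Forall v \<phi>)"
| rule_ex: "\<turnstile>\<^sub>B\<^sub>T (\<phi> \<^bold>\<longrightarrow> \<psi>) \<Longrightarrow> v \<notin> fv \<psi> \<Longrightarrow> \<turnstile>\<^sub>B\<^sub>T (Exists v \<phi> \<^bold>\<longrightarrow> \<psi>)"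
| rule_induction:
    "\<lbrakk>n = nvar i; m = nvar j; m \<noteq> n; m \<notin> fv \<phi>; free_for (Var m) n \<phi>;
      \<turnstile>\<^sub>B\<^sub>T subst n (Con Zero) \<phi>;
      \<turnstile>\<^sub>B\<^sub>T (\<phi> \<^bold>\<longrightarrow> Exists m (cst CP \<cdot> vr n \<cdot> cst Zero \<^bold>\<simeq> vr m \<^bold>\<and> subst n (Var m) \<phi>))\<rbrakk> \<Longrightarrow>
    \<turnstile>\<^sub>B\<^sub>T \<phi>"

end

theory Submission
  imports Defs
begin

text \<open>
  The proof is Aczel's slash, over a term model of the combinatory part. Values are closed external
  terms in normal form, with a deterministic application \<open>eval\<close>; the objects of type \<open>\<omega>\<close>
  are the numerals, and those of type \<open>k + 1\<close> are generated from comprehension terms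
  \<open>c\<^sub>n(t\<^sub>1, \<dots>, t\<^sub>m)\<close> with values as arguments and by pairing. Application and equality are interpreted
  in the term model, \<open>z \<in> c\<^sub>n(t\<^sub>1, \<dots>, t\<^sub>m)\<close> by the slash of the formula with number \<open>n\<close>, and
  implications and universal formulas are moreover required to be derivable. This is well-founded:
  a \<open>(k + 1)\<close>-elementary formula quantifies only over types below \<open>k + 1\<close>, so the sets of type
  \<open>k + 1\<close> it mentions are among the \<open>t\<^sub>i\<close>. Working with values rather than with closed terms up
  to provable equality avoids having to know which equations \<open>BT\<close> proves. Theorems of \<open>BT\<close> are
  slashed, a slashed disjunction has a slashed disjunct, and slashed sentences are derivable.

  As there are no terms for values in the language, \<open>\<phi>(t\<^sub>1, \<dots>, t\<^sub>m)\<close> is expressed as derivability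
  of \<open>\<phi>\<close> from the hypotheses \<open>t\<^sub>i \<simeq> x\<^sub>i\<close>.
\<close>

section \<open>Variables and substitution\<close>

text \<open>Without the demand of derivability a slashed formula would merely be true in the model,
  and a true disjunct need not be a theorem. For the atoms \<open>Ap\<close> and \<open>Eq\<close>
  derivability comes from the model itself: every value provably denotes an object of its type, and
  every computation step is a provable equation. This dictates what counts as a value.
  \<open>s x y\<close> is one because the axioms make it defined, \<open>s x\<close> and
  \<open>k x\<close> because a defined application has defined parts; \<open>d x y n\<close> only
  for a numeral \<open>n\<close>, and an applied comprehension constant only as a comprehension
  term, since otherwise no axiom provides definedness. Application in the model is therefore
  partial. Equality is identity of values, so the equality axioms are immediate; provable
  distinctness of distinct numerals is called for by the computation of \<open>d\<close>.
  Injectivity of the Goedel numbering makes membership in a comprehension term unambiguous.\<close>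

lemma finite_trm_vars [simp]: "finite (trm_vars a)"
  by (cases a) auto

lemma finite_fv [simp]: "finite (fv \<phi>)"
  by (induction \<phi>) auto

lemma finite_ext_vars [simp]: "finite (ext_vars t)"
  by (induction t) auto

text \<open>Every index from \<open>fresh_idx S\<close> on is new, for every type, so successive
  indices provide several fresh variables at once.\<close>

lemma fresh_idx_notin: "finite S \<Longrightarrow> fresh_idx S \<le> i \<Longrightarrow> V s i \<notin> S"
proof
  assume "finite S" "fresh_idx S \<le> i" "V s i \<in> S"
  then have "i \<le> Max (insert 0 (vidx ` S))"
    by (intro Max_ge) (auto intro!: image_eqI[of _ _ "V s i"])
  with \<open>fresh_idx S \<le> i\<close> show False by (simp add: fresh_idx_def)
qed

lemma ex_fresh: "finite S \<Longrightarrow> \<exists>i. V s i \<notin> S"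
  using fresh_idx_notin by blast

lemma trm_subst_Var_self [simp]: "trm_subst v (Var v) a = a"
  by (cases a) auto

lemma trm_subst_fresh: "v \<notin> trm_vars a \<Longrightarrow> trm_subst v t a = a"
  by (cases a) auto

lemma subst_Var_self [simp]: "subst v (Var v) \<phi> = \<phi>"
  by (induction \<phi>) auto

lemma subst_fresh: "v \<notin> fv \<phi> \<Longrightarrow> subst v t \<phi> = \<phi>"
  by (induction \<phi>) (auto simp: trm_subst_fresh)

lemma free_for_Var_self [simp]: "free_for (Var v) v \<phi>"
  by (induction \<phi>) auto

lemma trm_ty_subst: "trm_ty t = vty v \<Longrightarrow> trm_ty (trm_subst v t a) = trm_ty a"
  by (cases a) auto

lemma wff_subst [simp]: "trm_ty t = vty v \<Longrightarrow> wff (subst v t \<phi>) = wff \<phi>"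
  by (induction \<phi>) (auto simp: trm_ty_subst)

lemma BT_wff: "\<turnstile>\<^sub>B\<^sub>T \<phi> \<Longrightarrow> wff \<phi>"
  by (induction rule: BT.induct) auto

section \<open>Derivability from hypotheses\<close>

text \<open>Quantifier and induction rules enter only through theorems, so hypotheses are never
  generalised and the deduction theorem needs no condition on variables. Quantifier rules under
  hypotheses are recovered in \<open>ForallI\<close> and \<open>ExistsE\<close>.\<close>

inductive derives :: "form set \<Rightarrow> form \<Rightarrow> bool" (infix \<open>\<tturnstile>\<close> 50) for \<Gamma> where
  hyp: "\<phi> \<in> \<Gamma> \<Longrightarrow> wff \<phi> \<Longrightarrow> \<Gamma> \<tturnstile> \<phi>"
| theorem_: "\<turnstile>\<^sub>B\<^sub>T \<phi> \<Longrightarrow> \<Gamma> \<tturnstile> \<phi>"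
| mp: "\<Gamma> \<tturnstile> \<phi> \<^bold>\<longrightarrow> \<psi> \<Longrightarrow> \<Gamma> \<tturnstile> \<phi> \<Longrightarrow> \<Gamma> \<tturnstile> \<psi>"

lemma derives_wff: "\<Gamma> \<tturnstile> \<phi> \<Longrightarrow> wff \<phi>"
  by (induction rule: derives.induct) (auto dest: BT_wff)

lemma weaken: "\<Gamma> \<tturnstile> \<phi> \<Longrightarrow> \<Gamma> \<subseteq> \<Delta> \<Longrightarrow> \<Delta> \<tturnstile> \<phi>"
  by (induction rule: derives.induct) (auto intro: derives.intros)

lemma logic: "logic_ax \<phi> \<Longrightarrow> wff \<phi> \<Longrightarrow> \<Gamma> \<tturnstile> \<phi>"
  by (intro theorem_ by_logic)

lemma Imp_self: "wff \<phi> \<Longrightarrow> \<Gamma> \<tturnstile> \<phi> \<^bold>\<longrightarrow> \<phi>"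
  by (rule mp[OF mp[OF logic[OF ax_impS] logic[OF ax_impK]] logic[OF ax_impK[of \<phi> \<phi>]]]) auto

lemma Imp_const: "\<Gamma> \<tturnstile> \<psi> \<Longrightarrow> wff \<phi> \<Longrightarrow> \<Gamma> \<tturnstile> \<phi> \<^bold>\<longrightarrow> \<psi>"
  using logic[OF ax_impK[of \<psi> \<phi>]] derives_wff by (auto intro: mp)

lemma ImpI: "insert \<phi> \<Gamma> \<tturnstile> \<psi> \<Longrightarrow> wff \<phi> \<Longrightarrow> \<Gamma> \<tturnstile> \<phi> \<^bold>\<longrightarrow> \<psi>"
proof (induction rule: derives.induct)
  case (hyp \<psi>)
  then show ?case by (auto intro: Imp_self Imp_const derives.hyp)
next
  case (theorem_ \<psi>)
  then show ?case by (auto intro: Imp_const derives.theorem_)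
next
  case (mp \<psi> \<chi>)
  then have "wff (\<psi> \<^bold>\<longrightarrow> \<chi>)" using derives_wff by blast
  with mp show ?case
    using logic[OF ax_impS[of \<phi> \<psi> \<chi>], of \<Gamma>] by (auto intro: derives.mp)
qed

lemma derives_empty: "{} \<tturnstile> \<phi> \<longleftrightarrow> \<turnstile>\<^sub>B\<^sub>T \<phi>"
proof
  show "\<turnstile>\<^sub>B\<^sub>T \<phi>" if "{} \<tturnstile> \<phi>"
    using that by (induction rule: derives.induct) (auto intro: rule_mp)
qed (rule theorem_)

lemma ImpD:
  assumes "\<Gamma> \<tturnstile> \<phi> \<^bold>\<longrightarrow> \<psi>"
  shows "insert \<phi> \<Gamma> \<tturnstile> \<psi>"
proof (rule mp)
  show "insert \<phi> \<Gamma> \<tturnstile> \<phi> \<^bold>\<longrightarrow> \<psi>" using assms by (rule weaken) blast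
  show "insert \<phi> \<Gamma> \<tturnstile> \<phi>" using derives_wff[OF assms] by (auto intro: hyp)
qed

lemma cut: "insert \<phi> \<Gamma> \<tturnstile> \<psi> \<Longrightarrow> \<Gamma> \<tturnstile> \<phi> \<Longrightarrow> \<Gamma> \<tturnstile> \<psi>"
  by (meson ImpI derives_wff mp)

lemma theorem_mp: "\<turnstile>\<^sub>B\<^sub>T \<phi> \<^bold>\<longrightarrow> \<psi> \<Longrightarrow> \<Gamma> \<tturnstile> \<phi> \<Longrightarrow> \<Gamma> \<tturnstile> \<psi>"
  by (blast intro: theorem_ mp)

text \<open>Typical use: a consequence is derived from a few explicit hypotheses, whose free
  variables are known, and then moved to an arbitrary \<Gamma>, in which every variable may be
  free.\<close>

lemma cut_all: "\<Gamma> \<union> \<Delta> \<tturnstile> \<phi> \<Longrightarrow> (\<And>\<delta>. \<delta> \<in> \<Delta> \<Longrightarrow> \<Gamma> \<tturnstile> \<delta>) \<Longrightarrow> \<Gamma> \<tturnstile> \<phi>"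
  by (induction rule: derives.induct) (auto intro: derives.intros)

lemma AndI: "\<Gamma> \<tturnstile> \<phi> \<Longrightarrow> \<Gamma> \<tturnstile> \<psi> \<Longrightarrow> \<Gamma> \<tturnstile> \<phi> \<^bold>\<and> \<psi>"
  using logic[OF ax_andI[of \<phi> \<psi>], of \<Gamma>] derives_wff[of \<Gamma> \<phi>] derives_wff[of \<Gamma> \<psi>]
  by (auto intro: mp)

lemma AndE1: "\<Gamma> \<tturnstile> \<phi> \<^bold>\<and> \<psi> \<Longrightarrow> \<Gamma> \<tturnstile> \<phi>"
  using logic[OF ax_andE1[of \<phi> \<psi>], of \<Gamma>] derives_wff[of \<Gamma> "\<phi> \<^bold>\<and> \<psi>"] by (auto intro: mp)

lemma AndE2: "\<Gamma> \<tturnstile> \<phi> \<^bold>\<and> \<psi> \<Longrightarrow> \<Gamma> \<tturnstile> \<psi>"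
  using logic[OF ax_andE2[of \<phi> \<psi>], of \<Gamma>] derives_wff[of \<Gamma> "\<phi> \<^bold>\<and> \<psi>"] by (auto intro: mp)

lemma OrI1: "\<Gamma> \<tturnstile> \<phi> \<Longrightarrow> wff \<psi> \<Longrightarrow> \<Gamma> \<tturnstile> \<phi> \<^bold>\<or> \<psi>"
  using logic[OF ax_orI1[of \<phi> \<psi>], of \<Gamma>] derives_wff[of \<Gamma> "\<phi>"] by (auto intro: mp)

lemma OrI2: "\<Gamma> \<tturnstile> \<psi> \<Longrightarrow> wff \<phi> \<Longrightarrow> \<Gamma> \<tturnstile> \<phi> \<^bold>\<or> \<psi>"
  using logic[OF ax_orI2[of \<psi> \<phi>], of \<Gamma>] derives_wff[of \<Gamma> "\<psi>"] by (auto intro: mp)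

lemma OrE:
  assumes "\<Gamma> \<tturnstile> \<phi> \<^bold>\<or> \<psi>" "insert \<phi> \<Gamma> \<tturnstile> \<chi>" "insert \<psi> \<Gamma> \<tturnstile> \<chi>"
  shows "\<Gamma> \<tturnstile> \<chi>"
proof -
  have "wff \<phi>" "wff \<psi>" "wff \<chi>" using assms derives_wff by force+
  then have "\<Gamma> \<tturnstile> (\<phi> \<^bold>\<longrightarrow> \<chi>) \<^bold>\<longrightarrow> (\<psi> \<^bold>\<longrightarrow> \<chi>) \<^bold>\<longrightarrow> \<phi> \<^bold>\<or> \<psi> \<^bold>\<longrightarrow> \<chi>"
    by (intro logic ax_orE) auto
  with assms \<open>wff \<phi>\<close> \<open>wff \<psi>\<close> show ?thesis by (meson ImpI mp)
qed

text \<open>\<open>rule_all\<close> and \<open>rule_ex\<close> allow a single side formula. The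
  conjunction of the hypotheses used is such a formula, and it has no further free
  variables.\<close>

lemma derives_by_formula:
  "\<Gamma> \<tturnstile> \<phi> \<Longrightarrow> \<exists>\<beta>. fv \<beta> \<subseteq> \<Union>(fv ` \<Gamma>) \<and> \<Gamma> \<tturnstile> \<beta> \<and> {} \<tturnstile> \<beta> \<^bold>\<longrightarrow> \<phi>"
proof (induction rule: derives.induct)
  case (hyp \<phi>)
  then show ?case by (intro exI[of _ \<phi>]) (auto intro: derives.hyp Imp_self)
next
  case (theorem_ \<phi>)
  then show ?case
    \<comment> \<open>The empty conjunction: a closed theorem.\<close>
    by (intro exI[of _ "\<^bold>\<bottom> \<^bold>\<longrightarrow> \<^bold>\<bottom>"]) (auto intro: Imp_self Imp_const derives.theorem_)
next
  case (mp \<phi> \<psi>)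
  then obtain \<beta> \<gamma> where b: "fv \<beta> \<subseteq> \<Union>(fv ` \<Gamma>)" "\<Gamma> \<tturnstile> \<beta>" "{} \<tturnstile> \<beta> \<^bold>\<longrightarrow> \<phi> \<^bold>\<longrightarrow> \<psi>"
    "fv \<gamma> \<subseteq> \<Union>(fv ` \<Gamma>)" "\<Gamma> \<tturnstile> \<gamma>" "{} \<tturnstile> \<gamma> \<^bold>\<longrightarrow> \<phi>"
    by blast
  let ?H = "{\<beta> \<^bold>\<and> \<gamma>}"
  have w: "wff (\<beta> \<^bold>\<and> \<gamma>)" using b derives_wff by auto
  then have "?H \<tturnstile> \<beta> \<^bold>\<and> \<gamma>" by (auto intro: derives.hyp)
  then have "?H \<tturnstile> \<beta>" "?H \<tturnstile> \<gamma>" by (auto intro: AndE1 AndE2)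
  moreover have "?H \<tturnstile> \<beta> \<^bold>\<longrightarrow> \<phi> \<^bold>\<longrightarrow> \<psi>" "?H \<tturnstile> \<gamma> \<^bold>\<longrightarrow> \<phi>" using b weaken by blast+
  ultimately have "?H \<tturnstile> \<psi>" by (blast intro: derives.mp)
  with w b show ?case by (intro exI[of _ "\<beta> \<^bold>\<and> \<gamma>"]) (auto intro: ImpI AndI)
qed

lemma ForallI:
  assumes "\<Gamma> \<tturnstile> \<phi>" "\<And>\<gamma>. \<gamma> \<in> \<Gamma> \<Longrightarrow> v \<notin> fv \<gamma>"
  shows "\<Gamma> \<tturnstile> Forall v \<phi>"
proof -
  obtain \<beta> where "fv \<beta> \<subseteq> \<Union>(fv ` \<Gamma>)" "\<Gamma> \<tturnstile> \<beta>" "{} \<tturnstile> \<beta> \<^bold>\<longrightarrow> \<phi>"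
    using derives_by_formula[OF assms(1)] by blast
  with assms(2) show ?thesis
    by (metis (no_types, lifting) UN_iff derives_empty mp rule_all subsetD theorem_)
qed

lemma Forall_inst:
  assumes "\<Gamma> \<tturnstile> Forall v \<phi>" "trm_ty t = vty v" "free_for t v \<phi>"
  shows "\<Gamma> \<tturnstile> subst v t \<phi>"
  using logic[OF ax_allE[OF assms(2,3)], of \<Gamma>] assms derives_wff[OF assms(1)] by (auto intro: mp)

lemma ForallE: "\<Gamma> \<tturnstile> Forall v \<phi> \<Longrightarrow> \<Gamma> \<tturnstile> \<phi>"
  using Forall_inst[of \<Gamma> v \<phi> "Var v"] by simp

lemma ExistsI_inst:
  assumes "\<Gamma> \<tturnstile> subst v t \<phi>" "trm_ty t = vty v" "free_for t v \<phi>"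
  shows "\<Gamma> \<tturnstile> Exists v \<phi>"
  using logic[OF ax_exI[OF assms(2,3)], of \<Gamma>] assms derives_wff[OF assms(1)] by (auto intro: mp)

lemma ExistsI: "\<Gamma> \<tturnstile> \<phi> \<Longrightarrow> \<Gamma> \<tturnstile> Exists v \<phi>"
  using ExistsI_inst[of \<Gamma> v "Var v" \<phi>] by simp

lemma ExistsE:
  assumes "\<Gamma> \<tturnstile> Exists v \<phi>" "insert \<phi> \<Gamma> \<tturnstile> \<chi>" "\<And>\<gamma>. \<gamma> \<in> \<Gamma> \<Longrightarrow> v \<notin> fv \<gamma>" "v \<notin> fv \<chi>"
  shows "\<Gamma> \<tturnstile> \<chi>"
proof -
  have "wff \<phi>" "wff \<chi>" using assms(1,2) derives_wff by force+
  then have "\<Gamma> \<tturnstile> \<phi> \<^bold>\<longrightarrow> \<chi>" using assms by (auto intro: ImpI)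
  then obtain \<beta> where b: "fv \<beta> \<subseteq> \<Union>(fv ` \<Gamma>)" "\<Gamma> \<tturnstile> \<beta>" "{} \<tturnstile> \<beta> \<^bold>\<longrightarrow> \<phi> \<^bold>\<longrightarrow> \<chi>"
    using derives_by_formula by blast
  then have "{\<beta>} \<tturnstile> \<phi> \<^bold>\<longrightarrow> \<chi>" by (metis ImpD)
  then have "{\<phi>, \<beta>} \<tturnstile> \<chi>" by (rule ImpD)
  \<comment> \<open>The two antecedents are exchanged, because \<open>rule_ex\<close> quantifies the
    outermost one.\<close>
  then have "{\<phi>} \<tturnstile> \<beta> \<^bold>\<longrightarrow> \<chi>" using b derives_wff by (auto intro!: ImpI simp: insert_commute)
  then have "{} \<tturnstile> \<phi> \<^bold>\<longrightarrow> \<beta> \<^bold>\<longrightarrow> \<chi>" using \<open>wff \<phi>\<close> by (rule ImpI)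
  moreover have "v \<notin> fv (\<beta> \<^bold>\<longrightarrow> \<chi>)" using b assms by auto
  ultimately have "\<Gamma> \<tturnstile> Exists v \<phi> \<^bold>\<longrightarrow> \<beta> \<^bold>\<longrightarrow> \<chi>" by (metis derives_empty rule_ex theorem_)
  with assms b show ?thesis by (blast intro: mp)
qed

text \<open>Reduces the infinitely many hypotheses attached to a total assignment to finitely
  many.\<close>

lemma derives_finite: "\<Gamma> \<tturnstile> \<phi> \<Longrightarrow> \<exists>\<Delta>\<subseteq>\<Gamma>. finite \<Delta> \<and> \<Delta> \<tturnstile> \<phi>"
proof (induction rule: derives.induct)
  case (hyp \<phi>)
  then show ?case by (intro exI[of _ "{\<phi>}"]) (auto intro: derives.hyp)
next
  case (theorem_ \<phi>)
  then show ?case by (intro exI[of _ "{}"]) (auto intro: derives.theorem_)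
next
  case (mp \<phi> \<psi>)
  then obtain \<Delta> \<Delta>' where "\<Delta> \<subseteq> \<Gamma>" "\<Delta>' \<subseteq> \<Gamma>" "finite \<Delta>" "finite \<Delta>'" "\<Delta> \<tturnstile> \<phi> \<^bold>\<longrightarrow> \<psi>" "\<Delta>' \<tturnstile> \<phi>"
    by blast
  then show ?case
    by (intro exI[of _ "\<Delta> \<union> \<Delta>'"]) (auto intro: derives.mp[OF weaken weaken])
qed

lemma inst:
  assumes "\<turnstile>\<^sub>B\<^sub>T \<phi>" "trm_ty t = vty v" "free_for t v \<phi>"
  shows "\<turnstile>\<^sub>B\<^sub>T subst v t \<phi>"
  using Forall_inst[OF ForallI[of "{}" \<phi> v] assms(2,3)] assms by (simp add: derives_empty)

text \<open>Axioms are stated for variables only; constants are reached by substitution.\<close>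

lemma all_terms:
  assumes "\<And>v. vty v = s \<Longrightarrow> \<turnstile>\<^sub>B\<^sub>T F (Var v)"
    and "finite S"
    and "\<And>c v. vty v = s \<Longrightarrow> v \<notin> S \<Longrightarrow>
      free_for (Con c) v (F (Var v)) \<and> subst v (Con c) (F (Var v)) = F (Con c)"
    and "trm_ty a = s"
  shows "\<turnstile>\<^sub>B\<^sub>T F a"
proof (cases a)
  case (Var v)
  with assms show ?thesis by auto
next
  case (Con c)
  \<comment> \<open>A variable outside \<open>S\<close> occurs in no other argument, so substituting
    for it changes this argument only.\<close>
  obtain i where "V s i \<notin> S" using ex_fresh[OF assms(2)] by blast
  then have "free_for (Con c) (V s i) (F (Var (V s i)))"
    "subst (V s i) (Con c) (F (Var (V s i))) = F (Con c)"
    using assms(3)[of "V s i" c] by auto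
  with inst[OF assms(1), of "V s i" "Con c" "V s i"] Con assms(4) show ?thesis by simp
qed

section \<open>Equality and evaluation of external terms\<close>

lemma eq_refl_trm:
  assumes "trm_ty a = Ty 0"
  shows "\<Gamma> \<tturnstile> Eq (Ty 0) a a"
proof (rule theorem_, rule all_terms[of "Ty 0" "\<lambda>a. Eq (Ty 0) a a" "{}", OF _ _ _ assms])
  show "\<turnstile>\<^sub>B\<^sub>T Eq (Ty 0) (Var v) (Var v)" if "vty v = Ty 0" for v
    using that by (cases v) (auto intro!: by_equality eq_ax.intros)
qed auto

text \<open>The axioms treat \<omega> and the numbered types differently; this lemma and
  \<open>eq_common\<close> make equality uniform in the type \<open>s\<close>.\<close>

lemma eq_transport:
  assumes "trm_ty x = Ty 0" "trm_ty y = Ty 0" "trm_ty a = s"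
    and "\<Gamma> \<tturnstile> Eq s x a" "\<Gamma> \<tturnstile> Eq (Ty 0) x y"
  shows "\<Gamma> \<tturnstile> Eq s y a"
proof -
  let ?F = "\<lambda>x y a. Eq s x a \<^bold>\<and> Eq (Ty 0) x y \<^bold>\<longrightarrow> Eq s y a"
  have vars: "\<turnstile>\<^sub>B\<^sub>T ?F (Var x) (Var y) (Var a)"
    if "vty x = Ty 0" "vty y = Ty 0" "vty a = s" for x y a
  proof (cases s)
    case Omega
    with that show ?thesis by (cases x; cases y; cases a) (auto intro!: by_equality eq_num_cong)
  next
    case (Ty k)
    let ?H = "{Eq s (Var x) (Var a) \<^bold>\<and> Eq (Ty 0) (Var x) (Var y)}"
    have "?H \<tturnstile> Eq s (Var x) (Var a) \<^bold>\<and> Eq (Ty 0) (Var x) (Var y)" using that by (auto intro: hyp)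
    then have "?H \<tturnstile> Eq s (Var x) (Var a)" "?H \<tturnstile> Eq (Ty 0) (Var x) (Var y)"
      by (auto intro: AndE1 AndE2)
    moreover have "?H \<tturnstile> Eq (Ty 0) (Var y) (Var y)" using that eq_refl_trm by simp
    ultimately have "?H \<tturnstile> Eq (Ty 0) (Var x) (Var y) \<^bold>\<and> Eq (Ty 0) (Var y) (Var y) \<^bold>\<and> Eq s (Var x) (Var a)"
      by (intro AndI)
    \<comment> \<open>\<open>eq_trans\<close> with first type 0 and y as the common object; its
      second premise becomes y = y.\<close>
    moreover have "?H \<tturnstile> Eq (Ty 0) (Var x) (Var y) \<^bold>\<and> Eq (Ty 0) (Var y) (Var y) \<^bold>\<and> Eq s (Var x) (Var a)
      \<^bold>\<longrightarrow> Eq s (Var y) (Var a)"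
      using that Ty by (intro theorem_ by_equality, cases x; cases y; cases a) (auto intro!: eq_trans)
    ultimately have "?H \<tturnstile> Eq s (Var y) (Var a)" by (blast intro: mp)
    then show ?thesis using that by (auto intro!: ImpI simp flip: derives_empty)
  qed
  have v1: "\<turnstile>\<^sub>B\<^sub>T ?F x (Var y) (Var a)" if "vty y = Ty 0" "vty a = s" for y a
    by (rule all_terms[of "Ty 0" "\<lambda>x. ?F x (Var y) (Var a)" "{y, a}"]) (use vars that assms in \<open>auto\<close>)
  have v2: "\<turnstile>\<^sub>B\<^sub>T ?F x y (Var a)" if "vty a = s" for a
    by (rule all_terms[of "Ty 0" "\<lambda>y. ?F x y (Var a)" "trm_vars x \<union> {a}"]) (use v1 that assms in \<open>auto simp: trm_subst_fresh\<close>)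
  have "\<turnstile>\<^sub>B\<^sub>T ?F x y a"
    by (rule all_terms[of s "\<lambda>a. ?F x y a" "trm_vars x \<union> trm_vars y"]) (use v2 assms in \<open>auto simp: trm_subst_fresh\<close>)
  then show ?thesis by (rule theorem_mp) (intro AndI assms)
qed

lemma eq_sym0:
  assumes "trm_ty x = Ty 0" "trm_ty y = Ty 0" "\<Gamma> \<tturnstile> Eq (Ty 0) x y"
  shows "\<Gamma> \<tturnstile> Eq (Ty 0) y x"
  using eq_transport[OF assms(1,2) _ eq_refl_trm assms(3)] assms by auto

lemma eq_common:
  assumes "trm_ty x = Ty 0" "trm_ty y = Ty 0" "trm_ty a = s"
    and "\<Gamma> \<tturnstile> Eq s x a" "\<Gamma> \<tturnstile> Eq s y a"
  shows "\<Gamma> \<tturnstile> Eq (Ty 0) x y"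
proof -
  let ?F = "\<lambda>x y a. Eq s x a \<^bold>\<and> Eq s y a \<^bold>\<longrightarrow> Eq (Ty 0) x y"
  have vars: "\<turnstile>\<^sub>B\<^sub>T ?F (Var x) (Var y) (Var a)"
    if "vty x = Ty 0" "vty y = Ty 0" "vty a = s" for x y a
  proof (cases s)
    case Omega
    with that show ?thesis by (cases x; cases y; cases a) (auto intro!: by_equality eq_num)
  next
    case (Ty k)
    let ?H = "{Eq s (Var x) (Var a) \<^bold>\<and> Eq s (Var y) (Var a)}"
    have "?H \<tturnstile> Eq s (Var x) (Var a) \<^bold>\<and> Eq s (Var y) (Var a)" using that by (auto intro: hyp)
    then have "?H \<tturnstile> Eq s (Var x) (Var a)" "?H \<tturnstile> Eq s (Var y) (Var a)"
      by (auto intro: AndE1 AndE2)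
    moreover have "?H \<tturnstile> Eq (Ty 0) (Var x) (Var x)" using that eq_refl_trm by simp
    ultimately have "?H \<tturnstile> Eq s (Var x) (Var a) \<^bold>\<and> Eq s (Var y) (Var a) \<^bold>\<and> Eq (Ty 0) (Var x) (Var x)"
      by (intro AndI)
    \<comment> \<open>\<open>eq_trans\<close> with x itself as the last object, which turns a common
      object of type \<open>s\<close> into an equation of type 0.\<close>
    moreover have "?H \<tturnstile> Eq s (Var x) (Var a) \<^bold>\<and> Eq s (Var y) (Var a) \<^bold>\<and> Eq (Ty 0) (Var x) (Var x)
      \<^bold>\<longrightarrow> Eq (Ty 0) (Var y) (Var x)"
      using that Ty by (intro theorem_ by_equality, cases x; cases y; cases a) (auto intro!: eq_trans)
    ultimately have "?H \<tturnstile> Eq (Ty 0) (Var y) (Var x)" by (blast intro: mp)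
    then have "?H \<tturnstile> Eq (Ty 0) (Var x) (Var y)" using that eq_sym0 by simp
    then show ?thesis using that by (auto intro!: ImpI simp flip: derives_empty)
  qed
  have v3: "\<turnstile>\<^sub>B\<^sub>T ?F x (Var y) (Var a)" if "vty y = Ty 0" "vty a = s" for y a
    by (rule all_terms[of "Ty 0" "\<lambda>x. ?F x (Var y) (Var a)" "{y, a}"]) (use vars that assms in \<open>auto\<close>)
  have v4: "\<turnstile>\<^sub>B\<^sub>T ?F x y (Var a)" if "vty a = s" for a
    by (rule all_terms[of "Ty 0" "\<lambda>y. ?F x y (Var a)" "trm_vars x \<union> {a}"]) (use v3 that assms in \<open>auto simp: trm_subst_fresh\<close>)
  have "\<turnstile>\<^sub>B\<^sub>T ?F x y a"
    by (rule all_terms[of s "\<lambda>a. ?F x y a" "trm_vars x \<union> trm_vars y"]) (use v4 assms in \<open>auto simp: trm_subst_fresh\<close>)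
  then show ?thesis by (rule theorem_mp) (intro AndI assms)
qed

lemma Ap_cong:
  assumes "trm_ty f = Ty 0" "trm_ty x = Ty 0" "trm_ty y = Ty 0"
    "trm_ty g = Ty 0" "trm_ty u = Ty 0" "trm_ty v = Ty 0"
    and "\<Gamma> \<tturnstile> Ap f x y" "\<Gamma> \<tturnstile> Eq (Ty 0) f g" "\<Gamma> \<tturnstile> Eq (Ty 0) x u" "\<Gamma> \<tturnstile> Eq (Ty 0) y v"
  shows "\<Gamma> \<tturnstile> Ap g u v"
proof -
  let ?F = "\<lambda>f x y g u v. Ap f x y \<^bold>\<and> Eq (Ty 0) f g \<^bold>\<and> Eq (Ty 0) x u \<^bold>\<and> Eq (Ty 0) y v \<^bold>\<longrightarrow> Ap g u v"
  have vars: "\<turnstile>\<^sub>B\<^sub>T ?F (Var f) (Var x) (Var y) (Var g) (Var u) (Var v)"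
    if "vty f = Ty 0" "vty x = Ty 0" "vty y = Ty 0" "vty g = Ty 0" "vty u = Ty 0" "vty v = Ty 0"
    for f x y g u v
    using that
    by (intro by_equality, cases f; cases x; cases y; cases g; cases u; cases v)
      (auto intro!: eq_Ap)
  have v5: "\<turnstile>\<^sub>B\<^sub>T ?F f (Var x) (Var y) (Var g) (Var u) (Var v)"
    if "vty x = Ty 0" "vty y = Ty 0" "vty g = Ty 0" "vty u = Ty 0" "vty v = Ty 0"
    for x y g u v
    by (rule all_terms[of "Ty 0" "\<lambda>f. ?F f (Var x) (Var y) (Var g) (Var u) (Var v)"
          "{x, y, g, u, v}"]) (use vars that assms in \<open>auto\<close>)
  have v6: "\<turnstile>\<^sub>B\<^sub>T ?F f x (Var y) (Var g) (Var u) (Var v)"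
    if "vty y = Ty 0" "vty g = Ty 0" "vty u = Ty 0" "vty v = Ty 0"
    for y g u v
    by (rule all_terms[of "Ty 0" "\<lambda>x. ?F f x (Var y) (Var g) (Var u) (Var v)"
          "trm_vars f \<union> {y, g, u, v}"]) (use v5 that assms in \<open>auto simp: trm_subst_fresh\<close>)
  have v7: "\<turnstile>\<^sub>B\<^sub>T ?F f x y (Var g) (Var u) (Var v)"
    if "vty g = Ty 0" "vty u = Ty 0" "vty v = Ty 0"
    for g u v
    by (rule all_terms[of "Ty 0" "\<lambda>y. ?F f x y (Var g) (Var u) (Var v)"
          "trm_vars f \<union> trm_vars x \<union> {g, u, v}"]) (use v6 that assms in \<open>auto simp: trm_subst_fresh\<close>)
  have v8: "\<turnstile>\<^sub>B\<^sub>T ?F f x y g (Var u) (Var v)"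
    if "vty u = Ty 0" "vty v = Ty 0"
    for u v
    by (rule all_terms[of "Ty 0" "\<lambda>g. ?F f x y g (Var u) (Var v)"
          "trm_vars f \<union> trm_vars x \<union> trm_vars y \<union> {u, v}"]) (use v7 that assms in \<open>auto simp: trm_subst_fresh\<close>)
  have v9: "\<turnstile>\<^sub>B\<^sub>T ?F f x y g u (Var v)" if "vty v = Ty 0" for v
    by (rule all_terms[of "Ty 0" "\<lambda>u. ?F f x y g u (Var v)"
          "trm_vars f \<union> trm_vars x \<union> trm_vars y \<union> trm_vars g \<union> {v}"]) (use v8 that assms in \<open>auto simp: trm_subst_fresh\<close>)
  have "\<turnstile>\<^sub>B\<^sub>T ?F f x y g u v"
    by (rule all_terms[of "Ty 0" "\<lambda>v. ?F f x y g u v"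
          "trm_vars f \<union> trm_vars x \<union> trm_vars y \<union> trm_vars g \<union> trm_vars u"]) (use v9 assms in \<open>auto simp: trm_subst_fresh\<close>)
  then show ?thesis by (rule theorem_mp) (intro AndI assms)
qed

lemma ex_value:
  assumes "vty x = Ty 0" "x \<notin> trm_vars a"
  shows "\<Gamma> \<tturnstile> Exists x (Eq (trm_ty a) (Var x) a)"
proof (cases a)
  case (Var v)
  obtain i where x: "x = ovar i" using assms by (cases x) auto
  obtain s j where v: "v = V s j" by (cases v)
  have "comb_ax (Exists x (Eq (trm_ty a) (Var x) a))"
    using assms x v Var by (cases s) (auto intro: num_op type_op)
  with x Var show ?thesis by (auto intro!: theorem_ by_combinatorial)
next
  case (Con c)
  obtain i where x: "x = ovar i" using assms by (cases x) auto
  show ?thesis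
  \<comment> \<open>\<open>Zero\<close> has type \<omega> and cannot be substituted for x, so
    \<open>num_op\<close> is instantiated instead. Every other constant has type 0 and is its own
    witness.\<close>
  proof (cases "c = Zero")
    case True
    have "\<turnstile>\<^sub>B\<^sub>T Exists x (Eq Omega (Var x) (Var (nvar 0)))"
      using x by (auto intro!: by_combinatorial num_op)
    from inst[OF this, of "Con Zero" "nvar 0"] show ?thesis
      using True Con x by (auto intro: theorem_)
  next
    case False
    then have "trm_ty a = Ty 0" using Con by (cases c) auto
    with Con x show ?thesis
      by (intro ExistsI_inst[of _ x a]) (auto intro: eq_refl_trm)
  qed
qed

text \<open>Provides a type 0 variable equal to a term of any type, usable where only type 0 is
  allowed.\<close>

lemma name_trm:
  assumes "insert (Eq (trm_ty a) (Var x) a) \<Gamma> \<tturnstile> \<chi>" "vty x = Ty 0" "x \<notin> trm_vars a"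
    "\<And>\<gamma>. \<gamma> \<in> \<Gamma> \<Longrightarrow> x \<notin> fv \<gamma>" "x \<notin> fv \<chi>"
  shows "\<Gamma> \<tturnstile> \<chi>"
  using ExistsE[OF ex_value assms(1)] assms by blast

section \<open>Independence of evaluation from its bound variables\<close>

lemma fv_evalto [simp]: "fv (evalto t x) = insert x (ext_vars t)"
proof (induction t arbitrary: x)
  case (App t u)
  let ?S = "insert x (ext_vars t \<union> ext_vars u)"
  have "V (Ty 0) (fresh_idx ?S) \<notin> ?S" "V (Ty 0) (Suc (fresh_idx ?S)) \<notin> ?S"
    by (intro fresh_idx_notin; simp)+
  then show ?case using App by (auto simp: Let_def)
qed auto

lemma wff_evalto [simp]: "wff (evalto t x) \<longleftrightarrow> vty x = Ty 0"
  by (induction t arbitrary: x) (auto simp: Let_def)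

lemma fv_simeq [simp]: "fv (t \<^bold>\<simeq> u) = ext_vars t \<union> ext_vars u"
  using fresh_idx_notin[of "ext_vars t \<union> ext_vars u" _ "Ty 0"] by (auto simp: simeq_def Let_def)

lemma wff_simeq [simp]: "wff (t \<^bold>\<simeq> u)"
  by (auto simp: simeq_def Let_def)

declare evalto.simps(2) [simp del]

lemma Exists2E:
  assumes "\<Gamma> \<tturnstile> Exists y (Exists z (\<phi> \<^bold>\<and> \<psi> \<^bold>\<and> \<theta>))"
    and "insert \<phi> (insert \<psi> (insert \<theta> \<Gamma>)) \<tturnstile> \<chi>"
    and "\<And>\<gamma>. \<gamma> \<in> \<Gamma> \<Longrightarrow> y \<notin> fv \<gamma> \<and> z \<notin> fv \<gamma>" "y \<notin> fv \<chi>" "z \<notin> fv \<chi>"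
  shows "\<Gamma> \<tturnstile> \<chi>"
proof (rule ExistsE[OF assms(1)])
  let ?A = "\<phi> \<^bold>\<and> \<psi> \<^bold>\<and> \<theta>"
  let ?D = "insert ?A (insert (Exists z ?A) \<Gamma>)"
  have "wff ?A" using derives_wff[OF assms(1)] by simp
  then have "?D \<tturnstile> ?A" by (auto intro: hyp)
  then have "?D \<tturnstile> \<phi>" "?D \<tturnstile> \<psi>" "?D \<tturnstile> \<theta>" by (blast intro: AndE1 AndE2)+
  moreover have "?D \<union> {\<phi>, \<psi>, \<theta>} \<tturnstile> \<chi>" using assms(2) by (rule weaken) blast
  ultimately have D: "?D \<tturnstile> \<chi>" by (blast intro: cut_all)
  show "insert (Exists z ?A) \<Gamma> \<tturnstile> \<chi>"
    by (rule ExistsE[of _ z ?A, OF _ D]) (use assms \<open>wff ?A\<close> in \<open>auto intro: hyp\<close>)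
qed (use assms in auto)

abbreviation app_formula :: "ext \<Rightarrow> ext \<Rightarrow> var \<Rightarrow> var \<Rightarrow> var \<Rightarrow> form" where
  "app_formula t u y z x \<equiv>
     Exists y (Exists z (evalto t y \<^bold>\<and> evalto u z \<^bold>\<and> Ap (Var y) (Var z) (Var x)))"

text \<open>Renaming the bound variables for t \<cdot> u needs congruence for t and u, and
  congruence for t \<cdot> u needs renaming. The property is therefore carried as a hypothesis until
  the induction in \<open>evalto_congruent\<close> closes the circle.\<close>

definition evalto_congruent :: "ext \<Rightarrow> bool" where
  "evalto_congruent t \<longleftrightarrow> (\<forall>\<Gamma> x y. vty x = Ty 0 \<longrightarrow> vty y = Ty 0 \<longrightarrow>
     \<Gamma> \<tturnstile> evalto t x \<longrightarrow> \<Gamma> \<tturnstile> Eq (Ty 0) (Var x) (Var y) \<longrightarrow> \<Gamma> \<tturnstile> evalto t y)"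

text \<open>Renaming is done by equality reasoning: y' and z' are introduced as objects equal to y
  and z.\<close>

lemma app_formula_rename_disjoint:
  assumes "evalto_congruent t" "evalto_congruent u"
    and "vty y = Ty 0" "vty z = Ty 0" "vty y' = Ty 0" "vty z' = Ty 0" "vty x = Ty 0"
    and "distinct [x, y, z, y', z']" "set [y, z, y', z'] \<inter> (ext_vars t \<union> ext_vars u) = {}"
    and "\<Gamma> \<tturnstile> app_formula t u y z x"
  shows "\<Gamma> \<tturnstile> app_formula t u y' z' x"
proof -
  let ?E = "{evalto t y, evalto u z, Ap (Var y) (Var z) (Var x)}"
  let ?D = "insert (Eq (trm_ty (Var z)) (Var z') (Var z)) (insert (Eq (trm_ty (Var y)) (Var y') (Var y)) ?E)"
  have e: "?D \<tturnstile> evalto t y" "?D \<tturnstile> evalto u z" "?D \<tturnstile> Ap (Var y) (Var z) (Var x)"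
    "?D \<tturnstile> Eq (Ty 0) (Var y') (Var y)" "?D \<tturnstile> Eq (Ty 0) (Var z') (Var z)"
    using assms by (auto intro: hyp)
  have s: "?D \<tturnstile> Eq (Ty 0) (Var y) (Var y')" "?D \<tturnstile> Eq (Ty 0) (Var z) (Var z')"
    by (rule eq_sym0[OF _ _ e(4)] eq_sym0[OF _ _ e(5)]; use assms in simp)+
  have "?D \<tturnstile> Ap (Var y') (Var z') (Var x)"
    by (rule Ap_cong[OF _ _ _ _ _ _ e(3) s]) (use assms in \<open>auto intro: eq_refl_trm\<close>)
  moreover have "?D \<tturnstile> evalto t y'" "?D \<tturnstile> evalto u z'"
    using e s assms(1-7) unfolding evalto_congruent_def by blast+
  ultimately have "?D \<tturnstile> app_formula t u y' z' x" by (intro ExistsI AndI)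
  then have "insert (Eq (trm_ty (Var y)) (Var y') (Var y)) ?E \<tturnstile> app_formula t u y' z' x"
    by (rule name_trm) (use assms in auto)
  then have E: "?E \<tturnstile> app_formula t u y' z' x"
    by (rule name_trm[of "Var y" y']) (use assms in auto)
  have "{app_formula t u y z x} \<tturnstile> app_formula t u y' z' x"
  proof (rule Exists2E)
    show "{app_formula t u y z x} \<tturnstile> app_formula t u y z x" using assms by (auto intro: hyp)
    show "insert (evalto t y) (insert (evalto u z) (insert (Ap (Var y) (Var z) (Var x))
      {app_formula t u y z x})) \<tturnstile> app_formula t u y' z' x"
      using E by (rule weaken) blast
  qed (use assms in auto)
  then have "insert (app_formula t u y z x) \<Gamma> \<tturnstile> app_formula t u y' z' x" by (rule weaken) blast
  then show ?thesis using assms(10) by (rule cut)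
qed

text \<open>Old and new bound variables may overlap, so the renaming passes through a third, fresh
  pair.\<close>

lemma app_formula_rename:
  assumes "evalto_congruent t" "evalto_congruent u"
    and "vty y = Ty 0" "vty z = Ty 0" "vty y' = Ty 0" "vty z' = Ty 0" "vty x = Ty 0"
    and "distinct [x, y, z]" "set [y, z] \<inter> (ext_vars t \<union> ext_vars u) = {}"
    and "distinct [x, y', z']" "set [y', z'] \<inter> (ext_vars t \<union> ext_vars u) = {}"
    and "\<Gamma> \<tturnstile> app_formula t u y z x"
  shows "\<Gamma> \<tturnstile> app_formula t u y' z' x"
proof -
  let ?S = "set [x, y, z, y', z'] \<union> ext_vars t \<union> ext_vars u"
  define y'' z'' where "y'' = ovar (fresh_idx ?S)" and "z'' = ovar (Suc (fresh_idx ?S))"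
  have n: "y'' \<notin> ?S" "z'' \<notin> ?S" "y'' \<noteq> z''" "vty y'' = Ty 0" "vty z'' = Ty 0"
    unfolding y''_def z''_def by (intro fresh_idx_notin; simp)+ simp_all
  have "\<Gamma> \<tturnstile> app_formula t u y'' z'' x"
    by (rule app_formula_rename_disjoint[OF assms(1-4) _ _ _ _ _ assms(12)]) (use n assms in auto)
  then show ?thesis
    by (rule app_formula_rename_disjoint[OF assms(1,2), rotated -1]) (use n assms in auto)
qed

lemma evalto_App_iff:
  assumes "evalto_congruent t" "evalto_congruent u"
    and "vty y = Ty 0" "vty z = Ty 0" "vty x = Ty 0"
    and "distinct [x, y, z]" "set [y, z] \<inter> (ext_vars t \<union> ext_vars u) = {}"
  shows "\<Gamma> \<tturnstile> evalto (t \<cdot> u) x \<longleftrightarrow> \<Gamma> \<tturnstile> app_formula t u y z x"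
proof -
  let ?S = "insert x (ext_vars t \<union> ext_vars u)"
  define y' z' where "y' = ovar (fresh_idx ?S)" and "z' = ovar (Suc (fresh_idx ?S))"
  have n: "y' \<notin> ?S" "z' \<notin> ?S" "y' \<noteq> z'" "vty y' = Ty 0" "vty z' = Ty 0"
    unfolding y'_def z'_def by (intro fresh_idx_notin; simp)+ simp_all
  have eq: "evalto (t \<cdot> u) x = app_formula t u y' z' x"
    by (simp add: evalto.simps Let_def y'_def z'_def)
  show ?thesis unfolding eq
    by (rule iffI; erule app_formula_rename[OF assms(1,2), rotated -1]) (use n assms in auto)
qed

lemma evalto_congruent_App:
  assumes "evalto_congruent t" "evalto_congruent u"
  shows "evalto_congruent (t \<cdot> u)"
  unfolding evalto_congruent_def
proof (intro allI impI)
  fix \<Gamma> x x'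
  assume ty: "vty x = Ty 0" "vty x' = Ty 0"
    and x: "\<Gamma> \<tturnstile> evalto (t \<cdot> u) x" and eq: "\<Gamma> \<tturnstile> Eq (Ty 0) (Var x) (Var x')"
  let ?S = "{x, x'} \<union> (ext_vars t \<union> ext_vars u)"
  \<comment> \<open>Chosen to avoid both x and x', so that the same bound variables serve before and
    after the replacement.\<close>
  define y z where "y = ovar (fresh_idx ?S)" and "z = ovar (Suc (fresh_idx ?S))"
  have n: "y \<notin> ?S" "z \<notin> ?S" "y \<noteq> z" "vty y = Ty 0" "vty z = Ty 0"
    unfolding y_def z_def by (intro fresh_idx_notin; simp)+ simp_all
  let ?H = "{evalto (t \<cdot> u) x, Eq (Ty 0) (Var x) (Var x')}"
  let ?D = "insert (evalto t y) (insert (evalto u z) (insert (Ap (Var y) (Var z) (Var x)) ?H))"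
  have "?D \<tturnstile> Ap (Var y) (Var z) (Var x')"
    by (rule Ap_cong[of "Var y" "Var z" "Var x"]) (use ty n in \<open>auto intro: hyp eq_refl_trm\<close>)
  moreover have "?D \<tturnstile> evalto t y" "?D \<tturnstile> evalto u z" using n by (auto intro: hyp)
  ultimately have D: "?D \<tturnstile> app_formula t u y z x'" by (intro ExistsI AndI)
  have "?H \<tturnstile> app_formula t u y z x"
    by (rule iffD1[OF evalto_App_iff[OF assms]]) (use n ty in \<open>auto intro: hyp\<close>)
  then have "?H \<tturnstile> app_formula t u y z x'"
    by (rule Exists2E[OF _ D]) (use n in auto)
  then have "?H \<tturnstile> evalto (t \<cdot> u) x'"
    using evalto_App_iff[OF assms, of y z x' ?H] n ty by auto
  then have "\<Gamma> \<union> ?H \<tturnstile> evalto (t \<cdot> u) x'"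
    by (rule weaken) blast
  then show "\<Gamma> \<tturnstile> evalto (t \<cdot> u) x'"
    by (rule cut_all) (use x eq in auto)
qed

lemma evalto_congruent: "evalto_congruent t"
proof (induction t)
  case (At a)
  show ?case unfolding evalto_congruent_def by (auto intro: eq_transport[of "Var _"])
next
  case (App t u)
  then show ?case by (rule evalto_congruent_App)
qed

lemma evalto_cong:
  assumes "\<Gamma> \<tturnstile> evalto t x" "\<Gamma> \<tturnstile> Eq (Ty 0) (Var x) (Var y)"
  shows "\<Gamma> \<tturnstile> evalto t y"
proof -
  have "vty x = Ty 0" "vty y = Ty 0" using derives_wff[OF assms(2)] by simp_all
  with assms evalto_congruent[of t] show ?thesis unfolding evalto_congruent_def by blast
qed

lemma evalto_AppE:
  assumes "\<Gamma> \<tturnstile> evalto (t \<cdot> u) x"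
    and "insert (evalto t y) (insert (evalto u z) (insert (Ap (Var y) (Var z) (Var x)) \<Gamma>)) \<tturnstile> \<chi>"
    and "vty y = Ty 0" "vty z = Ty 0" "distinct [x, y, z]"
    and "set [y, z] \<inter> (ext_vars t \<union> ext_vars u \<union> fv \<chi> \<union> \<Union>(fv ` \<Gamma>)) = {}"
  shows "\<Gamma> \<tturnstile> \<chi>"
proof (rule Exists2E[OF _ assms(2)])
  have "vty x = Ty 0" using derives_wff[OF assms(1)] by simp
  then show "\<Gamma> \<tturnstile> app_formula t u y z x"
    using assms(3-6)
    by (intro iffD1[OF evalto_App_iff[OF evalto_congruent evalto_congruent] assms(1)]) auto
qed (use assms(3-6) in auto)

text \<open>y and z may occur in t or u or coincide with x, and so need not be fit as bound
  variables; fresh variables equal to them are.\<close>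

lemma evalto_AppI:
  assumes "\<Gamma> \<tturnstile> evalto t y" "\<Gamma> \<tturnstile> evalto u z" "\<Gamma> \<tturnstile> Ap (Var y) (Var z) (Var x)"
  shows "\<Gamma> \<tturnstile> evalto (t \<cdot> u) x"
proof -
  have ty: "vty x = Ty 0" "vty y = Ty 0" "vty z = Ty 0" using derives_wff[OF assms(3)] by auto
  let ?S = "{x, y, z} \<union> (ext_vars t \<union> ext_vars u)"
  define y' z' where "y' = ovar (fresh_idx ?S)" and "z' = ovar (Suc (fresh_idx ?S))"
  have n: "y' \<notin> ?S" "z' \<notin> ?S" "y' \<noteq> z'" "vty y' = Ty 0" "vty z' = Ty 0"
    unfolding y'_def z'_def by (intro fresh_idx_notin; simp)+ simp_all
  let ?E = "{evalto t y, evalto u z, Ap (Var y) (Var z) (Var x)}"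
  let ?D = "insert (Eq (trm_ty (Var z)) (Var z') (Var z)) (insert (Eq (trm_ty (Var y)) (Var y') (Var y)) ?E)"
  have e: "?D \<tturnstile> evalto t y" "?D \<tturnstile> evalto u z" "?D \<tturnstile> Ap (Var y) (Var z) (Var x)"
    "?D \<tturnstile> Eq (Ty 0) (Var y') (Var y)" "?D \<tturnstile> Eq (Ty 0) (Var z') (Var z)"
    using ty n by (auto intro: hyp)
  have s: "?D \<tturnstile> Eq (Ty 0) (Var y) (Var y')" "?D \<tturnstile> Eq (Ty 0) (Var z) (Var z')"
    by (rule eq_sym0[OF _ _ e(4)] eq_sym0[OF _ _ e(5)]; use ty n in simp)+
  have "?D \<tturnstile> Ap (Var y') (Var z') (Var x)"
    by (rule Ap_cong[OF _ _ _ _ _ _ e(3) s]) (use ty n in \<open>auto intro: eq_refl_trm\<close>)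
  moreover have "?D \<tturnstile> evalto t y'" "?D \<tturnstile> evalto u z'"
    using e s evalto_cong by blast+
  ultimately have "?D \<tturnstile> app_formula t u y' z' x" by (intro ExistsI AndI)
  then have "?D \<tturnstile> evalto (t \<cdot> u) x"
    using evalto_App_iff[OF evalto_congruent evalto_congruent, of y' z' x t u ?D] n ty by auto
  then have "insert (Eq (trm_ty (Var y)) (Var y') (Var y)) ?E \<tturnstile> evalto (t \<cdot> u) x"
    by (rule name_trm) (use n ty in auto)
  then have "?E \<tturnstile> evalto (t \<cdot> u) x"
    by (rule name_trm[of "Var y" y']) (use n ty in auto)
  then have "\<Gamma> \<union> ?E \<tturnstile> evalto (t \<cdot> u) x" by (rule weaken) blast
  then show ?thesis by (rule cut_all) (use assms in auto)
qed

lemma Ap_functional_var: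
  assumes "\<Gamma> \<tturnstile> Ap (Var f) (Var x) (Var y)" "\<Gamma> \<tturnstile> Ap (Var f) (Var x) (Var z)"
  shows "\<Gamma> \<tturnstile> Eq (Ty 0) (Var y) (Var z)"
proof -
  have "vty f = Ty 0" "vty x = Ty 0" "vty y = Ty 0" "vty z = Ty 0"
    using derives_wff[OF assms(1)] derives_wff[OF assms(2)] by auto
  then have "\<turnstile>\<^sub>B\<^sub>T Ap (Var f) (Var x) (Var y) \<^bold>\<and> Ap (Var f) (Var x) (Var z) \<^bold>\<longrightarrow> Eq (Ty 0) (Var y) (Var z)"
    by (intro by_combinatorial, cases f; cases x; cases y; cases z) (auto intro!: Ap_functional)
  then show ?thesis by (rule theorem_mp) (intro AndI assms)
qed

lemma evalto_functional:
  "\<Gamma> \<tturnstile> evalto t x \<Longrightarrow> \<Gamma> \<tturnstile> evalto t x' \<Longrightarrow> \<Gamma> \<tturnstile> Eq (Ty 0) (Var x) (Var x')"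
proof (induction t arbitrary: \<Gamma> x x')
  case (At a)
  have "vty x = Ty 0" "vty x' = Ty 0" using At.prems[THEN derives_wff] by auto
  with At show ?case by (auto intro: eq_common)
next
  case (App t u)
  have ty: "vty x = Ty 0" "vty x' = Ty 0" using App.prems[THEN derives_wff] by auto
  let ?S = "{x, x'} \<union> (ext_vars t \<union> ext_vars u)"
  define y z where "y = ovar (fresh_idx ?S)" and "z = ovar (Suc (fresh_idx ?S))"
  have n: "y \<notin> ?S" "z \<notin> ?S" "y \<noteq> z" "vty y = Ty 0" "vty z = Ty 0"
    unfolding y_def z_def by (intro fresh_idx_notin; simp)+ simp_all
  let ?S' = "{x, x', y, z} \<union> (ext_vars t \<union> ext_vars u)"
  define y' z' where "y' = ovar (fresh_idx ?S')" and "z' = ovar (Suc (fresh_idx ?S'))"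
  have n': "y' \<notin> ?S'" "z' \<notin> ?S'" "y' \<noteq> z'" "vty y' = Ty 0" "vty z' = Ty 0"
    unfolding y'_def z'_def by (intro fresh_idx_notin; simp)+ simp_all
  let ?H = "{evalto (t \<cdot> u) x, evalto (t \<cdot> u) x'}"
  let ?D = "insert (evalto t y) (insert (evalto u z) (insert (Ap (Var y) (Var z) (Var x)) ?H))"
  let ?E = "insert (evalto t y') (insert (evalto u z') (insert (Ap (Var y') (Var z') (Var x')) ?D))"
  \<comment> \<open>The induction hypotheses identify the two operators and the two arguments;
    functionality of \<open>Ap\<close> then identifies the results.\<close>
  have "?E \<tturnstile> Eq (Ty 0) (Var y') (Var y)" using n n' by (intro App.IH(1) hyp) auto
  moreover have "?E \<tturnstile> Eq (Ty 0) (Var z') (Var z)" using n n' by (intro App.IH(2) hyp) auto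
  moreover have "?E \<tturnstile> Ap (Var y') (Var z') (Var x')" "?E \<tturnstile> Eq (Ty 0) (Var x') (Var x')"
    using n n' ty by (auto intro: hyp eq_refl_trm)
  ultimately have "?E \<tturnstile> Ap (Var y) (Var z) (Var x')"
    using Ap_cong[of "Var y'" "Var z'" "Var x'" "Var y" "Var z" "Var x'" ?E] n n' ty by simp
  moreover have "?E \<tturnstile> Ap (Var y) (Var z) (Var x)" using n n' ty by (auto intro: hyp)
  ultimately have E: "?E \<tturnstile> Eq (Ty 0) (Var x) (Var x')" by (rule Ap_functional_var[rotated])
  have "?D \<tturnstile> evalto (t \<cdot> u) x'" using ty by (auto intro: hyp)
  then have D: "?D \<tturnstile> Eq (Ty 0) (Var x) (Var x')"
    by (rule evalto_AppE[OF _ E]) (use n n' in auto)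
  have "?H \<tturnstile> evalto (t \<cdot> u) x" using ty by (auto intro: hyp)
  then have "?H \<tturnstile> Eq (Ty 0) (Var x) (Var x')"
    by (rule evalto_AppE[OF _ D]) (use n in auto)
  then have "\<Gamma> \<union> ?H \<tturnstile> Eq (Ty 0) (Var x) (Var x')" by (rule weaken) blast
  then show ?case by (rule cut_all) (use App.prems in auto)
qed

section \<open>Common values and definedness\<close>

lemma common_value_rename:
  assumes "vty x = Ty 0" "vty y = Ty 0" "{x, y} \<inter> (ext_vars t \<union> ext_vars u) = {}"
    and "\<Gamma> \<tturnstile> Exists x (evalto t x \<^bold>\<and> evalto u x)"
  shows "\<Gamma> \<tturnstile> Exists y (evalto t y \<^bold>\<and> evalto u y)"
proof (cases "x = y")
  case False
  let ?H = "{Exists x (evalto t x \<^bold>\<and> evalto u x)}"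
  let ?D = "insert (evalto t x \<^bold>\<and> evalto u x) ?H"
  let ?E = "insert (Eq (trm_ty (Var x)) (Var y) (Var x)) ?D"
  have "?E \<tturnstile> evalto t x \<^bold>\<and> evalto u x" "?E \<tturnstile> Eq (Ty 0) (Var y) (Var x)"
    using assms by (auto intro: hyp)
  then have "?E \<tturnstile> evalto t x" "?E \<tturnstile> evalto u x" "?E \<tturnstile> Eq (Ty 0) (Var x) (Var y)"
    using assms by (auto intro: AndE1 AndE2 eq_sym0[of "Var y"])
  then have "?E \<tturnstile> Exists y (evalto t y \<^bold>\<and> evalto u y)"
    by (intro ExistsI AndI) (auto intro: evalto_cong)
  then have D: "?D \<tturnstile> Exists y (evalto t y \<^bold>\<and> evalto u y)"
    by (rule name_trm) (use assms False in auto)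
  have "?H \<tturnstile> Exists y (evalto t y \<^bold>\<and> evalto u y)"
    by (rule ExistsE[OF _ D]) (use assms False in \<open>auto intro: hyp\<close>)
  then have "\<Gamma> \<union> ?H \<tturnstile> Exists y (evalto t y \<^bold>\<and> evalto u y)" by (rule weaken) blast
  then show ?thesis by (rule cut_all) (use assms in auto)
qed (use assms in simp)

text \<open>From here on the bound variable of \<open>simeq\<close> can be chosen to suit the
  context.\<close>

lemma simeq_iff:
  assumes "vty y = Ty 0" "y \<notin> ext_vars t \<union> ext_vars u"
  shows "\<Gamma> \<tturnstile> t \<^bold>\<simeq> u \<longleftrightarrow> \<Gamma> \<tturnstile> Exists y (evalto t y \<^bold>\<and> evalto u y)"
proof -
  let ?x = "ovar (fresh_idx (ext_vars t \<union> ext_vars u))"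
  have "?x \<notin> ext_vars t \<union> ext_vars u" by (intro fresh_idx_notin) auto
  moreover have "t \<^bold>\<simeq> u = Exists ?x (evalto t ?x \<^bold>\<and> evalto u ?x)" by (simp add: simeq_def Let_def)
  ultimately show ?thesis
    using common_value_rename[of ?x y t u \<Gamma>] common_value_rename[of y ?x t u \<Gamma>] assms by auto
qed

lemma simeqE:
  assumes "\<Gamma> \<tturnstile> t \<^bold>\<simeq> u" and "insert (evalto t y) (insert (evalto u y) \<Gamma>) \<tturnstile> \<chi>"
    and "vty y = Ty 0" "y \<notin> ext_vars t \<union> ext_vars u \<union> fv \<chi> \<union> \<Union>(fv ` \<Gamma>)"
  shows "\<Gamma> \<tturnstile> \<chi>"
proof (rule ExistsE)
  show "\<Gamma> \<tturnstile> Exists y (evalto t y \<^bold>\<and> evalto u y)"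
    using assms simeq_iff[of y t u \<Gamma>] by auto
  let ?D = "insert (evalto t y \<^bold>\<and> evalto u y) \<Gamma>"
  have "?D \<tturnstile> evalto t y \<^bold>\<and> evalto u y" using assms by (auto intro: hyp)
  then have "?D \<tturnstile> evalto t y" "?D \<tturnstile> evalto u y" by (auto intro: AndE1 AndE2)
  moreover have "?D \<union> {evalto t y, evalto u y} \<tturnstile> \<chi>" using assms(2) by (rule weaken) blast
  ultimately show "?D \<tturnstile> \<chi>" by (blast intro: cut_all)
qed (use assms in auto)

lemma simeqI:
  assumes "\<Gamma> \<tturnstile> evalto t x" "\<Gamma> \<tturnstile> evalto u x"
  shows "\<Gamma> \<tturnstile> t \<^bold>\<simeq> u"
proof -
  have ty: "vty x = Ty 0" using derives_wff[OF assms(1)] by simp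
  let ?S = "insert x (ext_vars t \<union> ext_vars u)"
  define y where "y = ovar (fresh_idx ?S)"
  have n: "y \<notin> ?S" "vty y = Ty 0" unfolding y_def by (intro fresh_idx_notin; simp) simp
  let ?H = "{evalto t x, evalto u x}"
  let ?E = "insert (Eq (trm_ty (Var x)) (Var y) (Var x)) ?H"
  have "?E \<tturnstile> evalto t x" "?E \<tturnstile> evalto u x" "?E \<tturnstile> Eq (Ty 0) (Var y) (Var x)"
    using n ty by (auto intro: hyp)
  moreover from this(3) have "?E \<tturnstile> Eq (Ty 0) (Var x) (Var y)"
    using n ty by (auto intro: eq_sym0[of "Var y"])
  ultimately have "?E \<tturnstile> Exists y (evalto t y \<^bold>\<and> evalto u y)"
    by (intro ExistsI AndI) (auto intro: evalto_cong)
  then have "?H \<tturnstile> Exists y (evalto t y \<^bold>\<and> evalto u y)"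
    by (rule name_trm) (use n ty in auto)
  then have "?H \<tturnstile> t \<^bold>\<simeq> u" using simeq_iff[of y t u ?H] n by auto
  then have "\<Gamma> \<union> ?H \<tturnstile> t \<^bold>\<simeq> u" by (rule weaken) blast
  then show ?thesis by (rule cut_all) (use assms in auto)
qed

lemma simeq_sym:
  assumes "\<Gamma> \<tturnstile> t \<^bold>\<simeq> u"
  shows "\<Gamma> \<tturnstile> u \<^bold>\<simeq> t"
proof -
  let ?S = "ext_vars t \<union> ext_vars u"
  define y where "y = ovar (fresh_idx ?S)"
  have n: "y \<notin> ?S" "vty y = Ty 0" unfolding y_def by (intro fresh_idx_notin; simp) simp
  let ?H = "{t \<^bold>\<simeq> u}"
  have D: "insert (evalto t y) (insert (evalto u y) ?H) \<tturnstile> u \<^bold>\<simeq> t"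
    by (rule simeqI[of _ _ y]) (use n in \<open>auto intro: hyp\<close>)
  have "?H \<tturnstile> u \<^bold>\<simeq> t"
    by (rule simeqE[OF _ D]) (use n in \<open>auto intro: hyp\<close>)
  then have "\<Gamma> \<union> ?H \<tturnstile> u \<^bold>\<simeq> t" by (rule weaken) blast
  then show ?thesis by (rule cut_all) (use assms in auto)
qed

text \<open>
  \<open>t \<^bold>\<simeq> t\<close> serves as the definedness of \<open>t\<close>.
\<close>

lemma defined_iff: "\<Gamma> \<tturnstile> defined t \<longleftrightarrow> \<Gamma> \<tturnstile> t \<^bold>\<simeq> t"
proof -
  let ?x = "ovar (fresh_idx (ext_vars t))"
  have x: "?x \<notin> ext_vars t" by (intro fresh_idx_notin) auto
  have d: "defined t = Exists ?x (evalto t ?x)" "t \<^bold>\<simeq> t = Exists ?x (evalto t ?x \<^bold>\<and> evalto t ?x)"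
    by (simp_all add: defined_def simeq_def Let_def)
  have 1: "{defined t} \<tturnstile> t \<^bold>\<simeq> t"
  proof -
    have D: "insert (evalto t ?x) {defined t} \<tturnstile> t \<^bold>\<simeq> t"
      unfolding d by (intro ExistsI AndI) (auto intro: hyp)
    have "{defined t} \<tturnstile> Exists ?x (evalto t ?x)" unfolding d by (auto intro: hyp)
    then show ?thesis
      by (rule ExistsE[OF _ D]) (use x in \<open>auto simp: d\<close>)
  qed
  have 2: "{t \<^bold>\<simeq> t} \<tturnstile> defined t"
  proof (rule simeqE)
    show "insert (evalto t ?x) (insert (evalto t ?x) {t \<^bold>\<simeq> t}) \<tturnstile> defined t"
      unfolding d by (intro ExistsI) (auto intro: hyp)
  qed (use x in \<open>auto simp: d(1) intro: hyp\<close>)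
  show ?thesis
    using weaken[OF 1, of "\<Gamma> \<union> {defined t}"] weaken[OF 2, of "\<Gamma> \<union> {t \<^bold>\<simeq> t}"]
    by (auto intro: cut)
qed

lemma simeq_At_refl: "\<Gamma> \<tturnstile> At a \<^bold>\<simeq> At a"
proof -
  obtain x where x: "x \<notin> trm_vars a" "vty x = Ty 0"
    using ex_fresh[of "trm_vars a" "Ty 0"] by force
  have "{Eq (trm_ty a) (Var x) a} \<tturnstile> At a \<^bold>\<simeq> At a"
    by (rule simeqI[of _ _ x]) (use x in \<open>auto intro: hyp\<close>)
  then have "{} \<tturnstile> At a \<^bold>\<simeq> At a" by (rule name_trm) (use x in auto)
  then show ?thesis by (rule weaken) blast
qed

text \<open>
  Kleene ordering and equality, stated through derivability at every variable, so that they are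
  independent of the choice of bound variables in \<open>evalto\<close>.
\<close>

definition kle :: "form set \<Rightarrow> ext \<Rightarrow> ext \<Rightarrow> bool" where
  "kle \<Gamma> t u \<longleftrightarrow> (\<forall>x. vty x = Ty 0 \<longrightarrow> insert (evalto t x) \<Gamma> \<tturnstile> evalto u x)"

definition keq :: "form set \<Rightarrow> ext \<Rightarrow> ext \<Rightarrow> bool" where
  "keq \<Gamma> t u \<longleftrightarrow> kle \<Gamma> t u \<and> kle \<Gamma> u t"

lemma kleD: "kle \<Gamma> t u \<Longrightarrow> \<Gamma> \<subseteq> \<Delta> \<Longrightarrow> \<Delta> \<tturnstile> evalto t x \<Longrightarrow> \<Delta> \<tturnstile> evalto u x"
proof -
  assume a: "kle \<Gamma> t u" "\<Gamma> \<subseteq> \<Delta>" "\<Delta> \<tturnstile> evalto t x"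
  then have "insert (evalto t x) \<Gamma> \<tturnstile> evalto u x"
    using derives_wff[OF a(3)] by (auto simp: kle_def)
  then have "insert (evalto t x) \<Delta> \<tturnstile> evalto u x" by (rule weaken) (use a(2) in blast)
  then show ?thesis using a(3) by (rule cut)
qed

lemma kle_refl: "kle \<Gamma> t t"
  by (auto simp: kle_def intro: hyp)

lemma kle_trans: "kle \<Gamma> t u \<Longrightarrow> kle \<Gamma> u v \<Longrightarrow> kle \<Gamma> t v"
  unfolding kle_def[of _ t v] kle_def[of _ t u]
  by (auto intro: kleD)

lemma kle_weaken: "kle \<Gamma> t u \<Longrightarrow> \<Gamma> \<subseteq> \<Delta> \<Longrightarrow> kle \<Delta> t u"
  unfolding kle_def by (blast intro: weaken)

lemma keq_refl: "keq \<Gamma> t t"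
  by (simp add: keq_def kle_refl)

lemma keq_sym: "keq \<Gamma> t u \<Longrightarrow> keq \<Gamma> u t"
  by (simp add: keq_def)

lemma keq_trans: "keq \<Gamma> t u \<Longrightarrow> keq \<Gamma> u v \<Longrightarrow> keq \<Gamma> t v"
  by (auto simp: keq_def intro: kle_trans)

lemma keq_weaken: "keq \<Gamma> t u \<Longrightarrow> \<Gamma> \<subseteq> \<Delta> \<Longrightarrow> keq \<Delta> t u"
  by (auto simp: keq_def intro: kle_weaken)

lemma keqD: "keq \<Gamma> t u \<Longrightarrow> \<Gamma> \<subseteq> \<Delta> \<Longrightarrow> \<Delta> \<tturnstile> evalto t x \<Longrightarrow> \<Delta> \<tturnstile> evalto u x"
  by (auto simp: keq_def intro: kleD)

text \<open>Finiteness of \<Gamma> provides variables for the intermediate values that are not free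
  in it.\<close>

lemma kle_App:
  assumes "finite \<Gamma>" "kle \<Gamma> t t'" "kle \<Gamma> u u'"
  shows "kle \<Gamma> (t \<cdot> u) (t' \<cdot> u')"
  unfolding kle_def
proof (intro allI impI)
  fix x assume x: "vty x = Ty 0"
  let ?H = "insert (evalto (t \<cdot> u) x) \<Gamma>"
  let ?S = "insert x (ext_vars t \<union> ext_vars u \<union> ext_vars t' \<union> ext_vars u' \<union> \<Union>(fv ` ?H))"
  define y z where "y = ovar (fresh_idx ?S)" and "z = ovar (Suc (fresh_idx ?S))"
  have n: "y \<notin> ?S" "z \<notin> ?S" "y \<noteq> z" "vty y = Ty 0" "vty z = Ty 0"
    unfolding y_def z_def using assms(1) by (intro fresh_idx_notin; simp)+ simp_all
  let ?D = "insert (evalto t y) (insert (evalto u z) (insert (Ap (Var y) (Var z) (Var x)) ?H))"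
  have "?D \<tturnstile> evalto t y" "?D \<tturnstile> evalto u z" "?D \<tturnstile> Ap (Var y) (Var z) (Var x)"
    using x n by (auto intro: hyp)
  then have D: "?D \<tturnstile> evalto (t' \<cdot> u') x"
    using assms by (intro evalto_AppI[of _ _ y _ z]) (auto intro: kleD)
  show "?H \<tturnstile> evalto (t' \<cdot> u') x"
    by (rule evalto_AppE[OF _ D]) (use n x in \<open>auto intro: hyp\<close>)
qed

lemma keq_App: "finite \<Gamma> \<Longrightarrow> keq \<Gamma> t t' \<Longrightarrow> keq \<Gamma> u u' \<Longrightarrow> keq \<Gamma> (t \<cdot> u) (t' \<cdot> u')"
  by (simp add: keq_def kle_App)

text \<open>By functionality any value of t equals the common value of t and u, and so is a value of
  u.\<close>

lemma kle_if_simeq: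
  assumes "\<Gamma> \<tturnstile> t \<^bold>\<simeq> u"
  shows "kle \<Gamma> t u"
  unfolding kle_def
proof (intro allI impI)
  fix x assume x: "vty x = Ty 0"
  let ?S = "insert x (ext_vars t \<union> ext_vars u)"
  define y where "y = ovar (fresh_idx ?S)"
  have n: "y \<notin> ?S" "vty y = Ty 0" unfolding y_def by (intro fresh_idx_notin; simp) simp
  let ?H = "{t \<^bold>\<simeq> u, evalto t x}"
  let ?D = "insert (evalto t y) (insert (evalto u y) ?H)"
  have "?D \<tturnstile> evalto u y" using n by (auto intro: hyp)
  moreover have "?D \<tturnstile> Eq (Ty 0) (Var y) (Var x)"
    by (rule evalto_functional[of _ t]) (use n x in \<open>auto intro: hyp\<close>)
  ultimately have D: "?D \<tturnstile> evalto u x" by (rule evalto_cong)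
  have "?H \<tturnstile> evalto u x"
    by (rule simeqE[OF _ D]) (use n in \<open>auto intro: hyp\<close>)
  then have "insert (evalto t x) \<Gamma> \<union> {t \<^bold>\<simeq> u} \<tturnstile> evalto u x" by (rule weaken) blast
  then show "insert (evalto t x) \<Gamma> \<tturnstile> evalto u x"
    by (rule cut_all) (use assms in \<open>auto intro: weaken\<close>)
qed

lemma keq_if_simeq: "\<Gamma> \<tturnstile> t \<^bold>\<simeq> u \<Longrightarrow> keq \<Gamma> t u"
  using kle_if_simeq simeq_sym unfolding keq_def by blast

lemma keq_if_evalto:
  assumes "\<Gamma> \<tturnstile> evalto t x" "\<Gamma> \<tturnstile> evalto u x"
  shows "keq \<Gamma> t u"
  using assms by (intro keq_if_simeq simeqI)

lemma evalto_Var_self: "vty x = Ty 0 \<Longrightarrow> \<Gamma> \<tturnstile> evalto (vr x) x"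
  by (simp add: eq_refl_trm)

lemma keq_Var_if_evalto: "\<Gamma> \<tturnstile> evalto t x \<Longrightarrow> keq \<Gamma> t (vr x)"
  using derives_wff[of \<Gamma> "evalto t x"] by (auto intro: keq_if_evalto[of _ _ x] evalto_Var_self)

lemma simeq_kle:
  assumes "finite \<Gamma>" "\<Gamma> \<tturnstile> t \<^bold>\<simeq> u" "kle \<Gamma> t t'" "kle \<Gamma> u u'"
  shows "\<Gamma> \<tturnstile> t' \<^bold>\<simeq> u'"
proof -
  let ?S = "ext_vars t \<union> ext_vars u \<union> ext_vars t' \<union> ext_vars u' \<union> \<Union>(fv ` \<Gamma>)"
  obtain i where n: "ovar i \<notin> ?S" using ex_fresh[of ?S "Ty 0"] assms(1) by auto
  let ?y = "ovar i"
  let ?D = "insert (evalto t ?y) (insert (evalto u ?y) \<Gamma>)"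
  have "?D \<tturnstile> evalto t ?y" "?D \<tturnstile> evalto u ?y" by (auto intro: hyp)
  then have D: "?D \<tturnstile> t' \<^bold>\<simeq> u'"
    using assms by (intro simeqI[of _ _ ?y]) (auto intro: kleD)
  show ?thesis by (rule simeqE[OF assms(2) D]) (use n in auto)
qed

lemma simeq_keq:
  assumes "finite \<Gamma>" "\<Gamma> \<tturnstile> t \<^bold>\<simeq> u" "keq \<Gamma> t t'" "keq \<Gamma> u u'"
  shows "\<Gamma> \<tturnstile> t' \<^bold>\<simeq> u'"
  using assms simeq_kle by (auto simp: keq_def)

text \<open>Application is strict. This is the source of definedness for partial applications such
  as \<open>k t\<close> and \<open>d t u\<close>, which have no axiom of their own.\<close>

lemma simeq_AppD:
  assumes "\<Gamma> \<tturnstile> t \<cdot> u \<^bold>\<simeq> v"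
  shows "\<Gamma> \<tturnstile> t \<^bold>\<simeq> t" "\<Gamma> \<tturnstile> u \<^bold>\<simeq> u"
proof -
  let ?S = "ext_vars t \<union> ext_vars u \<union> ext_vars v"
  define y z x where "y = ovar (fresh_idx ?S)" and "z = ovar (Suc (fresh_idx ?S))"
    and "x = ovar (Suc (Suc (fresh_idx ?S)))"
  have n: "y \<notin> ?S" "z \<notin> ?S" "x \<notin> ?S" "distinct [x, y, z]" "vty y = Ty 0" "vty z = Ty 0" "vty x = Ty 0"
    unfolding y_def z_def x_def by (intro fresh_idx_notin; simp)+ simp_all
  have *: "\<Gamma> \<tturnstile> w \<^bold>\<simeq> w" if w: "w = t \<or> w = u" for w
  proof -
    let ?H = "{t \<cdot> u \<^bold>\<simeq> v}"
    let ?H' = "insert (evalto (t \<cdot> u) x) (insert (evalto v x) ?H)"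
    let ?D = "insert (evalto t y) (insert (evalto u z) (insert (Ap (Var y) (Var z) (Var x)) ?H'))"
    have "?D \<tturnstile> evalto t y" "?D \<tturnstile> evalto u z" using n by (auto intro: hyp)
    then have D: "?D \<tturnstile> w \<^bold>\<simeq> w" using w by (auto intro: simeqI)
    have H': "?H' \<tturnstile> w \<^bold>\<simeq> w"
      by (rule evalto_AppE[OF _ D]) (use n w in \<open>auto intro: hyp\<close>)
    have "?H \<tturnstile> w \<^bold>\<simeq> w"
      by (rule simeqE[OF _ H']) (use n w in \<open>auto intro: hyp\<close>)
    then have "insert (t \<cdot> u \<^bold>\<simeq> v) \<Gamma> \<tturnstile> w \<^bold>\<simeq> w" by (rule weaken) blast
    then show ?thesis using assms by (rule cut)
  qed
  show "\<Gamma> \<tturnstile> t \<^bold>\<simeq> t" "\<Gamma> \<tturnstile> u \<^bold>\<simeq> u" by (auto intro: *)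
qed

section \<open>Replacement of equal terms in formulas\<close>

lemma Eq_if_simeq:
  assumes "trm_ty a = Ty 0" "trm_ty b = Ty 0" "\<Gamma> \<tturnstile> At a \<^bold>\<simeq> At b"
  shows "\<Gamma> \<tturnstile> Eq (Ty 0) a b"
proof -
  obtain i where n: "ovar i \<notin> trm_vars a \<union> trm_vars b"
    using ex_fresh[of "trm_vars a \<union> trm_vars b" "Ty 0"] by auto
  let ?y = "ovar i" and ?H = "{At a \<^bold>\<simeq> At b}"
  let ?D = "insert (evalto (At a) ?y) (insert (evalto (At b) ?y) ?H)"
  have "?D \<tturnstile> Eq (Ty 0) (Var ?y) b" "?D \<tturnstile> Eq (Ty 0) (Var ?y) a"
    using assms by (auto intro: hyp)
  then have D: "?D \<tturnstile> Eq (Ty 0) a b" using assms by (intro eq_transport[of "Var ?y" a]) auto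
  have "?H \<tturnstile> Eq (Ty 0) a b"
    by (rule simeqE[OF _ D]) (use n in \<open>auto intro: hyp\<close>)
  then have "insert (At a \<^bold>\<simeq> At b) \<Gamma> \<tturnstile> Eq (Ty 0) a b" by (rule weaken) blast
  then show ?thesis using assms(3) by (rule cut)
qed

lemma Eq_simeq:
  assumes "trm_ty a = Ty 0" "trm_ty a' = Ty 0" "trm_ty b = s" "trm_ty b' = s"
    and "\<Gamma> \<tturnstile> At a \<^bold>\<simeq> At a'" "\<Gamma> \<tturnstile> At b \<^bold>\<simeq> At b'" "\<Gamma> \<tturnstile> Eq s a b"
  shows "\<Gamma> \<tturnstile> Eq s a' b'"
proof -
  have a': "\<Gamma> \<tturnstile> Eq s a' b"
    using assms by (intro eq_transport[of a a']) (auto intro: Eq_if_simeq)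
  obtain i where n: "ovar i \<notin> trm_vars a' \<union> trm_vars b \<union> trm_vars b'"
    using ex_fresh[of "trm_vars a' \<union> trm_vars b \<union> trm_vars b'" "Ty 0"] by auto
  let ?y = "ovar i" and ?H = "{At b \<^bold>\<simeq> At b', Eq s a' b}"
  let ?D = "insert (evalto (At b) ?y) (insert (evalto (At b') ?y) ?H)"
  have "?D \<tturnstile> Eq s (Var ?y) b'" "?D \<tturnstile> Eq s (Var ?y) b" "?D \<tturnstile> Eq s a' b"
    using assms by (auto intro: hyp)
  moreover from this have "?D \<tturnstile> Eq (Ty 0) (Var ?y) a'"
    using assms eq_common[of "Var ?y" a' b s ?D] by simp
  ultimately have D: "?D \<tturnstile> Eq s a' b'"
    using assms eq_transport[of "Var ?y" a' b' s ?D] by simp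
  have "?H \<tturnstile> Eq s a' b'"
    by (rule simeqE[OF _ D]) (use n assms in \<open>auto intro: hyp\<close>)
  then have "\<Gamma> \<union> ?H \<tturnstile> Eq s a' b'" by (rule weaken) blast
  then show ?thesis by (rule cut_all) (use assms a' in auto)
qed

lemma free_for_fresh: "v \<notin> fv \<phi> \<Longrightarrow> free_for t v \<phi>"
  by (induction \<phi>) auto

text \<open>Constants have type \<omega> or 0, so the right-hand side of a membership formula is
  always a variable. The size bound in \<open>slash_mem_cong\<close> rests on this as well.\<close>

lemma trm_ty_Suc:
  assumes "trm_ty b = Ty (Suc k)"
  obtains B where "b = Var B" "vty B = Ty (Suc k)"
proof (cases b)
  case (Con c)
  with assms show ?thesis by (cases c) auto
qed (use assms that in auto)

lemma Mem_var_axiom: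
  assumes "vty A = Ty k" "vty U = Ty k" "vty B = Ty (Suc k)" "vty W = Ty (Suc k)"
  shows "\<turnstile>\<^sub>B\<^sub>T Mem k (Var A) (Var B) \<^bold>\<and> vr A \<^bold>\<simeq> vr U \<^bold>\<and> vr B \<^bold>\<simeq> vr W \<^bold>\<longrightarrow> Mem k (Var U) (Var W)"
  using assms by (intro by_equality, cases A; cases U; cases B; cases W) (auto intro!: eq_Mem)

lemma Mem_simeq_left:
  assumes "trm_ty a = Ty k" "trm_ty a' = Ty k" "trm_ty b = Ty (Suc k)"
    and "\<Gamma> \<tturnstile> At a \<^bold>\<simeq> At a'" "\<Gamma> \<tturnstile> Mem k a b"
  shows "\<Gamma> \<tturnstile> Mem k a' b"
proof -
  obtain i where n: "ovar i \<notin> trm_vars a \<union> trm_vars a' \<union> trm_vars b"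
    using ex_fresh[of "trm_vars a \<union> trm_vars a' \<union> trm_vars b" "Ty 0"] by auto
  let ?x = "ovar i"
  obtain B where b: "b = Var B" "vty B = Ty (Suc k)"
    using trm_ty_Suc[OF assms(3)] .
  \<comment> \<open>Two equations with the explicit variable \<open>?x\<close> stand for the
    equality of a and a'. The bound variable of \<open>simeq\<close> depends on the variables
    present, so substituting a constant into it need not give the corresponding formula
    literally.\<close>
  let ?F = "\<lambda>a a'. Eq (Ty k) (Var ?x) a \<^bold>\<and> Eq (Ty k) (Var ?x) a' \<^bold>\<and> Mem k a b \<^bold>\<longrightarrow> Mem k a' b"
  have vars: "\<turnstile>\<^sub>B\<^sub>T ?F (Var A) (Var A')" if A: "vty A = Ty k" "vty A' = Ty k" for A A'
  proof -
    let ?H = "{Eq (Ty k) (Var ?x) (Var A) \<^bold>\<and> Eq (Ty k) (Var ?x) (Var A') \<^bold>\<and> Mem k (Var A) b}"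
    have "?H \<tturnstile> Eq (Ty k) (Var ?x) (Var A) \<^bold>\<and> Eq (Ty k) (Var ?x) (Var A') \<^bold>\<and> Mem k (Var A) b"
      using A b by (auto intro: hyp)
    then have h: "?H \<tturnstile> Eq (Ty k) (Var ?x) (Var A)" "?H \<tturnstile> Eq (Ty k) (Var ?x) (Var A')"
      "?H \<tturnstile> Mem k (Var A) (Var B)"
      using b by (blast intro: AndE1 AndE2)+
    then have "?H \<tturnstile> vr A \<^bold>\<simeq> vr A'" using A by (intro simeqI[of _ _ ?x]) auto
    with h have "?H \<tturnstile> Mem k (Var A) (Var B) \<^bold>\<and> vr A \<^bold>\<simeq> vr A' \<^bold>\<and> vr B \<^bold>\<simeq> vr B"
      by (intro AndI simeq_At_refl)
    with Mem_var_axiom[OF A b(2) b(2)] have "?H \<tturnstile> Mem k (Var A') (Var B)" by (rule theorem_mp)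
    then show ?thesis using A b by (auto intro!: ImpI simp flip: derives_empty)
  qed
  have v1: "\<turnstile>\<^sub>B\<^sub>T ?F a (Var A')" if "vty A' = Ty k" for A'
    by (rule all_terms[of "Ty k" "\<lambda>a. ?F a (Var A')" "{?x, A', B}"]) (use vars that b assms in auto)
  have F: "\<turnstile>\<^sub>B\<^sub>T ?F a a'"
    by (rule all_terms[of "Ty k" "\<lambda>a'. ?F a a'" "{?x, B} \<union> trm_vars a"])
      (use v1 b assms in \<open>auto simp: trm_subst_fresh\<close>)
  let ?H = "{At a \<^bold>\<simeq> At a', Mem k a b}"
  let ?D = "insert (evalto (At a) ?x) (insert (evalto (At a') ?x) ?H)"
  have "?D \<tturnstile> Eq (Ty k) (Var ?x) a" "?D \<tturnstile> Eq (Ty k) (Var ?x) a'" "?D \<tturnstile> Mem k a b"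
    using assms by (auto intro: hyp)
  then have "?D \<tturnstile> Eq (Ty k) (Var ?x) a \<^bold>\<and> Eq (Ty k) (Var ?x) a' \<^bold>\<and> Mem k a b" by (intro AndI)
  with F have D: "?D \<tturnstile> Mem k a' b" by (rule theorem_mp)
  have "?H \<tturnstile> Mem k a' b"
    by (rule simeqE[OF _ D]) (use n assms in \<open>auto intro: hyp\<close>)
  then have "\<Gamma> \<union> ?H \<tturnstile> Mem k a' b" by (rule weaken) blast
  then show ?thesis by (rule cut_all) (use assms in auto)
qed

lemma Mem_simeq:
  assumes "trm_ty a = Ty k" "trm_ty a' = Ty k" "trm_ty b = Ty (Suc k)" "trm_ty b' = Ty (Suc k)"
    and "\<Gamma> \<tturnstile> At a \<^bold>\<simeq> At a'" "\<Gamma> \<tturnstile> At b \<^bold>\<simeq> At b'" "\<Gamma> \<tturnstile> Mem k a b"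
  shows "\<Gamma> \<tturnstile> Mem k a' b'"
proof -
  have a': "\<Gamma> \<tturnstile> Mem k a' b" using assms by (intro Mem_simeq_left[of a k a' b])
  obtain B where b: "b = Var B" "vty B = Ty (Suc k)" using trm_ty_Suc[OF assms(3)] .
  obtain B' where b': "b' = Var B'" "vty B' = Ty (Suc k)" using trm_ty_Suc[OF assms(4)] .
  let ?F = "\<lambda>a. Mem k a b \<^bold>\<and> At b \<^bold>\<simeq> At b' \<^bold>\<longrightarrow> Mem k a b'"
  have vars: "\<turnstile>\<^sub>B\<^sub>T ?F (Var A)" if A: "vty A = Ty k" for A
  proof -
    let ?H = "{Mem k (Var A) b \<^bold>\<and> At b \<^bold>\<simeq> At b'}"
    have "?H \<tturnstile> Mem k (Var A) b \<^bold>\<and> At b \<^bold>\<simeq> At b'" using A b by (auto intro: hyp)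
    then have "?H \<tturnstile> Mem k (Var A) (Var B)" "?H \<tturnstile> vr B \<^bold>\<simeq> vr B'"
      using b b' by (blast intro: AndE1 AndE2)+
    then have "?H \<tturnstile> Mem k (Var A) (Var B) \<^bold>\<and> vr A \<^bold>\<simeq> vr A \<^bold>\<and> vr B \<^bold>\<simeq> vr B'"
      by (intro AndI simeq_At_refl)
    with Mem_var_axiom[OF A A b(2) b'(2)] have "?H \<tturnstile> Mem k (Var A) (Var B')" by (rule theorem_mp)
    then show ?thesis using A b b' by (auto intro!: ImpI simp flip: derives_empty)
  qed
  have F: "\<turnstile>\<^sub>B\<^sub>T ?F a'"
    by (rule all_terms[of "Ty k" ?F "{B, B'}"]) (use vars b b' assms in \<open>auto simp: subst_fresh free_for_fresh\<close>)
  show ?thesis by (rule theorem_mp[OF F]) (intro AndI a' assms)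
qed

lemma simeq_trm_subst:
  assumes "\<Gamma> \<tturnstile> At t \<^bold>\<simeq> vr v"
  shows "\<Gamma> \<tturnstile> At a \<^bold>\<simeq> At (trm_subst v t a)"
  using assms simeq_sym[OF assms] simeq_At_refl by (cases a) auto

text \<open>Both directions are proved in one induction, since an implication exchanges them. At a
  quantifier, \<open>free_for\<close> keeps the bound variable out of the hypothesis, so that it may
  be generalised.\<close>

lemma simeq_subst_iff:
  assumes "trm_ty t = vty v" "free_for t v \<phi>" "wff \<phi>"
  shows "{At t \<^bold>\<simeq> vr v} \<tturnstile> \<phi> \<^bold>\<longrightarrow> subst v t \<phi> \<and> {At t \<^bold>\<simeq> vr v} \<tturnstile> subst v t \<phi> \<^bold>\<longrightarrow> \<phi>"
  using assms(2,3)
proof (induction \<phi>)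
  case (Ap a b c)
  let ?s = "trm_subst v t"
  have h: "{At t \<^bold>\<simeq> vr v} \<tturnstile> At t \<^bold>\<simeq> vr v" by (auto intro: hyp)
  have e: "insert \<gamma> {At t \<^bold>\<simeq> vr v} \<tturnstile> At x \<^bold>\<simeq> At (?s x)" for \<gamma> x
    by (rule simeq_trm_subst, rule weaken[OF h]) blast
  note e' = e[THEN simeq_sym]
  have "insert (Ap a b c) {At t \<^bold>\<simeq> vr v} \<tturnstile> Ap (?s a) (?s b) (?s c)"
    by (rule Ap_cong[of a b c]; (rule Eq_if_simeq)?)
      (use Ap assms(1) trm_ty_subst[OF assms(1)] e in \<open>auto intro: hyp\<close>)
  moreover have "insert (Ap (?s a) (?s b) (?s c)) {At t \<^bold>\<simeq> vr v} \<tturnstile> Ap a b c"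
    by (rule Ap_cong[of "?s a" "?s b" "?s c"]; (rule Eq_if_simeq)?)
      (use Ap assms(1) trm_ty_subst[OF assms(1)] e' in \<open>auto intro: hyp\<close>)
  ultimately show ?case using Ap assms(1) trm_ty_subst[OF assms(1)] by (auto intro!: ImpI)
next
  case (Eq s a b)
  let ?s = "trm_subst v t"
  have h: "{At t \<^bold>\<simeq> vr v} \<tturnstile> At t \<^bold>\<simeq> vr v" by (auto intro: hyp)
  have e: "insert \<gamma> {At t \<^bold>\<simeq> vr v} \<tturnstile> At x \<^bold>\<simeq> At (?s x)" for \<gamma> x
    by (rule simeq_trm_subst, rule weaken[OF h]) blast
  note e' = e[THEN simeq_sym]
  show ?case using Eq assms(1) trm_ty_subst[OF assms(1)]
    by (auto intro!: ImpI intro: Eq_simeq[OF _ _ _ _ e e hyp] Eq_simeq[OF _ _ _ _ e' e' hyp])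
next
  case (Mem k a b)
  let ?s = "trm_subst v t"
  have h: "{At t \<^bold>\<simeq> vr v} \<tturnstile> At t \<^bold>\<simeq> vr v" by (auto intro: hyp)
  have e: "insert \<gamma> {At t \<^bold>\<simeq> vr v} \<tturnstile> At x \<^bold>\<simeq> At (?s x)" for \<gamma> x
    by (rule simeq_trm_subst, rule weaken[OF h]) blast
  note e' = e[THEN simeq_sym]
  show ?case using Mem assms(1) trm_ty_subst[OF assms(1)]
    by (auto intro!: ImpI intro: Mem_simeq[OF _ _ _ _ e e hyp] Mem_simeq[OF _ _ _ _ e' e' hyp])
next
  case Bot
  then show ?case by (auto intro: Imp_self)
next
  case (And \<phi> \<psi>)
  have "\<Gamma> \<tturnstile> \<phi> \<^bold>\<and> \<psi> \<^bold>\<longrightarrow> \<phi>' \<^bold>\<and> \<psi>'" if "\<Gamma> \<tturnstile> \<phi> \<^bold>\<longrightarrow> \<phi>'" "\<Gamma> \<tturnstile> \<psi> \<^bold>\<longrightarrow> \<psi>'" for \<Gamma> \<phi> \<psi> \<phi>' \<psi>'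
  proof (rule ImpI)
    have "wff (\<phi> \<^bold>\<longrightarrow> \<phi>')" "wff (\<psi> \<^bold>\<longrightarrow> \<psi>')" using that derives_wff by blast+
    then show w: "wff (\<phi> \<^bold>\<and> \<psi>)" by simp
    let ?D = "insert (\<phi> \<^bold>\<and> \<psi>) \<Gamma>"
    have "?D \<tturnstile> \<phi> \<^bold>\<and> \<psi>" using w by (auto intro: hyp)
    moreover have "?D \<tturnstile> \<phi> \<^bold>\<longrightarrow> \<phi>'" "?D \<tturnstile> \<psi> \<^bold>\<longrightarrow> \<psi>'" using that weaken by blast+
    ultimately show "?D \<tturnstile> \<phi>' \<^bold>\<and> \<psi>'" by (meson AndI AndE1 AndE2 mp)
  qed
  with And show ?case by auto
next
  case (Or \<phi> \<psi>)
  have "\<Gamma> \<tturnstile> \<phi> \<^bold>\<or> \<psi> \<^bold>\<longrightarrow> \<phi>' \<^bold>\<or> \<psi>'" if "\<Gamma> \<tturnstile> \<phi> \<^bold>\<longrightarrow> \<phi>'" "\<Gamma> \<tturnstile> \<psi> \<^bold>\<longrightarrow> \<psi>'" for \<Gamma> \<phi> \<psi> \<phi>' \<psi>'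
  proof (rule ImpI)
    have w: "wff (\<phi> \<^bold>\<longrightarrow> \<phi>')" "wff (\<psi> \<^bold>\<longrightarrow> \<psi>')" using that derives_wff by blast+
    then show "wff (\<phi> \<^bold>\<or> \<psi>)" by simp
    let ?D = "insert (\<phi> \<^bold>\<or> \<psi>) \<Gamma>"
    have d: "insert \<phi> ?D \<tturnstile> \<phi>'" "insert \<psi> ?D \<tturnstile> \<psi>'"
      by (rule weaken[OF ImpD[OF that(1)]] weaken[OF ImpD[OF that(2)]]; blast)+
    show "?D \<tturnstile> \<phi>' \<^bold>\<or> \<psi>'"
      by (rule OrE[of _ \<phi> \<psi>]) (use w d in \<open>auto intro: hyp OrI1 OrI2\<close>)
  qed
  with Or show ?case by auto
next
  case (Imp \<phi> \<psi>)
  have "\<Gamma> \<tturnstile> (\<phi> \<^bold>\<longrightarrow> \<psi>) \<^bold>\<longrightarrow> \<phi>' \<^bold>\<longrightarrow> \<psi>'" if "\<Gamma> \<tturnstile> \<phi>' \<^bold>\<longrightarrow> \<phi>" "\<Gamma> \<tturnstile> \<psi> \<^bold>\<longrightarrow> \<psi>'" for \<Gamma> \<phi> \<psi> \<phi>' \<psi>'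
  proof (rule ImpI, rule ImpI)
    have w: "wff (\<phi>' \<^bold>\<longrightarrow> \<phi>)" "wff (\<psi> \<^bold>\<longrightarrow> \<psi>')" using that derives_wff by blast+
    then show "wff (\<phi> \<^bold>\<longrightarrow> \<psi>)" "wff \<phi>'" by auto
    let ?D = "insert \<phi>' (insert (\<phi> \<^bold>\<longrightarrow> \<psi>) \<Gamma>)"
    have "?D \<tturnstile> \<phi>'" "?D \<tturnstile> \<phi> \<^bold>\<longrightarrow> \<psi>" using w by (auto intro: hyp)
    moreover have "?D \<tturnstile> \<phi>' \<^bold>\<longrightarrow> \<phi>" "?D \<tturnstile> \<psi> \<^bold>\<longrightarrow> \<psi>'"
      by (rule weaken[OF that(1)] weaken[OF that(2)]; blast)+
    ultimately show "?D \<tturnstile> \<psi>'" by (meson mp)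
  qed
  with Imp show ?case by auto
next
  case (Forall w \<phi>)
  let ?H = "{At t \<^bold>\<simeq> vr v}"
  show ?case
  \<comment> \<open>In the first case the substitution changes nothing; otherwise w is neither v nor
    a variable of t.\<close>
  proof (cases "w = v \<or> v \<notin> fv \<phi>")
    case True
    then show ?thesis using Forall.prems by (auto simp: subst_fresh intro!: Imp_self)
  next
    case False
    then have w: "w \<noteq> v" "w \<notin> trm_vars t" and IH: "?H \<tturnstile> \<phi> \<^bold>\<longrightarrow> subst v t \<phi>" "?H \<tturnstile> subst v t \<phi> \<^bold>\<longrightarrow> \<phi>"
      using Forall by auto
    have "?H \<tturnstile> Forall w \<phi> \<^bold>\<longrightarrow> Forall w \<psi>" if "?H \<tturnstile> \<phi> \<^bold>\<longrightarrow> \<psi>" for \<phi> \<psi>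
    proof (intro ImpI ForallI)
      have "wff (\<phi> \<^bold>\<longrightarrow> \<psi>)" using that by (rule derives_wff)
      then show "wff (Forall w \<phi>)" by simp
      then have "insert (Forall w \<phi>) ?H \<tturnstile> Forall w \<phi>" by (auto intro: hyp)
      then have "insert (Forall w \<phi>) ?H \<tturnstile> \<phi>" by (rule ForallE)
      moreover have "insert (Forall w \<phi>) ?H \<tturnstile> \<phi> \<^bold>\<longrightarrow> \<psi>" using that by (rule weaken) blast
      ultimately show "insert (Forall w \<phi>) ?H \<tturnstile> \<psi>" by (blast intro: mp)
    qed (use w in auto)
    with IH w show ?thesis by auto
  qed
next
  case (Exists w \<phi>)
  let ?H = "{At t \<^bold>\<simeq> vr v}"
  show ?case
  proof (cases "w = v \<or> v \<notin> fv \<phi>")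
    case True
    then show ?thesis using Exists.prems by (auto simp: subst_fresh intro!: Imp_self)
  next
    case False
    then have w: "w \<noteq> v" "w \<notin> trm_vars t" and IH: "?H \<tturnstile> \<phi> \<^bold>\<longrightarrow> subst v t \<phi>" "?H \<tturnstile> subst v t \<phi> \<^bold>\<longrightarrow> \<phi>"
      using Exists by auto
    have "?H \<tturnstile> Exists w \<phi> \<^bold>\<longrightarrow> Exists w \<psi>" if "?H \<tturnstile> \<phi> \<^bold>\<longrightarrow> \<psi>" for \<phi> \<psi>
    proof (rule ImpI)
      have "wff (\<phi> \<^bold>\<longrightarrow> \<psi>)" using that by (rule derives_wff)
      then show "wff (Exists w \<phi>)" by simp
      then have E: "insert (Exists w \<phi>) ?H \<tturnstile> Exists w \<phi>" by (auto intro: hyp)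
      have "insert \<phi> (insert (Exists w \<phi>) ?H) \<tturnstile> \<psi>"
        by (rule weaken[OF ImpD[OF that]]) blast
      then have D: "insert \<phi> (insert (Exists w \<phi>) ?H) \<tturnstile> Exists w \<psi>" by (rule ExistsI)
      show "insert (Exists w \<phi>) ?H \<tturnstile> Exists w \<psi>"
        by (rule ExistsE[OF E D]) (use w in auto)
    qed
    with IH w show ?thesis by auto
  qed
qed

section \<open>Naming closed terms by variables\<close>

lemma ex_same:
  assumes "trm_ty a = vty v" "v \<notin> trm_vars a"
  shows "\<Gamma> \<tturnstile> Exists v (At a \<^bold>\<simeq> vr v)"
proof -
  obtain i where n: "ovar i \<notin> insert v (trm_vars a)"
    using ex_fresh[of "insert v (trm_vars a)" "Ty 0"] by auto
  let ?x = "ovar i" and ?s = "vty v"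
  let ?H = "{Eq (trm_ty a) (Var ?x) a}"
  \<comment> \<open>Here v can be instantiated by literal substitution; in the formula to be proved,
    the bound variable of \<open>simeq\<close> was chosen with v present.\<close>
  let ?E = "Eq ?s (Var ?x) a \<^bold>\<and> Eq ?s (Var ?x) (Var v)"
  have "?H \<tturnstile> Eq ?s (Var ?x) a" using assms by (auto intro: hyp)
  then have "?H \<tturnstile> subst v a ?E" using n assms by (auto intro: AndI simp: trm_subst_fresh)
  then have E: "?H \<tturnstile> Exists v ?E" by (rule ExistsI_inst) (use assms in auto)
  have "insert ?E ?H \<tturnstile> ?E" using assms by (auto intro: hyp)
  then have "insert ?E ?H \<tturnstile> Eq ?s (Var ?x) a" "insert ?E ?H \<tturnstile> Eq ?s (Var ?x) (Var v)"
    by (auto intro: AndE1 AndE2)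
  then have "insert ?E ?H \<tturnstile> At a \<^bold>\<simeq> vr v" using assms by (intro simeqI[of _ _ ?x]) auto
  then have D: "insert ?E ?H \<tturnstile> Exists v (At a \<^bold>\<simeq> vr v)" by (rule ExistsI)
  have "?H \<tturnstile> Exists v (At a \<^bold>\<simeq> vr v)" by (rule ExistsE[OF E D]) (use n assms in auto)
  then have "{} \<tturnstile> Exists v (At a \<^bold>\<simeq> vr v)" by (rule name_trm) (use n in auto)
  then show ?thesis by (rule weaken) blast
qed

text \<open>Stated for every bound variable v of type \<open>s\<close>, which spares renaming in
  each use; \<open>denotesI\<close> supplies the missing ones once and for all.\<close>

definition denotes :: "ty \<Rightarrow> ext \<Rightarrow> bool" where
  "denotes s t \<longleftrightarrow> ext_vars t = {} \<and> (\<forall>v. vty v = s \<longrightarrow> {} \<tturnstile> Exists v (t \<^bold>\<simeq> vr v))"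

lemma denotes_closed: "denotes s t \<Longrightarrow> ext_vars t = {}"
  by (simp add: denotes_def)

text \<open>The substitute for instantiating a variable by a closed external term: v takes the place
  of t under a hypothesis that is discharged afterwards.\<close>

lemma name_closed:
  assumes "denotes s t" "insert (t \<^bold>\<simeq> vr v) \<Gamma> \<tturnstile> \<chi>" "vty v = s"
    "\<And>\<gamma>. \<gamma> \<in> \<Gamma> \<Longrightarrow> v \<notin> fv \<gamma>" "v \<notin> fv \<chi>"
  shows "\<Gamma> \<tturnstile> \<chi>"
proof (rule ExistsE[OF _ assms(2)])
  show "\<Gamma> \<tturnstile> Exists v (t \<^bold>\<simeq> vr v)" using assms by (auto simp: denotes_def intro: weaken)
qed (use assms in auto)

lemma name_simeq:
  assumes "denotes s t" "finite \<Gamma>"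
    "\<And>v. vty v = s \<Longrightarrow> insert (t \<^bold>\<simeq> vr v) \<Gamma> \<tturnstile> a \<^bold>\<simeq> b"
  shows "\<Gamma> \<tturnstile> a \<^bold>\<simeq> b"
proof -
  let ?S = "ext_vars a \<union> ext_vars b \<union> \<Union>(fv ` \<Gamma>)"
  obtain i where n: "V s i \<notin> ?S" using ex_fresh[of ?S s] assms(2) by auto
  show ?thesis by (rule name_closed[OF assms(1) assms(3), of "V s i"]) (use n in auto)
qed

lemma name_keq:
  assumes "denotes s t" "finite \<Gamma>"
    "\<And>v. vty v = s \<Longrightarrow> keq (insert (t \<^bold>\<simeq> vr v) \<Gamma>) a b"
  shows "keq \<Gamma> a b"
proof -
  have "kle \<Gamma> a b" if "\<And>v. vty v = s \<Longrightarrow> kle (insert (t \<^bold>\<simeq> vr v) \<Gamma>) a b" for a b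
    unfolding kle_def
  proof (intro allI impI)
    fix x assume x: "vty x = Ty 0"
    let ?S = "insert x (ext_vars a \<union> ext_vars b \<union> \<Union>(fv ` \<Gamma>))"
    obtain i where n: "V s i \<notin> ?S" using ex_fresh[of ?S s] assms(2) by auto
    have "insert (t \<^bold>\<simeq> vr (V s i)) (insert (evalto a x) \<Gamma>) \<tturnstile> evalto b x"
      using that[of "V s i"] x by (auto simp: kle_def insert_commute)
    then show "insert (evalto a x) \<Gamma> \<tturnstile> evalto b x"
      by (rule name_closed[OF assms(1)]) (use n in auto)
  qed
  then show ?thesis using assms(3) by (simp add: keq_def)
qed

text \<open>In type 0 definedness is enough, since an external term is evaluated to a type 0
  variable anyway.\<close>

lemma denotes_if_defined:
  assumes "ext_vars t = {}" "{} \<tturnstile> t \<^bold>\<simeq> t"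
  shows "denotes (Ty 0) t"
  unfolding denotes_def
proof (intro conjI allI impI)
  fix v assume v: "vty v = Ty 0"
  let ?D = "insert (evalto t v) (insert (evalto t v) {})"
  have "?D \<tturnstile> evalto t v" "?D \<tturnstile> evalto (vr v) v"
    using v by (auto intro: hyp eq_refl_trm)
  then have "?D \<tturnstile> Exists v (t \<^bold>\<simeq> vr v)" by (intro ExistsI simeqI)
  with assms(2) show "{} \<tturnstile> Exists v (t \<^bold>\<simeq> vr v)"
    by (rule simeqE) (use v assms in auto)
qed (rule assms)

lemma keq_name: "(t \<^bold>\<simeq> vr v) \<in> \<Gamma> \<Longrightarrow> keq \<Gamma> t (vr v)"
  by (rule keq_if_simeq, rule hyp) auto

lemma denotes_defined:
  assumes "denotes s t"
  shows "\<Gamma> \<tturnstile> t \<^bold>\<simeq> t"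
proof -
  have "{} \<tturnstile> t \<^bold>\<simeq> t"
  proof (rule name_simeq[OF assms])
    fix v
    let ?H = "{t \<^bold>\<simeq> vr v}"
    show "?H \<tturnstile> t \<^bold>\<simeq> t"
      by (rule simeq_keq[of _ t "vr v" t t]) (auto intro: hyp keq_refl keq_sym keq_name)
  qed auto
  then show ?thesis by (rule weaken) blast
qed

lemma denotes_Ty0: "denotes s t \<Longrightarrow> denotes (Ty 0) t"
  by (rule denotes_if_defined) (auto simp: denotes_closed intro: denotes_defined)

lemma denotes_const: "denotes (const_ty c) (cst c)"
  by (simp add: denotes_def ex_same)

lemma simeq_of_keq:
  assumes "denotes s t" "finite \<Gamma>" "keq \<Gamma> t u"
  shows "\<Gamma> \<tturnstile> t \<^bold>\<simeq> u"
  using simeq_keq[OF assms(2) denotes_defined[OF assms(1)] keq_refl assms(3)] .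

lemma denotes_keq:
  assumes "denotes s t" "keq {} t u" "ext_vars u = {}"
  shows "denotes (Ty 0) u"
  using simeq_keq[OF _ denotes_defined[OF assms(1)] assms(2,2)] assms(3)
  by (auto intro: denotes_if_defined)

lemma denotes_AppD:
  assumes "denotes s (t \<cdot> u)"
  shows "denotes (Ty 0) t" "denotes (Ty 0) u"
  using simeq_AppD[OF denotes_defined[OF assms, of "{}"]] denotes_closed[OF assms]
  by (auto intro: denotes_if_defined)

section \<open>The combinatorial axioms for closed terms\<close>

lemma comb: "comb_ax \<phi> \<Longrightarrow> wff \<phi> \<Longrightarrow> \<Gamma> \<tturnstile> \<phi>"
  by (intro theorem_ by_combinatorial)

lemma ovarE: "vty x = Ty 0 \<Longrightarrow> (\<And>i. x = ovar i \<Longrightarrow> P) \<Longrightarrow> P"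
  by (cases x) auto

lemma nvarE: "vty x = Omega \<Longrightarrow> (\<And>i. x = nvar i \<Longrightarrow> P) \<Longrightarrow> P"
  by (cases x) auto

text \<open>Pattern for the lemmas that follow: the closed terms are named by variables, the axiom
  is applied to these, and congruence of application carries it back.\<close>

lemma keq_k:
  assumes "denotes (Ty 0) t" "denotes (Ty 0) u"
  shows "keq {} (cst CK \<cdot> t \<cdot> u) t"
proof (rule name_keq[OF assms(1)], simp, rule name_keq[OF assms(2)], simp)
  fix x y assume xy: "vty x = Ty 0" "vty y = Ty 0"
  let ?H = "{u \<^bold>\<simeq> vr y, t \<^bold>\<simeq> vr x}"
  have "?H \<tturnstile> evalto (cst CK \<cdot> vr x \<cdot> vr y) x"
    using xy by (elim ovarE) (auto intro!: comb k_eq)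
  then have "keq ?H (cst CK \<cdot> vr x \<cdot> vr y) (vr x)" by (rule keq_Var_if_evalto)
  moreover have "keq ?H (cst CK \<cdot> t \<cdot> u) (cst CK \<cdot> vr x \<cdot> vr y)"
    by (intro keq_App keq_refl keq_name) auto
  moreover have "keq ?H (vr x) t" by (intro keq_sym[OF keq_name]) auto
  ultimately show "keq ?H (cst CK \<cdot> t \<cdot> u) t" by (blast intro: keq_trans)
qed

lemma keq_if_kleene_eq:
  assumes "\<Gamma> \<tturnstile> t \<^bold>\<cong> u"
  shows "keq \<Gamma> t u"
proof -
  let ?x = "ovar (fresh_idx (ext_vars t \<union> ext_vars u))"
  have x: "?x \<notin> ext_vars t \<union> ext_vars u" by (intro fresh_idx_notin) auto
  have K: "t \<^bold>\<cong> u = Forall ?x (evalto t ?x \<^bold>\<longleftrightarrow> evalto u ?x)" by (simp add: kleene_eq_def Let_def)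
  have fK: "?x \<notin> fv (t \<^bold>\<cong> u)" unfolding K by simp
  have wK: "wff (t \<^bold>\<cong> u)" using assms by (rule derives_wff)
  have *: "kle \<Gamma> a b" if ab: "a = t \<and> b = u \<or> a = u \<and> b = t" for a b
    unfolding kle_def
  proof (intro allI impI)
    fix y assume y: "vty y = Ty 0"
    let ?H = "{t \<^bold>\<cong> u, evalto a y}"
    have st: "\<Delta> \<tturnstile> evalto a ?x \<Longrightarrow> \<Delta> \<tturnstile> t \<^bold>\<cong> u \<Longrightarrow> \<Delta> \<tturnstile> evalto b ?x" for \<Delta>
    proof -
      assume a: "\<Delta> \<tturnstile> evalto a ?x" "\<Delta> \<tturnstile> t \<^bold>\<cong> u"
      then have "\<Delta> \<tturnstile> evalto t ?x \<^bold>\<longleftrightarrow> evalto u ?x" unfolding K by (blast intro: ForallE)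
      then have "\<Delta> \<tturnstile> evalto a ?x \<^bold>\<longrightarrow> evalto b ?x" using ab by (auto intro: AndE1 AndE2)
      then show ?thesis using a(1) by (rule mp)
    qed
    have "?H \<tturnstile> evalto b y"
    \<comment> \<open>\<open>kleene_eq\<close> binds one fixed variable \<open>?x\<close>, whereas
      \<open>kle\<close> concerns every y; a different y is first equated with
      \<open>?x\<close>.\<close>
    proof (cases "y = ?x")
      case True
      have "?H \<tturnstile> evalto a ?x" using True by (auto intro: hyp)
      moreover have "?H \<tturnstile> t \<^bold>\<cong> u" using wK by (auto intro: hyp)
      ultimately show ?thesis unfolding True by (rule st)
    next
      case False
      let ?D = "insert (Eq (trm_ty (Var y)) (Var ?x) (Var y)) ?H"
      have e: "?D \<tturnstile> Eq (Ty 0) (Var ?x) (Var y)" using y by (auto intro: hyp)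
      have "?D \<tturnstile> Eq (Ty 0) (Var y) (Var ?x)" by (rule eq_sym0[OF _ _ e]) (use y in auto)
      moreover have "?D \<tturnstile> evalto a y" using y by (auto intro: hyp)
      ultimately have "?D \<tturnstile> evalto a ?x" by (blast intro: evalto_cong)
      moreover have "?D \<tturnstile> t \<^bold>\<cong> u" using wK by (auto intro: hyp)
      ultimately have "?D \<tturnstile> evalto b ?x" by (rule st)
      then have "?D \<tturnstile> evalto b y" using e by (rule evalto_cong)
      then show ?thesis
        by (rule name_trm) (use False x fK ab in auto)
    qed
    then have "insert (t \<^bold>\<cong> u) (insert (evalto a y) \<Gamma>) \<tturnstile> evalto b y" by (rule weaken) blast
    moreover have "insert (evalto a y) \<Gamma> \<tturnstile> t \<^bold>\<cong> u" using assms by (rule weaken) blast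
    ultimately show "insert (evalto a y) \<Gamma> \<tturnstile> evalto b y" by (rule cut)
  qed
  show ?thesis unfolding keq_def using * by blast
qed

lemma wff_defined [simp]: "wff (defined t)"
  by (simp add: defined_def Let_def)

lemma wff_kleene_eq [simp]: "wff (t \<^bold>\<cong> u)"
  by (simp add: kleene_eq_def Let_def)

lemma keq_s:
  assumes "denotes (Ty 0) t" "denotes (Ty 0) u" "denotes (Ty 0) v"
  shows "keq {} (cst CS \<cdot> t \<cdot> u \<cdot> v) (t \<cdot> v \<cdot> (u \<cdot> v))"
proof (rule name_keq[OF assms(1)], simp, rule name_keq[OF assms(2)], simp,
    rule name_keq[OF assms(3)], simp)
  fix x y z assume xy: "vty x = Ty 0" "vty y = Ty 0" "vty z = Ty 0"
  let ?H = "{v \<^bold>\<simeq> vr z, u \<^bold>\<simeq> vr y, t \<^bold>\<simeq> vr x}"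
  have "?H \<tturnstile> cst CS \<cdot> vr x \<cdot> vr y \<cdot> vr z \<^bold>\<cong> vr x \<cdot> vr z \<cdot> (vr y \<cdot> vr z)"
    using xy by (elim ovarE) (auto intro!: comb s_eq)
  then have "keq ?H (cst CS \<cdot> vr x \<cdot> vr y \<cdot> vr z) (vr x \<cdot> vr z \<cdot> (vr y \<cdot> vr z))"
    by (rule keq_if_kleene_eq)
  moreover have "keq ?H (cst CS \<cdot> t \<cdot> u \<cdot> v) (cst CS \<cdot> vr x \<cdot> vr y \<cdot> vr z)"
    by (intro keq_App keq_refl keq_name) auto
  moreover have "keq ?H (vr x \<cdot> vr z \<cdot> (vr y \<cdot> vr z)) (t \<cdot> v \<cdot> (u \<cdot> v))"
    by (intro keq_App keq_sym[OF keq_name]) auto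
  ultimately show "keq ?H (cst CS \<cdot> t \<cdot> u \<cdot> v) (t \<cdot> v \<cdot> (u \<cdot> v))" by (blast intro: keq_trans)
qed

lemma denotes_binary:
  assumes "denotes (Ty 0) t" "denotes (Ty 0) u"
    and "\<And>x y. vty x = Ty 0 \<Longrightarrow> vty y = Ty 0 \<Longrightarrow> \<turnstile>\<^sub>B\<^sub>T defined (cst c \<cdot> vr x \<cdot> vr y)"
  shows "denotes (Ty 0) (cst c \<cdot> t \<cdot> u)"
proof (rule denotes_if_defined)
  show "{} \<tturnstile> cst c \<cdot> t \<cdot> u \<^bold>\<simeq> cst c \<cdot> t \<cdot> u"
  proof (rule name_simeq[OF assms(1)], simp, rule name_simeq[OF assms(2)], simp)
    fix x y assume xy: "vty x = Ty 0" "vty y = Ty 0"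
    let ?H = "{u \<^bold>\<simeq> vr y, t \<^bold>\<simeq> vr x}"
    have "?H \<tturnstile> defined (cst c \<cdot> vr x \<cdot> vr y)" by (intro theorem_ assms xy)
    then have "?H \<tturnstile> cst c \<cdot> vr x \<cdot> vr y \<^bold>\<simeq> cst c \<cdot> vr x \<cdot> vr y" by (simp add: defined_iff)
    moreover have "keq ?H (cst c \<cdot> vr x \<cdot> vr y) (cst c \<cdot> t \<cdot> u)"
      by (intro keq_App keq_refl keq_sym[OF keq_name]) auto
    ultimately show "?H \<tturnstile> cst c \<cdot> t \<cdot> u \<^bold>\<simeq> cst c \<cdot> t \<cdot> u" by (auto intro: simeq_keq)
  qed
qed (use assms denotes_closed in auto)

lemma denotes_unary:
  assumes "denotes (Ty 0) t"
    and "\<And>x. vty x = Ty 0 \<Longrightarrow> \<turnstile>\<^sub>B\<^sub>T defined (cst c \<cdot> vr x)"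
  shows "denotes (Ty 0) (cst c \<cdot> t)"
proof (rule denotes_if_defined)
  show "{} \<tturnstile> cst c \<cdot> t \<^bold>\<simeq> cst c \<cdot> t"
  proof (rule name_simeq[OF assms(1)], simp)
    fix x assume x: "vty x = Ty 0"
    let ?H = "{t \<^bold>\<simeq> vr x}"
    have "?H \<tturnstile> defined (cst c \<cdot> vr x)" by (intro theorem_ assms x)
    then have "?H \<tturnstile> cst c \<cdot> vr x \<^bold>\<simeq> cst c \<cdot> vr x" by (simp add: defined_iff)
    moreover have "keq ?H (cst c \<cdot> vr x) (cst c \<cdot> t)"
      by (intro keq_App keq_refl keq_sym[OF keq_name]) auto
    ultimately show "?H \<tturnstile> cst c \<cdot> t \<^bold>\<simeq> cst c \<cdot> t" by (auto intro: simeq_keq)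
  qed
qed (use assms denotes_closed in auto)

lemma denotes_s:
  assumes "denotes (Ty 0) t" "denotes (Ty 0) u"
  shows "denotes (Ty 0) (cst CS \<cdot> t \<cdot> u)"
  using assms by (rule denotes_binary) (elim ovarE, auto intro!: by_combinatorial s_def)

lemma denotes_p:
  assumes "denotes (Ty 0) t" "denotes (Ty 0) u"
  shows "denotes (Ty 0) (cst CP \<cdot> t \<cdot> u)"
  using assms by (rule denotes_binary) (elim ovarE, auto intro!: by_combinatorial p_def)

lemma denotes_p1: "denotes (Ty 0) t \<Longrightarrow> denotes (Ty 0) (cst CP1 \<cdot> t)"
  by (erule denotes_unary) (elim ovarE, auto intro!: by_combinatorial p1_def)

lemma denotes_p2: "denotes (Ty 0) t \<Longrightarrow> denotes (Ty 0) (cst CP2 \<cdot> t)"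
  by (erule denotes_unary) (elim ovarE, auto intro!: by_combinatorial p2_def)

text \<open>\<open>k t\<close> is a part of \<open>k t t\<close>, which is defined because it equals
  t.\<close>

lemma denotes_k:
  assumes "denotes (Ty 0) t"
  shows "denotes (Ty 0) (cst CK \<cdot> t)"
  using denotes_keq[OF assms keq_sym[OF keq_k[OF assms assms]]] denotes_closed[OF assms]
  by (auto dest: denotes_AppD(1))

lemma keq_proj:
  assumes "denotes (Ty 0) t" "denotes (Ty 0) u"
  shows "keq {} (cst CP1 \<cdot> (cst CP \<cdot> t \<cdot> u)) t" "keq {} (cst CP2 \<cdot> (cst CP \<cdot> t \<cdot> u)) u"
proof -
  have *: "keq {} (cst c \<cdot> (cst CP \<cdot> t \<cdot> u)) w"
    if "c = CP1 \<and> w = t \<or> c = CP2 \<and> w = u" for c w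
  proof (rule name_keq[OF assms(1)], simp, rule name_keq[OF assms(2)], simp)
    fix x y assume xy: "vty x = Ty 0" "vty y = Ty 0"
    let ?H = "{u \<^bold>\<simeq> vr y, t \<^bold>\<simeq> vr x}"
    have "?H \<tturnstile> evalto (cst CP1 \<cdot> (cst CP \<cdot> vr x \<cdot> vr y)) x"
      using xy by (elim ovarE) (auto intro!: comb p1_eq)
    then have "keq ?H (cst CP1 \<cdot> (cst CP \<cdot> vr x \<cdot> vr y)) (vr x)" by (rule keq_Var_if_evalto)
    moreover have "?H \<tturnstile> evalto (cst CP2 \<cdot> (cst CP \<cdot> vr x \<cdot> vr y)) y"
      using xy by (elim ovarE) (auto intro!: comb p2_eq)
    then have "keq ?H (cst CP2 \<cdot> (cst CP \<cdot> vr x \<cdot> vr y)) (vr y)" by (rule keq_Var_if_evalto)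
    moreover have "keq ?H (vr x) t" "keq ?H (vr y) u" by (intro keq_sym[OF keq_name]; simp)+
    ultimately have "keq ?H (cst c \<cdot> (cst CP \<cdot> vr x \<cdot> vr y)) w" using that by (elim disjE) (auto elim: keq_trans)
    moreover have "keq ?H (cst c \<cdot> (cst CP \<cdot> t \<cdot> u)) (cst c \<cdot> (cst CP \<cdot> vr x \<cdot> vr y))"
      by (intro keq_App keq_refl keq_name) auto
    ultimately show "keq ?H (cst c \<cdot> (cst CP \<cdot> t \<cdot> u)) w" by (rule keq_trans[rotated])
  qed
  show "keq {} (cst CP1 \<cdot> (cst CP \<cdot> t \<cdot> u)) t" "keq {} (cst CP2 \<cdot> (cst CP \<cdot> t \<cdot> u)) u"
    by (auto intro: *)
qed

lemma pair_not_zero: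
  assumes "denotes (Ty 0) t" "denotes (Ty 0) u"
  shows "{cst CP \<cdot> t \<cdot> u \<^bold>\<simeq> cst Zero} \<tturnstile> \<^bold>\<bottom>"
proof -
  let ?P = "cst CP \<cdot> t \<cdot> u \<^bold>\<simeq> cst Zero"
  have fP: "fv ?P = {}" using assms denotes_closed by auto
  let ?x = "ovar 0" and ?y = "ovar 1"
  let ?H = "{u \<^bold>\<simeq> vr ?y, t \<^bold>\<simeq> vr ?x, ?P}"
  have "keq ?H (cst CP \<cdot> t \<cdot> u) (cst CP \<cdot> vr ?x \<cdot> vr ?y)"
    by (intro keq_App keq_refl keq_name) auto
  then have "?H \<tturnstile> cst CP \<cdot> vr ?x \<cdot> vr ?y \<^bold>\<simeq> cst Zero"
    by (rule simeq_keq[rotated 2]) (auto intro: hyp keq_refl)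
  moreover have "?H \<tturnstile> \<^bold>\<not> (cst CP \<cdot> vr ?x \<cdot> vr ?y \<^bold>\<simeq> cst Zero)" by (auto intro!: comb p_nonzero)
  ultimately have "?H \<tturnstile> \<^bold>\<bottom>" by (blast intro: mp)
  then have "{t \<^bold>\<simeq> vr ?x, ?P} \<tturnstile> \<^bold>\<bottom>"
    by (rule name_closed[OF assms(2)]) (use fP assms denotes_closed in auto)
  then show ?thesis
    by (rule name_closed[OF assms(1)]) (use fP assms denotes_closed in auto)
qed

lemma keq_d_eq:
  assumes "denotes (Ty 0) t" "denotes (Ty 0) u" "denotes Omega a"
  shows "keq {} (cst CD \<cdot> t \<cdot> u \<cdot> a \<cdot> a) t"
proof (rule name_keq[OF assms(1)], simp, rule name_keq[OF assms(2)], simp,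
    rule name_keq[OF assms(3)], simp)
  fix x y n assume xy: "vty x = Ty 0" "vty y = Ty 0" "vty n = Omega"
  let ?H = "{a \<^bold>\<simeq> vr n, u \<^bold>\<simeq> vr y, t \<^bold>\<simeq> vr x}"
  have "?H \<tturnstile> vr n \<^bold>\<simeq> vr n \<^bold>\<longrightarrow> evalto (cst CD \<cdot> vr x \<cdot> vr y \<cdot> vr n \<cdot> vr n) x"
    using xy by (elim ovarE nvarE) (auto intro!: comb d_eq)
  then have "?H \<tturnstile> evalto (cst CD \<cdot> vr x \<cdot> vr y \<cdot> vr n \<cdot> vr n) x"
    using simeq_At_refl by (rule mp)
  then have "keq ?H (cst CD \<cdot> vr x \<cdot> vr y \<cdot> vr n \<cdot> vr n) (vr x)" by (rule keq_Var_if_evalto)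
  moreover have "keq ?H (cst CD \<cdot> t \<cdot> u \<cdot> a \<cdot> a) (cst CD \<cdot> vr x \<cdot> vr y \<cdot> vr n \<cdot> vr n)"
    by (intro keq_App keq_refl keq_name) auto
  moreover have "keq ?H (vr x) t" by (intro keq_sym[OF keq_name]) auto
  ultimately show "keq ?H (cst CD \<cdot> t \<cdot> u \<cdot> a \<cdot> a) t" by (blast intro: keq_trans)
qed

lemma keq_d_neq:
  assumes "denotes (Ty 0) t" "denotes (Ty 0) u" "denotes Omega a" "denotes Omega b"
    and "{a \<^bold>\<simeq> b} \<tturnstile> \<^bold>\<bottom>"
  shows "keq {} (cst CD \<cdot> t \<cdot> u \<cdot> a \<cdot> b) u"
proof (rule name_keq[OF assms(1)], simp, rule name_keq[OF assms(2)], simp,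
    rule name_keq[OF assms(3)], simp, rule name_keq[OF assms(4)], simp)
  fix x y n m assume xy: "vty x = Ty 0" "vty y = Ty 0" "vty n = Omega" "vty m = Omega"
  let ?H = "{b \<^bold>\<simeq> vr m, a \<^bold>\<simeq> vr n, u \<^bold>\<simeq> vr y, t \<^bold>\<simeq> vr x}"
  have "?H \<tturnstile> \<^bold>\<not> (vr n \<^bold>\<simeq> vr m) \<^bold>\<longrightarrow> evalto (cst CD \<cdot> vr x \<cdot> vr y \<cdot> vr n \<cdot> vr m) y"
    using xy by (elim ovarE nvarE) (auto intro!: comb d_neq)
  \<comment> \<open>The refutation of a = b is carried over to the variables that name a and
    b.\<close>
  moreover have "?H \<tturnstile> \<^bold>\<not> (vr n \<^bold>\<simeq> vr m)"
  proof (rule ImpI)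
    let ?D = "insert (vr n \<^bold>\<simeq> vr m) ?H"
    have "?D \<tturnstile> a \<^bold>\<simeq> b"
      by (rule simeq_keq[of _ "vr n" "vr m"]) (auto intro!: hyp keq_sym[OF keq_name])
    moreover have "insert (a \<^bold>\<simeq> b) ?D \<tturnstile> \<^bold>\<bottom>" using assms(5) by (rule weaken) blast
    ultimately show "?D \<tturnstile> \<^bold>\<bottom>" by (blast intro: cut)
  qed simp
  ultimately have "?H \<tturnstile> evalto (cst CD \<cdot> vr x \<cdot> vr y \<cdot> vr n \<cdot> vr m) y" by (rule mp)
  then have "keq ?H (cst CD \<cdot> vr x \<cdot> vr y \<cdot> vr n \<cdot> vr m) (vr y)" by (rule keq_Var_if_evalto)
  moreover have "keq ?H (cst CD \<cdot> t \<cdot> u \<cdot> a \<cdot> b) (cst CD \<cdot> vr x \<cdot> vr y \<cdot> vr n \<cdot> vr m)"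
    by (intro keq_App keq_refl keq_name) auto
  moreover have "keq ?H (vr y) u" by (intro keq_sym[OF keq_name]) auto
  ultimately show "keq ?H (cst CD \<cdot> t \<cdot> u \<cdot> a \<cdot> b) u" by (blast intro: keq_trans)
qed

text \<open>\<open>d t u a\<close> is a part of \<open>d t u a a\<close>, which is defined because
  it equals t.\<close>

lemma denotes_d:
  assumes "denotes (Ty 0) t" "denotes (Ty 0) u" "denotes Omega a"
  shows "denotes (Ty 0) (cst CD \<cdot> t \<cdot> u \<cdot> a)"
  using denotes_keq[OF assms(1) keq_sym[OF keq_d_eq[OF assms]]] assms denotes_closed
  by (auto dest: denotes_AppD(1))

text \<open>An object equal to t, found under a bound variable w, is copied to v; that w and v
  differ is what \<open>ex_same\<close> asks for.\<close>

lemma denotesI: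
  assumes "ext_vars t = {}"
    and "\<And>v. vty v = s \<Longrightarrow> \<exists>w. vty w = s \<and> w \<noteq> v \<and> {} \<tturnstile> Exists w (t \<^bold>\<simeq> vr w)"
  shows "denotes s t"
  unfolding denotes_def
proof (intro conjI allI impI assms(1))
  fix v assume v: "vty v = s"
  then obtain w where w: "vty w = s" "w \<noteq> v" "{} \<tturnstile> Exists w (t \<^bold>\<simeq> vr w)" using assms by blast
  let ?D = "insert (vr w \<^bold>\<simeq> vr v) {t \<^bold>\<simeq> vr w}"
  have k: "keq ?D (vr w) (vr v)" by (intro keq_name) simp
  have "?D \<tturnstile> t \<^bold>\<simeq> vr v"
    by (rule simeq_keq[OF _ _ keq_refl k]) (auto intro: hyp)
  then have D: "?D \<tturnstile> Exists v (t \<^bold>\<simeq> vr v)" by (rule ExistsI)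
  have E: "{t \<^bold>\<simeq> vr w} \<tturnstile> Exists v (vr w \<^bold>\<simeq> vr v)" by (rule ex_same) (use v w in auto)
  have "{t \<^bold>\<simeq> vr w} \<tturnstile> Exists v (t \<^bold>\<simeq> vr v)"
    by (rule ExistsE[OF E D]) (use w assms in auto)
  with w(3) show "{} \<tturnstile> Exists v (t \<^bold>\<simeq> vr v)"
    by (rule ExistsE) (use w assms in auto)
qed

lemma denotes_Suc:
  assumes "denotes Omega a"
  shows "denotes Omega (cst CP \<cdot> a \<cdot> cst Zero)"
  unfolding denotes_def
proof (intro conjI allI impI)
  fix m assume m: "vty m = Omega"
  then obtain j where j: "m = nvar j" by (rule nvarE)
  \<comment> \<open>The successor index makes the argument variable differ from m, as
    \<open>p_num\<close> demands.\<close>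
  let ?n = "nvar (Suc j)"
  let ?A = "cst CP \<cdot> a \<cdot> cst Zero" and ?B = "cst CP \<cdot> vr ?n \<cdot> cst Zero"
  let ?H = "{a \<^bold>\<simeq> vr ?n}"
  have E: "?H \<tturnstile> Exists m (?B \<^bold>\<simeq> vr m)" using j by (auto intro!: comb p_num)
  let ?D = "insert (?B \<^bold>\<simeq> vr m) ?H"
  have "keq ?D ?B ?A" by (intro keq_App keq_refl keq_sym[OF keq_name]) auto
  then have "?D \<tturnstile> ?A \<^bold>\<simeq> vr m" by (rule simeq_keq[rotated 2]) (auto intro: hyp keq_refl)
  then have D: "?D \<tturnstile> Exists m (?A \<^bold>\<simeq> vr m)" by (rule ExistsI)
  have "?H \<tturnstile> Exists m (?A \<^bold>\<simeq> vr m)"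
    by (rule ExistsE[OF E D]) (use j denotes_closed[OF assms] in auto)
  then show "{} \<tturnstile> Exists m (?A \<^bold>\<simeq> vr m)"
    by (rule name_closed[OF assms]) (use j denotes_closed[OF assms] in auto)
qed (use denotes_closed[OF assms] in auto)

lemma denotes_pair_type:
  assumes "denotes (Ty 0) t" "denotes (Ty (Suc k)) u"
  shows "denotes (Ty (Suc k)) (cst CP \<cdot> t \<cdot> u)"
  unfolding denotes_def
proof (intro conjI allI impI)
  fix B assume B: "vty B = Ty (Suc k)"
  then obtain j where j: "B = V (Ty (Suc k)) j" by (cases B) auto
  let ?x = "ovar 0" and ?y = "V (Ty (Suc k)) (Suc j)"
  let ?A = "cst CP \<cdot> t \<cdot> u" and ?B = "cst CP \<cdot> vr ?x \<cdot> vr ?y"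
  let ?H = "{u \<^bold>\<simeq> vr ?y, t \<^bold>\<simeq> vr ?x}"
  have E: "?H \<tturnstile> Exists B (?B \<^bold>\<simeq> vr B)" using j by (auto intro!: comb p_type)
  let ?D = "insert (?B \<^bold>\<simeq> vr B) ?H"
  have "keq ?D ?B ?A" by (intro keq_App keq_refl keq_sym[OF keq_name]) auto
  then have "?D \<tturnstile> ?A \<^bold>\<simeq> vr B" by (rule simeq_keq[rotated 2]) (auto intro: hyp keq_refl)
  then have D: "?D \<tturnstile> Exists B (?A \<^bold>\<simeq> vr B)" by (rule ExistsI)
  have c: "ext_vars t = {}" "ext_vars u = {}" using assms denotes_closed by auto
  have "?H \<tturnstile> Exists B (?A \<^bold>\<simeq> vr B)"
    by (rule ExistsE[OF E D]) (use j c in auto)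
  then have "{t \<^bold>\<simeq> vr ?x} \<tturnstile> Exists B (?A \<^bold>\<simeq> vr B)"
    by (rule name_closed[OF assms(2)]) (use j c in auto)
  then show "{} \<tturnstile> Exists B (?A \<^bold>\<simeq> vr B)"
    by (rule name_closed[OF assms(1)]) (use j c in auto)
qed (use denotes_closed assms in auto)

section \<open>Values\<close>

text \<open>The side conditions of the comprehension axiom that do not concern U, together with the
  well-formedness that \<open>BT\<close> imposes on instances.\<close>

definition compr :: "nat \<Rightarrow> var \<Rightarrow> var list \<Rightarrow> form \<Rightarrow> bool" where
  "compr k Z Xs \<phi> \<longleftrightarrow> vty Z = Ty k \<and> (\<forall>v\<in>set Xs. ty_le (vty v) (Suc k)) \<and> distinct (Z # Xs) \<and>
     elementary (Suc k) \<phi> \<and> fv \<phi> \<subseteq> set (Z # Xs) \<and> wff \<phi>"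

abbreviation compr_term :: "var \<Rightarrow> var list \<Rightarrow> form \<Rightarrow> ext list \<Rightarrow> ext" where
  "compr_term Z Xs \<phi> ts \<equiv> app_tuple (cst (CC (goedel Z Xs \<phi>))) ts"

inductive dom :: "ty \<Rightarrow> ext \<Rightarrow> bool" where
  dom_zero: "dom Omega (cst Zero)"
| dom_Suc: "dom Omega n \<Longrightarrow> dom Omega (cst CP \<cdot> n \<cdot> cst Zero)"
| dom_compr: "compr k Z Xs \<phi> \<Longrightarrow> list_all2 (\<lambda>X t. dom (vty X) t) Xs ts \<Longrightarrow>
    dom (Ty (Suc k)) (compr_term Z Xs \<phi> ts)"
| dom_pair_type: "dom (Ty 0) x \<Longrightarrow> dom (Ty (Suc k)) y \<Longrightarrow> dom (Ty (Suc k)) (cst CP \<cdot> x \<cdot> y)"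
| dom_type: "dom s x \<Longrightarrow> dom (Ty 0) x"
| dom_const: "const_ty c = Ty 0 \<Longrightarrow> dom (Ty 0) (cst c)"
| dom_k: "dom (Ty 0) x \<Longrightarrow> dom (Ty 0) (cst CK \<cdot> x)"
| dom_s1: "dom (Ty 0) x \<Longrightarrow> dom (Ty 0) (cst CS \<cdot> x)"
| dom_s2: "dom (Ty 0) x \<Longrightarrow> dom (Ty 0) y \<Longrightarrow> dom (Ty 0) (cst CS \<cdot> x \<cdot> y)"
| dom_p1: "dom (Ty 0) x \<Longrightarrow> dom (Ty 0) (cst CP \<cdot> x)"
| dom_p2: "dom (Ty 0) x \<Longrightarrow> dom (Ty 0) y \<Longrightarrow> dom (Ty 0) (cst CP \<cdot> x \<cdot> y)"
| dom_proj1: "dom (Ty 0) x \<Longrightarrow> dom (Ty 0) (cst CP1 \<cdot> x)"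
| dom_proj2: "dom (Ty 0) x \<Longrightarrow> dom (Ty 0) (cst CP2 \<cdot> x)"
| dom_d1: "dom (Ty 0) x \<Longrightarrow> dom (Ty 0) (cst CD \<cdot> x)"
| dom_d2: "dom (Ty 0) x \<Longrightarrow> dom (Ty 0) y \<Longrightarrow> dom (Ty 0) (cst CD \<cdot> x \<cdot> y)"
| dom_d3: "dom (Ty 0) x \<Longrightarrow> dom (Ty 0) y \<Longrightarrow> dom Omega n \<Longrightarrow> dom (Ty 0) (cst CD \<cdot> x \<cdot> y \<cdot> n)"

text \<open>
  The projections are total by axiom, hence \<open>p\<^sub>i x\<close> is a value when \<open>x\<close> is not a pair.
\<close>

inductive eval :: "ext \<Rightarrow> ext \<Rightarrow> ext \<Rightarrow> bool" where
  eval_k1: "eval (cst CK) x (cst CK \<cdot> x)"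
| eval_k2: "eval (cst CK \<cdot> x) y x"
| eval_s1: "eval (cst CS) x (cst CS \<cdot> x)"
| eval_s2: "eval (cst CS \<cdot> x) y (cst CS \<cdot> x \<cdot> y)"
| eval_s3: "eval x z a \<Longrightarrow> eval y z b \<Longrightarrow> eval a b c \<Longrightarrow> eval (cst CS \<cdot> x \<cdot> y) z c"
| eval_p1: "eval (cst CP) x (cst CP \<cdot> x)"
| eval_p2: "eval (cst CP \<cdot> x) y (cst CP \<cdot> x \<cdot> y)"
| eval_proj1: "eval (cst CP1) (cst CP \<cdot> x \<cdot> y) x"
| eval_proj1': "\<nexists>a b. x = cst CP \<cdot> a \<cdot> b \<Longrightarrow> eval (cst CP1) x (cst CP1 \<cdot> x)"
| eval_proj2: "eval (cst CP2) (cst CP \<cdot> x \<cdot> y) y"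
| eval_proj2': "\<nexists>a b. x = cst CP \<cdot> a \<cdot> b \<Longrightarrow> eval (cst CP2) x (cst CP2 \<cdot> x)"
| eval_d1: "eval (cst CD) x (cst CD \<cdot> x)"
| eval_d2: "eval (cst CD \<cdot> x) y (cst CD \<cdot> x \<cdot> y)"
| eval_d3: "dom Omega n \<Longrightarrow> eval (cst CD \<cdot> x \<cdot> y) n (cst CD \<cdot> x \<cdot> y \<cdot> n)"
| eval_d_eq: "dom Omega n \<Longrightarrow> eval (cst CD \<cdot> x \<cdot> y \<cdot> n) n x"
| eval_d_neq: "dom Omega n \<Longrightarrow> dom Omega m \<Longrightarrow> n \<noteq> m \<Longrightarrow> eval (cst CD \<cdot> x \<cdot> y \<cdot> n) m y"
| eval_c: "dom (Ty (Suc k)) (cst (CC n) \<cdot> x) \<Longrightarrow> eval (cst (CC n)) x (cst (CC n) \<cdot> x)"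

text \<open>The rules exclude one another: the stuck projections require an argument that is not a
  pair, and the last two rules for \<open>d\<close> are separated by identity of numerals. Only
  \<open>eval_s3\<close> is recursive.\<close>

lemma eval_functional: "eval f x y \<Longrightarrow> eval f x y' \<Longrightarrow> y = y'"
proof (induction arbitrary: y' rule: eval.induct)
  case (eval_s3 x z a y b c)
  from eval_s3.prems obtain a' b' where "eval x z a'" "eval y z b'" "eval a' b' y'"
    by (cases rule: eval.cases) auto
  with eval_s3.IH show ?case by auto
qed (erule eval.cases; force)+

text \<open>\<open>eval\<close> does not ask that x and y in \<open>s x y\<close> and its like be
  values; this is recovered from the operator being one. In a comprehension term the argument is a
  tuple, that is an iterated pair of values.\<close>

lemma dom_App: "dom s t \<Longrightarrow> t = f \<cdot> x \<Longrightarrow> dom (Ty 0) f \<and> dom (Ty 0) x"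
proof (induction arbitrary: f x rule: dom.induct)
  case (dom_compr k Z Xs \<phi> ts)
  show ?case
  proof (cases ts)
    case (Cons t us)
    have "\<forall>t\<in>set ts. dom (Ty 0) t"
      using dom_compr(2) dom_type by (fastforce simp: list_all2_conv_all_nth in_set_conv_nth)
    then have "dom (Ty 0) t" "\<forall>u\<in>set us. dom (Ty 0) u" using Cons by auto
    then have "dom (Ty 0) (foldl (\<lambda>a b. cst CP \<cdot> a \<cdot> b) t us)"
      by (induction us arbitrary: t) (auto intro: dom_p2)
    with dom_compr Cons show ?thesis by (auto intro: dom_const)
  qed (use dom_compr in auto)
qed (auto intro: dom.intros)

section \<open>Comprehension terms with closed parameters\<close>

lemma app_tuple_vars: "ext_vars (app_tuple t us) = ext_vars t \<union> (\<Union>u\<in>set us. ext_vars u)"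
proof -
  have "ext_vars (foldl (\<lambda>a b. cst CP \<cdot> a \<cdot> b) u us) = ext_vars u \<union> (\<Union>u\<in>set us. ext_vars u)" for u us
    by (induction us arbitrary: u) auto
  then show ?thesis by (cases us) auto
qed

lemma keq_app_tuple:
  assumes "finite \<Gamma>" "list_all2 (keq \<Gamma>) us vs"
  shows "keq \<Gamma> (app_tuple t us) (app_tuple t vs)"
proof -
  have "keq \<Gamma> (foldl (\<lambda>a b. cst CP \<cdot> a \<cdot> b) u us) (foldl (\<lambda>a b. cst CP \<cdot> a \<cdot> b) v vs)"
    if "list_all2 (keq \<Gamma>) us vs" "keq \<Gamma> u v" for u v us vs
    using that by (induction arbitrary: u v rule: list_all2_induct) (auto intro!: keq_App keq_refl assms(1))
  with assms show ?thesis by (cases us; cases vs) (auto intro: keq_App keq_refl)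
qed

abbreviation names :: "var list \<Rightarrow> ext list \<Rightarrow> form set" where
  "names Xs ts \<equiv> (\<lambda>(X, t). t \<^bold>\<simeq> vr X) ` set (zip Xs ts)"

text \<open>The terms are closed, so eliminating one name leaves the hypotheses on the others
  untouched.\<close>

lemma name_list:
  assumes "list_all2 (\<lambda>X t. denotes (vty X) t) Xs ts" "distinct Xs"
    and "\<And>\<gamma>. \<gamma> \<in> \<Gamma> \<Longrightarrow> set Xs \<inter> fv \<gamma> = {}" "set Xs \<inter> fv \<chi> = {}"
    and "names Xs ts \<union> \<Gamma> \<tturnstile> \<chi>"
  shows "\<Gamma> \<tturnstile> \<chi>"
  using assms
proof (induction arbitrary: \<Gamma> rule: list_all2_induct)
  case (Cons X Xs t ts)
  have "ext_vars t = {}" by (rule denotes_closed[OF Cons(1)])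
  have "insert (t \<^bold>\<simeq> vr X) \<Gamma> \<tturnstile> \<chi>"
    by (rule Cons.IH) (use Cons.prems \<open>ext_vars t = {}\<close> in \<open>auto simp: insert_commute\<close>)
  then show ?case
    by (rule name_closed[OF Cons(1)]) (use Cons.prems in auto)
qed auto

lemma keq_compr_term:
  assumes "list_all2 (\<lambda>X t. denotes (vty X) t) Xs ts" "names Xs ts \<subseteq> \<Gamma>" "finite \<Gamma>"
  shows "keq \<Gamma> (app_tuple c ts) (app_tuple c (map vr Xs))"
proof (rule keq_app_tuple[OF assms(3)])
  have "length Xs = length ts" using assms(1) by (rule list_all2_lengthD)
  then show "list_all2 (keq \<Gamma>) ts (map vr Xs)"
    using assms(2) by (auto simp: list_all2_conv_all_nth intro!: keq_name) (force simp: set_zip)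
qed

lemma compr_axiom:
  assumes "compr k Z Xs \<phi>" "vty U = Ty (Suc k)" "U \<notin> set Xs"
  shows "\<turnstile>\<^sub>B\<^sub>T Exists U (compr_term Z Xs \<phi> (map vr Xs) \<^bold>\<simeq> vr U \<^bold>\<and> Forall Z (Mem k (Var Z) (Var U) \<^bold>\<longleftrightarrow> \<phi>))"
proof -
  obtain i where "Z = V (Ty k) i" using assms by (cases Z) (auto simp: compr_def)
  moreover obtain j where "U = V (Ty (Suc k)) j" using assms by (cases U) auto
  ultimately show ?thesis using assms unfolding compr_def
    by (intro by_comprehension comprehension) auto
qed

text \<open>The axiom has variables as parameters. Naming each closed parameter by the very variable
  in \<open>Xs\<close> makes it applicable literally; \<open>Xs\<close> and U are eliminated at the
  end.\<close>

lemma compr_namedE: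
  assumes "compr k Z Xs \<phi>" "list_all2 (\<lambda>X t. denotes (vty X) t) Xs ts"
    and "vty U = Ty (Suc k)" "U \<notin> set Xs" "U \<notin> fv \<chi>" "set Xs \<inter> fv \<chi> = {}"
    and "\<And>\<gamma>. \<gamma> \<in> \<Gamma> \<Longrightarrow> insert U (set Xs) \<inter> fv \<gamma> = {}"
    and "insert (compr_term Z Xs \<phi> ts \<^bold>\<simeq> vr U) (insert (Forall Z (Mem k (Var Z) (Var U) \<^bold>\<longleftrightarrow> \<phi>))
          (names Xs ts \<union> \<Gamma>)) \<tturnstile> \<chi>"
  shows "\<Gamma> \<tturnstile> \<chi>"
proof (rule name_list[OF assms(2)])
  let ?H = "names Xs ts"
  let ?B = "compr_term Z Xs \<phi> (map vr Xs) \<^bold>\<simeq> vr U" and ?C = "Forall Z (Mem k (Var Z) (Var U) \<^bold>\<longleftrightarrow> \<phi>)"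
  let ?A = "compr_term Z Xs \<phi> ts \<^bold>\<simeq> vr U"
  let ?D = "insert (?B \<^bold>\<and> ?C) ?H"
  have E: "?H \<union> \<Gamma> \<tturnstile> Exists U (?B \<^bold>\<and> ?C)" by (intro theorem_ compr_axiom assms)
  then have w: "wff (?B \<^bold>\<and> ?C)" by (auto dest: derives_wff)
  then have "?D \<tturnstile> ?B \<^bold>\<and> ?C" by (auto intro: hyp)
  then have "?D \<tturnstile> ?B" and C: "?D \<tturnstile> ?C" by (blast intro: AndE1 AndE2)+
  have A: "?D \<tturnstile> ?A"
    by (rule simeq_keq[OF _ \<open>?D \<tturnstile> ?B\<close> keq_sym[OF keq_compr_term[OF assms(2)]] keq_refl]) auto
  have "(?D \<union> \<Gamma>) \<union> {?A, ?C} \<tturnstile> \<chi>" using assms(8) by (rule weaken) blast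
  moreover have "?D \<union> \<Gamma> \<tturnstile> ?A" using A by (rule weaken) blast
  moreover have "?D \<union> \<Gamma> \<tturnstile> ?C" using C by (rule weaken) blast
  ultimately have "?D \<union> \<Gamma> \<tturnstile> \<chi>" by (blast intro: cut_all)
  then have D: "insert (?B \<^bold>\<and> ?C) (?H \<union> \<Gamma>) \<tturnstile> \<chi>" by simp
  have "U \<notin> fv \<gamma>" if "\<gamma> \<in> ?H" for \<gamma>
  proof -
    obtain X t where "\<gamma> = t \<^bold>\<simeq> vr X" "(X, t) \<in> set (zip Xs ts)" using \<open>\<gamma> \<in> ?H\<close> by auto
    moreover from this have "ext_vars t = {}"
      using assms(2) by (metis (mono_tags, lifting) case_prodD denotes_closed list_all2_iff)
    ultimately show ?thesis using assms(4) by (auto dest: set_zip_leftD)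
  qed
  then show "?H \<union> \<Gamma> \<tturnstile> \<chi>"
    by (intro ExistsE[OF E D]) (use assms(5,7) in auto)
qed (use assms in \<open>auto simp: compr_def\<close>)

lemma denotes_compr:
  assumes "compr k Z Xs \<phi>" "list_all2 (\<lambda>X t. denotes (vty X) t) Xs ts"
  shows "denotes (Ty (Suc k)) (compr_term Z Xs \<phi> ts)"
proof (rule denotesI)
  let ?A = "compr_term Z Xs \<phi> ts"
  have "ext_vars t = {}" if "t \<in> set ts" for t
    using that assms(2) by (metis denotes_closed in_set_conv_nth list_all2_conv_all_nth)
  then show c: "ext_vars ?A = {}" by (auto simp: app_tuple_vars)
  fix v assume v: "vty v = Ty (Suc k)"
  have "finite (insert v (set Xs))" by simp
  \<comment> \<open>v may itself be a parameter, which the axiom does not allow for U; hence another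
    variable and \<open>denotesI\<close>.\<close>
  from ex_fresh[OF this] obtain j where j: "V (Ty (Suc k)) j \<notin> insert v (set Xs)" by blast
  let ?U = "V (Ty (Suc k)) j"
  have "{} \<tturnstile> Exists ?U (?A \<^bold>\<simeq> vr ?U)"
    by (rule compr_namedE[OF assms, of ?U]; (rule ExistsI)?) (use j c in \<open>auto intro: hyp\<close>)
  then show "\<exists>w. vty w = Ty (Suc k) \<and> w \<noteq> v \<and> {} \<tturnstile> Exists w (?A \<^bold>\<simeq> vr w)"
    using j by (intro exI[of _ ?U]) auto
qed

lemma dom_denotes: "dom s t \<Longrightarrow> denotes s t"
proof (induction rule: dom.induct)
  case dom_zero
  then show ?case using denotes_const[of Zero] by simp
next
  case (dom_const c)
  then show ?case using denotes_const[of c] by simp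
next
  case (dom_compr k Z Xs \<phi> ts)
  then show ?case by (intro denotes_compr) (auto elim: list_all2_mono)
next
  case (dom_s1 x)
  \<comment> \<open>The second argument is arbitrary: the partial application is defined as a part
    of a defined one. The cases of \<open>p\<close> and \<open>d\<close> below are alike.\<close>
  then show ?case using denotes_s[of x x] denotes_AppD(1) by blast
next
  case (dom_p1 x)
  then show ?case using denotes_p[of x x] denotes_AppD(1) by blast
next
  case (dom_d1 x)
  have "denotes Omega (cst Zero)" using denotes_const[of Zero] by simp
  with dom_d1 show ?case using denotes_d[of x x] denotes_AppD(1) by blast
next
  case (dom_d2 x y)
  have "denotes Omega (cst Zero)" using denotes_const[of Zero] by simp
  with dom_d2 show ?case using denotes_d[of x y] denotes_AppD(1) by blast
qed (auto intro: denotes_Suc denotes_pair_type denotes_Ty0 denotes_k denotes_s denotes_p denotes_p1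
    denotes_p2 denotes_d)

lemma dom_closed: "dom s t \<Longrightarrow> ext_vars t = {}"
  by (intro denotes_closed dom_denotes)

section \<open>Numerals and provability of computations\<close>

inductive_cases dom_OmegaE: "dom Omega t"

text \<open>A pair is never zero, and \<open>CP1\<close> strips a successor from both sides.\<close>

lemma numerals_distinct:
  "dom Omega n \<Longrightarrow> dom Omega m \<Longrightarrow> n \<noteq> m \<Longrightarrow> {n \<^bold>\<simeq> m} \<tturnstile> \<^bold>\<bottom>"
proof (induction Omega n arbitrary: m rule: dom.induct)
  case dom_zero
  then obtain m' where m: "dom Omega m'" "m = cst CP \<cdot> m' \<cdot> cst Zero" by (auto elim: dom_OmegaE)
  have "{cst CP \<cdot> m' \<cdot> cst Zero \<^bold>\<simeq> cst Zero} \<tturnstile> \<^bold>\<bottom>"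
    using m by (intro pair_not_zero dom_denotes) (auto intro: dom.intros)
  then have "insert (m \<^bold>\<simeq> cst Zero) {cst Zero \<^bold>\<simeq> m} \<tturnstile> \<^bold>\<bottom>" unfolding m by (rule weaken) blast
  then show ?case by (rule cut) (rule simeq_sym[OF hyp], auto)
next
  case (dom_Suc n)
  from dom_Suc.prems(1) consider "m = cst Zero" | m' where "dom Omega m'" "m = cst CP \<cdot> m' \<cdot> cst Zero"
    by (auto elim: dom_OmegaE)
  then show ?case
  proof cases
    case 1
    have "{cst CP \<cdot> n \<cdot> cst Zero \<^bold>\<simeq> cst Zero} \<tturnstile> \<^bold>\<bottom>"
      using dom_Suc by (intro pair_not_zero dom_denotes) (auto intro: dom.intros)
    with 1 show ?thesis by simp
  next
    case (2 m')
    let ?H = "{cst CP \<cdot> n \<cdot> cst Zero \<^bold>\<simeq> m}"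
    have d: "denotes (Ty 0) n" "denotes (Ty 0) m'" "denotes (Ty 0) (cst Zero)"
      using 2 dom_Suc by (auto intro!: dom_denotes intro: dom.intros)
    have "keq ?H (cst CP \<cdot> n \<cdot> cst Zero) (cst CP \<cdot> m' \<cdot> cst Zero)"
      using 2 by (auto intro!: keq_if_simeq hyp)
    then have "keq ?H (cst CP1 \<cdot> (cst CP \<cdot> n \<cdot> cst Zero)) (cst CP1 \<cdot> (cst CP \<cdot> m' \<cdot> cst Zero))"
      by (rule keq_App[OF _ keq_refl, rotated]) simp
    moreover have "keq ?H (cst CP1 \<cdot> (cst CP \<cdot> n \<cdot> cst Zero)) n"
      "keq ?H (cst CP1 \<cdot> (cst CP \<cdot> m' \<cdot> cst Zero)) m'"
      using keq_proj(1)[OF d(1,3)] keq_proj(1)[OF d(2,3)] by (auto intro: keq_weaken)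
    ultimately have "keq ?H n m'" by (meson keq_sym keq_trans)
    then have "?H \<tturnstile> n \<^bold>\<simeq> m'" by (intro simeq_of_keq[OF d(1)]) auto
    moreover have "{n \<^bold>\<simeq> m'} \<tturnstile> \<^bold>\<bottom>" using dom_Suc 2 by auto
    then have "insert (n \<^bold>\<simeq> m') ?H \<tturnstile> \<^bold>\<bottom>" by (rule weaken) blast
    ultimately show ?thesis by (blast intro: cut)
  qed
qed


text \<open>Makes true atoms \<open>Ap\<close> derivable. The distinctness of numerals enters at
  \<open>eval_d_neq\<close>; strict evaluation of the parts allows \<open>eval_s3\<close> to compose
  its three equations.\<close>

lemma eval_sound:
  "eval f x y \<Longrightarrow> dom (Ty 0) f \<Longrightarrow> dom (Ty 0) x \<Longrightarrow> dom (Ty 0) y \<and> keq {} (f \<cdot> x) y"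
proof (induction rule: eval.induct)
  case (eval_k2 x y)
  then have "dom (Ty 0) x" using dom_App by blast
  with eval_k2 show ?case by (auto intro: keq_k dom_denotes)
next
  case (eval_s3 x z a y b c)
  then have d: "dom (Ty 0) x" "dom (Ty 0) y" using dom_App by blast+
  with eval_s3 have IH: "keq {} (x \<cdot> z) a" "keq {} (y \<cdot> z) b" "keq {} (a \<cdot> b) c" "dom (Ty 0) c" by auto
  have "keq {} (cst CS \<cdot> x \<cdot> y \<cdot> z) (x \<cdot> z \<cdot> (y \<cdot> z))"
    using d eval_s3 by (intro keq_s dom_denotes) auto
  moreover have "keq {} (x \<cdot> z \<cdot> (y \<cdot> z)) (a \<cdot> b)" using IH by (intro keq_App) auto
  ultimately show ?case using IH by (blast intro: keq_trans)
next
  case (eval_proj1 x y)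
  then have "dom (Ty 0) x" "dom (Ty 0) y" using dom_App by blast+
  then show ?case by (auto intro: keq_proj dom_denotes)
next
  case (eval_proj2 x y)
  then have "dom (Ty 0) x" "dom (Ty 0) y" using dom_App by blast+
  then show ?case by (auto intro: keq_proj dom_denotes)
next
  case (eval_d_eq n x y)
  then have "dom (Ty 0) x" "dom (Ty 0) y" using dom_App by blast+
  with eval_d_eq show ?case by (auto intro: keq_d_eq dom_denotes)
next
  case (eval_d_neq n m x y)
  then have "dom (Ty 0) x" "dom (Ty 0) y" using dom_App by blast+
  with eval_d_neq show ?case by (auto intro: keq_d_neq dom_denotes numerals_distinct)
next
  case (eval_s2 x y)
  then have "dom (Ty 0) x" using dom_App by blast
  with eval_s2 show ?case by (auto intro: keq_refl dom.intros)
next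
  case (eval_p2 x y)
  then have "dom (Ty 0) x" using dom_App by blast
  with eval_p2 show ?case by (auto intro: keq_refl dom.intros)
next
  case (eval_d2 x y)
  then have "dom (Ty 0) x" using dom_App by blast
  with eval_d2 show ?case by (auto intro: keq_refl dom.intros)
next
  case (eval_d3 n x y)
  then have "dom (Ty 0) x" "dom (Ty 0) y" using dom_App by blast+
  with eval_d3 show ?case by (auto intro: keq_refl dom.intros)
qed (auto intro: keq_refl dom.intros)

section \<open>Derivability of instances\<close>

definition valid :: "(var \<Rightarrow> ext) \<Rightarrow> bool" where
  "valid \<sigma> \<longleftrightarrow> (\<forall>v. dom (vty v) (\<sigma> v))"

definition hyps :: "(var \<Rightarrow> ext) \<Rightarrow> var set \<Rightarrow> form set" where
  "hyps \<sigma> W = (\<lambda>v. \<sigma> v \<^bold>\<simeq> vr v) ` W"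

text \<open>Every variable carries a hypothesis, so that modus ponens needs no bookkeeping of free
  variables; \<open>prov_finite\<close> returns to those of \<phi>.\<close>

definition prov :: "(var \<Rightarrow> ext) \<Rightarrow> form \<Rightarrow> bool" where
  "prov \<sigma> \<phi> \<longleftrightarrow> hyps \<sigma> UNIV \<tturnstile> \<phi>"

primrec tval :: "(var \<Rightarrow> ext) \<Rightarrow> trm \<Rightarrow> ext" where
  "tval \<sigma> (Var v) = \<sigma> v"
| "tval \<sigma> (Con c) = cst c"

lemma valid_upd: "valid \<sigma> \<Longrightarrow> dom (vty v) d \<Longrightarrow> valid (\<sigma>(v := d))"
  by (simp add: valid_def)

lemma valid_closed: "valid \<sigma> \<Longrightarrow> ext_vars (\<sigma> v) = {}"
  using dom_closed[of "vty v" "\<sigma> v"] by (simp add: valid_def)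

lemma dom_tval: "valid \<sigma> \<Longrightarrow> dom (trm_ty a) (tval \<sigma> a)"
proof (cases a)
  case (Con c)
  then show ?thesis by (cases c) (auto intro: dom.intros)
qed (simp add: valid_def)

lemma hyps_remove:
  assumes "finite W" "valid \<sigma>" "hyps \<sigma> (W \<union> F) \<tturnstile> \<phi>" "W \<inter> fv \<phi> = {}"
  shows "hyps \<sigma> F \<tturnstile> \<phi>"
  using assms(1,3,4)
proof (induction W)
  case (insert w W)
  have "hyps \<sigma> (W \<union> F) \<tturnstile> \<phi>"
  proof (cases "w \<in> W \<union> F")
    case True
    then have "insert w W \<union> F = W \<union> F" by auto
    with insert.prems show ?thesis by simp
  next
    case False
    have "denotes (vty w) (\<sigma> w)" using assms(2) by (simp add: valid_def dom_denotes)
    then show ?thesis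
    proof (rule name_closed)
      show "insert (\<sigma> w \<^bold>\<simeq> vr w) (hyps \<sigma> (W \<union> F)) \<tturnstile> \<phi>"
        using insert.prems by (simp add: hyps_def)
    qed (use False insert.prems valid_closed[OF assms(2)] in \<open>auto simp: hyps_def\<close>)
  qed
  then show ?case using insert by auto
qed simp

lemma prov_finite:
  assumes "valid \<sigma>" "prov \<sigma> \<phi>"
  shows "hyps \<sigma> (fv \<phi>) \<tturnstile> \<phi>"
proof -
  obtain \<Delta> where "\<Delta> \<subseteq> hyps \<sigma> UNIV" "finite \<Delta>" "\<Delta> \<tturnstile> \<phi>"
    using derives_finite assms(2) unfolding prov_def by blast
  then obtain W where W: "finite W" "hyps \<sigma> W \<tturnstile> \<phi>"
    using finite_subset_image[of \<Delta> "\<lambda>v. \<sigma> v \<^bold>\<simeq> vr v" UNIV] unfolding hyps_def by blast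
  have "W = (W - fv \<phi>) \<union> (W \<inter> fv \<phi>)" by auto
  then have "hyps \<sigma> (W \<inter> fv \<phi>) \<tturnstile> \<phi>"
    using W assms(1) hyps_remove[of "W - fv \<phi>" \<sigma> "W \<inter> fv \<phi>" \<phi>] by auto
  then show ?thesis by (rule weaken) (auto simp: hyps_def)
qed

lemma prov_if_hyps: "hyps \<sigma> W \<tturnstile> \<phi> \<Longrightarrow> prov \<sigma> \<phi>"
  unfolding prov_def by (erule weaken) (auto simp: hyps_def)

lemma prov_coincidence:
  assumes "valid \<sigma>" "\<And>v. v \<in> fv \<phi> \<Longrightarrow> \<sigma> v = \<tau> v" "prov \<sigma> \<phi>"
  shows "prov \<tau> \<phi>"
proof (rule prov_if_hyps)
  have "hyps \<sigma> (fv \<phi>) = hyps \<tau> (fv \<phi>)" using assms(2) by (auto simp: hyps_def)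
  with prov_finite[OF assms(1,3)] show "hyps \<tau> (fv \<phi>) \<tturnstile> \<phi>" by simp
qed

lemma prov_closed: "valid \<sigma> \<Longrightarrow> prov \<sigma> \<phi> \<Longrightarrow> fv \<phi> = {} \<Longrightarrow> \<turnstile>\<^sub>B\<^sub>T \<phi>"
  using prov_finite[of \<sigma> \<phi>] by (simp add: hyps_def derives_empty)

lemma prov_theorem: "\<turnstile>\<^sub>B\<^sub>T \<phi> \<Longrightarrow> prov \<sigma> \<phi>"
  unfolding prov_def by (rule theorem_)

lemma prov_mp: "prov \<sigma> (\<phi> \<^bold>\<longrightarrow> \<psi>) \<Longrightarrow> prov \<sigma> \<phi> \<Longrightarrow> prov \<sigma> \<psi>"
  unfolding prov_def by (rule mp)

text \<open>v is bound in the premise, so its value may be changed before the quantifier is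
  stripped.\<close>

lemma prov_Forall:
  assumes "valid \<sigma>" "prov \<sigma> (Forall v \<phi>)"
  shows "prov (\<sigma>(v := d)) \<phi>"
  using prov_coincidence[OF assms(1) _ assms(2), of "\<sigma>(v := d)"] ForallE unfolding prov_def by auto

lemma prov_Exists:
  assumes "valid \<sigma>" "dom (vty v) d" "prov (\<sigma>(v := d)) \<phi>"
  shows "prov \<sigma> (Exists v \<phi>)"
proof (rule prov_coincidence[OF valid_upd[OF assms(1,2)]])
  show "prov (\<sigma>(v := d)) (Exists v \<phi>)" using assms(3) unfolding prov_def by (rule ExistsI)
qed auto

lemma hyps_tval: "trm_vars a \<subseteq> W \<Longrightarrow> hyps \<sigma> W \<tturnstile> tval \<sigma> a \<^bold>\<simeq> At a"
  by (cases a) (auto intro: simeq_At_refl hyp simp: hyps_def)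

lemma fv_subst_fresh: "v \<notin> trm_vars t \<Longrightarrow> v \<notin> fv (subst v t \<phi>)"
proof -
  assume "v \<notin> trm_vars t"
  moreover from this have "v \<notin> trm_vars (trm_subst v t a)" for a by (cases a) auto
  ultimately show ?thesis by (induction \<phi>) auto
qed

lemma prov_subst:
  assumes "valid \<sigma>" "trm_ty t = vty v" "free_for t v \<phi>" "wff \<phi>"
  shows "prov \<sigma> (subst v t \<phi>) \<longleftrightarrow> prov (\<sigma>(v := tval \<sigma> t)) \<phi>"
proof (cases "t = Var v")
  case False
  \<comment> \<open>Terms of the language are atomic, so v does not occur in any other t, and the
    update leaves the value of t unchanged.\<close>
  then have v: "v \<notin> trm_vars t" using assms(2) by (cases t) auto
  let ?\<tau> = "\<sigma>(v := tval \<sigma> t)" and ?H = "hyps (\<sigma>(v := tval \<sigma> t)) (insert v (trm_vars t))"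
  have \<tau>: "valid ?\<tau>" using assms(1,2) dom_tval[of \<sigma> t] by (auto intro: valid_upd)
  have "tval ?\<tau> t = tval \<sigma> t" using v by (cases t) auto
  then have "?H \<tturnstile> tval \<sigma> t \<^bold>\<simeq> At t" using hyps_tval[of t "insert v (trm_vars t)" ?\<tau>] by auto
  moreover have "?H \<tturnstile> tval \<sigma> t \<^bold>\<simeq> vr v" by (rule hyp) (auto simp: hyps_def)
  ultimately have "?H \<tturnstile> At t \<^bold>\<simeq> vr v"
    by (intro simeq_keq[of ?H "tval \<sigma> t" "vr v" "At t" "vr v"] keq_if_simeq[of ?H "tval \<sigma> t"] keq_refl)
      (auto simp: hyps_def)
  then have "prov ?\<tau> (At t \<^bold>\<simeq> vr v)" by (rule prov_if_hyps)
  moreover have "prov ?\<tau> (At t \<^bold>\<simeq> vr v \<^bold>\<longrightarrow> \<phi> \<^bold>\<longrightarrow> subst v t \<phi>)"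
    "prov ?\<tau> (At t \<^bold>\<simeq> vr v \<^bold>\<longrightarrow> subst v t \<phi> \<^bold>\<longrightarrow> \<phi>)"
    using simeq_subst_iff[OF assms(2-4)]
    by (auto intro!: prov_theorem ImpI simp flip: derives_empty)
  ultimately have "prov ?\<tau> (subst v t \<phi>) \<longleftrightarrow> prov ?\<tau> \<phi>" by (blast intro: prov_mp)
  moreover have "prov ?\<tau> (subst v t \<phi>) \<longleftrightarrow> prov \<sigma> (subst v t \<phi>)"
    by (rule iffI; erule prov_coincidence[rotated 2])
      (use fv_subst_fresh[OF v, of \<phi>] assms(1) \<tau> in auto)
  ultimately show ?thesis by simp
qed simp

lemma keq_tval: "keq (hyps \<sigma> (trm_vars a \<union> W)) (tval \<sigma> a) (At a)"
  by (rule keq_if_simeq, rule hyps_tval) auto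

lemma prov_Eq:
  assumes "valid \<sigma>" "trm_ty x = Ty 0" "trm_ty a = s" "tval \<sigma> x = tval \<sigma> a"
  shows "prov \<sigma> (Eq s x a)"
proof (rule prov_if_hyps)
  let ?W = "trm_vars x \<union> trm_vars a"
  obtain i where i: "ovar i \<notin> ?W" using ex_fresh[of ?W "Ty 0"] by auto
  let ?y = "ovar i" and ?H = "hyps \<sigma> ?W"
  have "keq ?H (tval \<sigma> x) (At x)" "keq ?H (tval \<sigma> a) (At a)"
    using keq_tval[of \<sigma> x "trm_vars a"] keq_tval[of \<sigma> a "trm_vars x"] by (auto simp: Un_commute)
  then have k: "keq ?H (At x) (At a)" using assms by (auto intro: keq_trans keq_sym)
  let ?D = "insert (Eq (trm_ty x) (Var ?y) x) ?H"
  have e: "?D \<tturnstile> evalto (At x) ?y" using assms by (auto intro: hyp)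
  then have "?D \<tturnstile> evalto (At a) ?y" by (rule keqD[OF k, rotated]) blast
  then have "?D \<tturnstile> Eq s x a" using e assms eq_transport[of "Var ?y" x a s ?D] by simp
  then show "?H \<tturnstile> Eq s x a"
    by (rule name_trm) (use i assms valid_closed[OF assms(1)] in \<open>auto simp: hyps_def\<close>)
qed

lemma prov_Ap:
  assumes "valid \<sigma>" "trm_ty a = Ty 0" "trm_ty b = Ty 0" "trm_ty c = Ty 0"
    and "eval (tval \<sigma> a) (tval \<sigma> b) (tval \<sigma> c)"
  shows "prov \<sigma> (Ap a b c)"
proof (rule prov_if_hyps)
  let ?W = "trm_vars a \<union> trm_vars b \<union> trm_vars c"
  let ?i = "fresh_idx ?W"
  define x y z where "x = ovar ?i" and "y = ovar (Suc ?i)" and "z = ovar (Suc (Suc ?i))"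
  have n: "x \<notin> ?W" "y \<notin> ?W" "z \<notin> ?W" "distinct [x, y, z]" "vty x = Ty 0" "vty y = Ty 0" "vty z = Ty 0"
    unfolding x_def y_def z_def by (intro fresh_idx_notin; simp)+ simp_all
  let ?H = "hyps \<sigma> ?W"
  have "keq ?H (tval \<sigma> a) (At a)" "keq ?H (tval \<sigma> b) (At b)" "keq ?H (tval \<sigma> c) (At c)"
    by (rule keq_if_simeq, rule hyps_tval, blast)+
  moreover have "keq ?H (tval \<sigma> a \<cdot> tval \<sigma> b) (tval \<sigma> c)"
    using eval_sound[OF assms(5)] dom_tval[OF assms(1), of a] dom_tval[OF assms(1), of b] assms
    by (auto intro: keq_weaken)
  moreover have "finite ?H" by (simp add: hyps_def)
  \<comment> \<open>The computation between values becomes one between the terms that name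
    them.\<close>
  ultimately have k: "keq ?H (At c) (At a \<cdot> At b)"
    by (meson keq_App keq_sym keq_trans)
  let ?D = "insert (Eq (trm_ty c) (Var x) c) ?H"
  let ?E = "insert (evalto (At a) y) (insert (evalto (At b) z) (insert (Ap (Var y) (Var z) (Var x)) ?D))"
  have "?D \<tturnstile> evalto (At c) x" using assms n by (auto intro: hyp)
  then have AB: "?D \<tturnstile> evalto (At a \<cdot> At b) x" by (rule keqD[OF k, rotated]) blast
  have f: "fv \<gamma> \<subseteq> ?W" if "\<gamma> \<in> ?H" for \<gamma>
    using that valid_closed[OF assms(1)] by (auto simp: hyps_def)
  have "?E \<tturnstile> Ap (Var y) (Var z) (Var x)" "?E \<tturnstile> Eq (Ty 0) (Var y) a" "?E \<tturnstile> Eq (Ty 0) (Var z) b"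
    "?E \<tturnstile> Eq (Ty 0) (Var x) c" using assms n by (auto intro: hyp)
  then have E: "?E \<tturnstile> Ap a b c"
    using Ap_cong[of "Var y" "Var z" "Var x" a b c ?E] assms n by simp
  have "?D \<tturnstile> Ap a b c"
    by (rule evalto_AppE[OF AB E]) (use n f in auto)
  then show "?H \<tturnstile> Ap a b c"
    by (rule name_trm) (use n f in auto)
qed

section \<open>The slash\<close>

text \<open>Membership is a parameter \<open>M\<close>, so that the recursion is on formulas only
  and \<open>mem\<close> can be defined from it. For arbitrary \<open>M\<close> nothing else ensures
  that a membership formula is derivable, so its clause demands it; \<open>slash_compr_ax\<close>
  shows that comprehension meets the demand.\<close>

primrec slash :: "(nat \<Rightarrow> ext \<Rightarrow> ext \<Rightarrow> bool) \<Rightarrow> form \<Rightarrow> (var \<Rightarrow> ext) \<Rightarrow> bool" where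
  "slash M (Ap a b c) \<sigma> \<longleftrightarrow> eval (tval \<sigma> a) (tval \<sigma> b) (tval \<sigma> c)"
| "slash M (Eq s a b) \<sigma> \<longleftrightarrow> tval \<sigma> a = tval \<sigma> b"
| "slash M (Mem k a b) \<sigma> \<longleftrightarrow> M k (tval \<sigma> a) (tval \<sigma> b) \<and> prov \<sigma> (Mem k a b)"
| "slash M \<^bold>\<bottom> \<sigma> \<longleftrightarrow> False"
| "slash M (\<phi> \<^bold>\<and> \<psi>) \<sigma> \<longleftrightarrow> slash M \<phi> \<sigma> \<and> slash M \<psi> \<sigma>"
| "slash M (\<phi> \<^bold>\<or> \<psi>) \<sigma> \<longleftrightarrow> slash M \<phi> \<sigma> \<or> slash M \<psi> \<sigma>"
| "slash M (\<phi> \<^bold>\<longrightarrow> \<psi>) \<sigma> \<longleftrightarrow> prov \<sigma> (\<phi> \<^bold>\<longrightarrow> \<psi>) \<and> (slash M \<phi> \<sigma> \<longrightarrow> slash M \<psi> \<sigma>)"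
| "slash M (Forall v \<phi>) \<sigma> \<longleftrightarrow>
     prov \<sigma> (Forall v \<phi>) \<and> (\<forall>d. dom (vty v) d \<longrightarrow> slash M \<phi> (\<sigma>(v := d)))"
| "slash M (Exists v \<phi>) \<sigma> \<longleftrightarrow> (\<exists>d. dom (vty v) d \<and> slash M \<phi> (\<sigma>(v := d)))"

text \<open>
  The guard \<open>if\<close> only serves termination: by \<open>slash_mem_cong\<close> it can be dropped again.
\<close>

function mem :: "nat \<Rightarrow> ext \<Rightarrow> ext \<Rightarrow> bool" where
  "mem k z u \<longleftrightarrow> (\<exists>Z Xs \<phi> \<tau>. compr k Z Xs \<phi> \<and> valid \<tau> \<and> \<tau> Z = z \<and>
     u = compr_term Z Xs \<phi> (map \<tau> Xs) \<and>
     slash (\<lambda>j z' u'. if j < k \<or> j = k \<and> size u' < size u then mem j z' u' else False) \<phi> \<tau>)"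
  by pat_completeness auto
termination
  \<comment> \<open>Level comes before size, since a set quantified in \<phi> has lower level but
    may be of any size; size takes care of the parameters of the same level.\<close>
  by (relation "inv_image (less_than <*lex*> less_than) (\<lambda>(k, z, u). (k, size u))") auto

declare mem.simps [simp del]

section \<open>Coincidence, derivability and substitution\<close>

lemma tval_coincidence: "(\<And>v. v \<in> trm_vars a \<Longrightarrow> \<sigma> v = \<tau> v) \<Longrightarrow> tval \<sigma> a = tval \<tau> a"
  by (cases a) auto

lemma slash_coincidence:
  assumes "valid \<sigma>" "valid \<tau>" "\<And>v. v \<in> fv \<phi> \<Longrightarrow> \<sigma> v = \<tau> v"
  shows "slash M \<phi> \<sigma> \<longleftrightarrow> slash M \<phi> \<tau>"
proof -
  have pr: "prov \<sigma> \<chi> \<longleftrightarrow> prov \<tau> \<chi>" if "valid \<sigma>" "valid \<tau>" "\<And>v. v \<in> fv \<chi> \<Longrightarrow> \<sigma> v = \<tau> v" for \<sigma> \<tau> \<chi>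
    using prov_coincidence[of \<sigma> \<chi> \<tau>] prov_coincidence[of \<tau> \<chi> \<sigma>] that by auto
  show ?thesis using assms
  proof (induction \<phi> arbitrary: \<sigma> \<tau>)
    case (Ap a b c)
    then have "tval \<sigma> a = tval \<tau> a" "tval \<sigma> b = tval \<tau> b" "tval \<sigma> c = tval \<tau> c"
      by (auto intro!: tval_coincidence)
    then show ?case by simp
  next
    case (Eq s a b)
    then have "tval \<sigma> a = tval \<tau> a" "tval \<sigma> b = tval \<tau> b" by (auto intro!: tval_coincidence)
    then show ?case by simp
  next
    case (Mem k a b)
    then have "tval \<sigma> a = tval \<tau> a" "tval \<sigma> b = tval \<tau> b" by (auto intro!: tval_coincidence)
    moreover have "prov \<sigma> (Mem k a b) \<longleftrightarrow> prov \<tau> (Mem k a b)" using Mem by (intro pr) auto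
    ultimately show ?case by simp
  next
    case (And \<phi> \<psi>)
    have "slash M \<phi> \<sigma> \<longleftrightarrow> slash M \<phi> \<tau>" "slash M \<psi> \<sigma> \<longleftrightarrow> slash M \<psi> \<tau>"
      using And.prems by (intro And.IH; simp)+
    then show ?case by simp
  next
    case (Or \<phi> \<psi>)
    have "slash M \<phi> \<sigma> \<longleftrightarrow> slash M \<phi> \<tau>" "slash M \<psi> \<sigma> \<longleftrightarrow> slash M \<psi> \<tau>"
      using Or.prems by (intro Or.IH; simp)+
    then show ?case by simp
  next
    case (Imp \<phi> \<psi>)
    have "slash M \<phi> \<sigma> \<longleftrightarrow> slash M \<phi> \<tau>" "slash M \<psi> \<sigma> \<longleftrightarrow> slash M \<psi> \<tau>"
      using Imp.prems by (intro Imp.IH; simp)+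
    moreover have "prov \<sigma> (\<phi> \<^bold>\<longrightarrow> \<psi>) \<longleftrightarrow> prov \<tau> (\<phi> \<^bold>\<longrightarrow> \<psi>)" using Imp.prems by (intro pr) auto
    ultimately show ?case by simp
  next
    case (Forall v \<phi>)
    have "slash M \<phi> (\<sigma>(v := d)) \<longleftrightarrow> slash M \<phi> (\<tau>(v := d))" if "dom (vty v) d" for d
      by (rule Forall.IH; (rule valid_upd)?) (use Forall.prems that in auto)
    moreover have "prov \<sigma> (Forall v \<phi>) \<longleftrightarrow> prov \<tau> (Forall v \<phi>)" using Forall.prems by (intro pr) auto
    ultimately show ?case by simp
  next
    case (Exists v \<phi>)
    have "slash M \<phi> (\<sigma>(v := d)) \<longleftrightarrow> slash M \<phi> (\<tau>(v := d))" if "dom (vty v) d" for d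
      by (rule Exists.IH; (rule valid_upd)?) (use Exists.prems that in auto)
    then show ?case by auto
  qed simp
qed

text \<open>Only the clauses without a built-in \<open>prov\<close> need an argument:
  \<open>Ap\<close> and \<open>Eq\<close> are derivable because computation is provable, the others
  follow by introduction rules.\<close>

lemma slash_prov: "valid \<sigma> \<Longrightarrow> wff \<phi> \<Longrightarrow> slash M \<phi> \<sigma> \<Longrightarrow> prov \<sigma> \<phi>"
proof (induction \<phi> arbitrary: \<sigma>)
  case (And \<phi> \<psi>)
  then show ?case by (auto simp: prov_def intro: AndI)
next
  case (Or \<phi> \<psi>)
  then show ?case by (auto simp: prov_def intro: OrI1 OrI2)
next
  case (Exists v \<phi>)
  then obtain d where "dom (vty v) d" "slash M \<phi> (\<sigma>(v := d))" by auto
  with Exists show ?case by (intro prov_Exists[of \<sigma> v d]) (auto intro: valid_upd)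
qed (auto intro: prov_Ap prov_Eq)

lemma tval_subst: "tval \<sigma> (trm_subst v t a) = tval (\<sigma>(v := tval \<sigma> t)) a"
  by (cases a) auto

lemma slash_subst:
  assumes "trm_ty t = vty v" "valid \<sigma>" "free_for t v \<phi>" "wff \<phi>"
  shows "slash M (subst v t \<phi>) \<sigma> \<longleftrightarrow> slash M \<phi> (\<sigma>(v := tval \<sigma> t))"
  using assms(2-4)
  supply fun_upd_apply [simp del] \<comment> \<open>the induction rule presents the updated \<open>\<sigma>\<close> eta-expanded\<close>
proof (induction \<phi> arbitrary: \<sigma>)
  case (Mem k a b)
  then show ?case using prov_subst[OF Mem.prems(1) assms(1) Mem.prems(2,3)]
    by (simp add: tval_subst)
next
  case (Imp \<phi> \<psi>)
  then show ?case using prov_subst[OF Imp.prems(1) assms(1) Imp.prems(2,3)] by simp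
next
  case (Forall w \<phi>)
  have val: "valid (\<sigma>(v := tval \<sigma> t))"
    using assms(1) dom_tval[of \<sigma> t] Forall.prems by (auto intro: valid_upd)
  show ?case
  proof (cases "v \<in> fv (Forall w \<phi>)")
    case False
    then have "subst v t (Forall w \<phi>) = Forall w \<phi>" by (rule subst_fresh)
    moreover have "slash M (Forall w \<phi>) \<sigma> \<longleftrightarrow> slash M (Forall w \<phi>) (\<sigma>(v := tval \<sigma> t))"
      using False val Forall.prems by (intro slash_coincidence) (auto simp: fun_upd_apply)
    ultimately show ?thesis by simp
  next
    case True
    then have w: "w \<noteq> v" "w \<notin> trm_vars t" "free_for t v \<phi>" using Forall.prems by auto
    then have t: "tval (\<sigma>(w := d)) t = tval \<sigma> t" for d
      by (intro tval_coincidence) (auto simp: fun_upd_apply)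
    have "slash M (subst v t \<phi>) (\<sigma>(w := d)) \<longleftrightarrow> slash M \<phi> (\<sigma>(v := tval \<sigma> t, w := d))"
      if "dom (vty w) d" for d
      using Forall.IH[of "\<sigma>(w := d)"] Forall.prems w that t by (simp add: valid_upd fun_upd_twist)
    then show ?thesis using w prov_subst[OF Forall.prems(1) assms(1) Forall.prems(2,3)] by auto
  qed
next
  case (Exists w \<phi>)
  have val: "valid (\<sigma>(v := tval \<sigma> t))"
    using assms(1) dom_tval[of \<sigma> t] Exists.prems by (auto intro: valid_upd)
  show ?case
  proof (cases "v \<in> fv (Exists w \<phi>)")
    case False
    then have "subst v t (Exists w \<phi>) = Exists w \<phi>" by (rule subst_fresh)
    moreover have "slash M (Exists w \<phi>) \<sigma> \<longleftrightarrow> slash M (Exists w \<phi>) (\<sigma>(v := tval \<sigma> t))"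
      using False val Exists.prems by (intro slash_coincidence) (auto simp: fun_upd_apply)
    ultimately show ?thesis by simp
  next
    case True
    then have w: "w \<noteq> v" "w \<notin> trm_vars t" "free_for t v \<phi>" using Exists.prems by auto
    then have t: "tval (\<sigma>(w := d)) t = tval \<sigma> t" for d
      by (intro tval_coincidence) (auto simp: fun_upd_apply)
    have "slash M (subst v t \<phi>) (\<sigma>(w := d)) \<longleftrightarrow> slash M \<phi> (\<sigma>(v := tval \<sigma> t, w := d))"
      if "dom (vty w) d" for d
      using Exists.IH[of "\<sigma>(w := d)"] Exists.prems w that t by (simp add: valid_upd fun_upd_twist)
    then show ?thesis using w by auto
  qed
qed (simp_all add: tval_subst)

text \<open>An elementary formula of level \<open>k + 1\<close> does not quantify over type
  \<open>k + 1\<close>. Its objects of that type are therefore values of free variables and stay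
  below the size bound under every quantifier; its membership atoms have level at most
  \<open>k\<close>.\<close>

lemma slash_mem_cong:
  assumes "\<And>j z u. j < k \<or> j = k \<and> size u < n \<Longrightarrow> M j z u = M' j z u"
    and "elementary (Suc k) \<phi>" "wff \<phi>" "\<And>v. v \<in> fv \<phi> \<Longrightarrow> vty v = Ty (Suc k) \<Longrightarrow> size (\<tau> v) < n"
  shows "slash M \<phi> \<tau> \<longleftrightarrow> slash M' \<phi> \<tau>"
  using assms(2-4)
proof (induction \<phi> arbitrary: \<tau>)
  case (Mem j a b)
  show ?case
  proof (cases "j = k")
    case True
    then obtain B where "b = Var B" "vty B = Ty (Suc k)" using Mem.prems trm_ty_Suc[of b k] by auto
    then show ?thesis using assms(1)[of j "tval \<tau> b" "tval \<tau> a"] True Mem.prems by auto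
  next
    case False
    then show ?thesis using assms(1)[of j "tval \<tau> b" "tval \<tau> a"] Mem.prems by auto
  qed
next
  case (Forall v \<phi>)
  have "slash M \<phi> (\<tau>(v := d)) \<longleftrightarrow> slash M' \<phi> (\<tau>(v := d))" for d
    using Forall.prems by (intro Forall.IH) auto
  then show ?case by simp
next
  case (Exists v \<phi>)
  have "slash M \<phi> (\<tau>(v := d)) \<longleftrightarrow> slash M' \<phi> (\<tau>(v := d))" for d
    using Exists.prems by (intro Exists.IH) auto
  then show ?case by simp
next
  case (And \<phi> \<psi>)
  have "slash M \<phi> \<tau> \<longleftrightarrow> slash M' \<phi> \<tau>" "slash M \<psi> \<tau> \<longleftrightarrow> slash M' \<psi> \<tau>"
    using And.prems by (intro And.IH; simp)+
  then show ?case by simp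
next
  case (Or \<phi> \<psi>)
  have "slash M \<phi> \<tau> \<longleftrightarrow> slash M' \<phi> \<tau>" "slash M \<psi> \<tau> \<longleftrightarrow> slash M' \<psi> \<tau>"
    using Or.prems by (intro Or.IH; simp)+
  then show ?case by simp
next
  case (Imp \<phi> \<psi>)
  have "slash M \<phi> \<tau> \<longleftrightarrow> slash M' \<phi> \<tau>" "slash M \<psi> \<tau> \<longleftrightarrow> slash M' \<psi> \<tau>"
    using Imp.prems by (intro Imp.IH; simp)+
  then show ?case by simp
qed simp_all

lemma size_app_tuple: "t \<in> set ts \<Longrightarrow> size t < size (app_tuple c ts)"
proof -
  have "size t \<le> size (foldl (\<lambda>a b. cst CP \<cdot> a \<cdot> b) u us)" if "t \<in> set (u # us)" for u us
    using that
  proof (induction us arbitrary: u)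
    case (Cons a us)
    show ?case
    proof (cases "t \<in> set us")
      case True
      then show ?thesis using Cons.IH[of "cst CP \<cdot> u \<cdot> a"] by simp
    next
      case False
      then have "size t \<le> size (cst CP \<cdot> u \<cdot> a)" using Cons.prems by auto
      also have "\<dots> \<le> size (foldl (\<lambda>a b. cst CP \<cdot> a \<cdot> b) (cst CP \<cdot> u \<cdot> a) us)"
        by (induction us rule: rev_induct) auto
      finally show ?thesis by simp
    qed
  qed simp
  moreover assume "t \<in> set ts"
  ultimately show ?thesis by (cases ts) (auto simp: less_Suc_eq_le trans_le_add2)
qed

lemma app_tuple_const_inject: "app_tuple (cst c) us = app_tuple (cst d) vs \<Longrightarrow> c = d"
  by (cases us; cases vs) auto

text \<open>The lengths must agree, because a pair is at once a tuple with two entries and a single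
  entry.\<close>

lemma app_tuple_args_inject:
  assumes "length us = length vs" "app_tuple c us = app_tuple c vs"
  shows "us = vs"
proof -
  have inj: "u = v \<and> us = vs" if "length us = length vs"
    "foldl (\<lambda>a b. cst CP \<cdot> a \<cdot> b) u us = foldl (\<lambda>a b. cst CP \<cdot> a \<cdot> b) v vs" for u v us vs
    using that
  proof (induction us arbitrary: vs rule: rev_induct)
    case (snoc a us)
    then show ?case by (cases vs rule: rev_cases) auto
  qed simp
  show ?thesis
  proof (cases us)
    case (Cons u us')
    then obtain v vs' where "vs = v # vs'" using assms(1) by (cases vs) auto
    with Cons assms show ?thesis using inj[of us' vs' u v] by simp
  qed (use assms in simp)
qed

text \<open>The Goedel number in the head constant determines Z, \<open>Xs\<close> and \<phi>, and
  the length of \<open>Xs\<close> then determines the arguments. So any assignment that presents the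
  same term and element agrees with \<tau> on the free variables of \<phi>.\<close>

lemma mem_compr_term:
  assumes "compr k Z Xs \<phi>" "valid \<tau>"
  shows "mem k (\<tau> Z) (compr_term Z Xs \<phi> (map \<tau> Xs)) \<longleftrightarrow> slash mem \<phi> \<tau>"
proof -
  let ?u = "compr_term Z Xs \<phi> (map \<tau> Xs)"
  let ?M = "\<lambda>j z' u'. if j < k \<or> j = k \<and> size u' < size ?u then mem j z' u' else False"
  have eq: "slash ?M \<phi> \<tau> \<longleftrightarrow> slash mem \<phi> \<tau>"
  proof (rule slash_mem_cong[of k "size ?u"])
    fix v assume "v \<in> fv \<phi>" "vty v = Ty (Suc k)"
    then have "v \<in> set Xs" using assms(1) by (auto simp: compr_def)
    then show "size (\<tau> v) < size ?u" by (intro size_app_tuple) simp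
  qed (use assms in \<open>auto simp: compr_def\<close>)
  have "mem k (\<tau> Z) ?u \<longleftrightarrow> slash ?M \<phi> \<tau>"
  proof
    show "mem k (\<tau> Z) ?u" if "slash ?M \<phi> \<tau>"
      using that assms by (subst mem.simps) blast
    assume "mem k (\<tau> Z) ?u"
    then obtain Z' Xs' \<phi>' \<tau>' where m: "compr k Z' Xs' \<phi>'" "valid \<tau>'" "\<tau>' Z' = \<tau> Z"
      "?u = compr_term Z' Xs' \<phi>' (map \<tau>' Xs')" "slash ?M \<phi>' \<tau>'"
      by (subst (asm) mem.simps) blast
    from m(4) have "goedel Z Xs \<phi> = goedel Z' Xs' \<phi>'" using app_tuple_const_inject by blast
    then have g: "Z' = Z" "Xs' = Xs" "\<phi>' = \<phi>" by (auto simp: goedel_inject)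
    with m(4) have "map \<tau>' Xs = map \<tau> Xs"
      by (intro app_tuple_args_inject[of _ _ "cst (CC (goedel Z Xs \<phi>))"]) simp_all
    then have "\<tau>' v = \<tau> v" if "v \<in> fv \<phi>" for v using that assms(1) m(3) g by (auto simp: compr_def)
    then show "slash ?M \<phi> \<tau>" using slash_coincidence[OF m(2) assms(2), of \<phi> ?M] m(5) g by simp
  qed
  with eq show ?thesis by simp
qed

section \<open>Soundness of the slash\<close>

text \<open>What the slash makes of \<open>evalto\<close>, by \<open>slash_evalto\<close>, freed of
  bound variables. It is a relation because application is partial.\<close>

primrec ev :: "(var \<Rightarrow> ext) \<Rightarrow> ext \<Rightarrow> ext \<Rightarrow> bool" where
  "ev \<sigma> (At a) d \<longleftrightarrow> d = tval \<sigma> a"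
| "ev \<sigma> (t \<cdot> u) d \<longleftrightarrow> (\<exists>y z. ev \<sigma> t y \<and> ev \<sigma> u z \<and> eval y z d)"

lemma evI: "ev \<sigma> t y \<Longrightarrow> ev \<sigma> u z \<Longrightarrow> eval y z d \<Longrightarrow> ev \<sigma> (t \<cdot> u) d"
  by auto

lemma ev_vr: "ev \<sigma> (vr v) (\<sigma> v)"
  by simp

lemma ev_cst: "ev \<sigma> (cst c) (cst c)"
  by simp

lemma ev_dom: "valid \<sigma> \<Longrightarrow> ev \<sigma> t d \<Longrightarrow> dom (Ty 0) d"
proof (induction t arbitrary: d)
  case (At a)
  then show ?case using dom_tval dom_type by auto
next
  case (App t u)
  then show ?case using eval_sound by fastforce
qed

lemma ev_coincidence: "(\<And>v. v \<in> ext_vars t \<Longrightarrow> \<sigma> v = \<tau> v) \<Longrightarrow> ev \<sigma> t = ev \<tau> t"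
proof (induction t)
  case (At a)
  then show ?case using tval_coincidence[of a \<sigma> \<tau>] by (auto simp: fun_eq_iff)
next
  case (App t u)
  then have "ev \<sigma> t = ev \<tau> t" "ev \<sigma> u = ev \<tau> u" by auto
  then show ?case by (simp add: fun_eq_iff)
qed

lemma slash_evalto:
  "valid \<sigma> \<Longrightarrow> vty x = Ty 0 \<Longrightarrow> slash M (evalto t x) \<sigma> \<longleftrightarrow> ev \<sigma> t (\<sigma> x)"
proof (induction t arbitrary: \<sigma> x)
  case (App t u)
  let ?S = "insert x (ext_vars t \<union> ext_vars u)"
  define y z where "y = ovar (fresh_idx ?S)" and "z = ovar (Suc (fresh_idx ?S))"
  have n: "y \<notin> ?S" "z \<notin> ?S" "y \<noteq> z" "vty y = Ty 0" "vty z = Ty 0"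
    unfolding y_def z_def by (intro fresh_idx_notin; simp)+ simp_all
  then have "x \<noteq> y" "x \<noteq> z" by auto
  have E: "evalto (t \<cdot> u) x = app_formula t u y z x"
    by (simp add: evalto.simps(2) Let_def y_def z_def)
  have "slash M (evalto t y) (\<sigma>(y := d, z := e)) \<longleftrightarrow> ev \<sigma> t d"
    "slash M (evalto u z) (\<sigma>(y := d, z := e)) \<longleftrightarrow> ev \<sigma> u e"
    if "dom (Ty 0) d" "dom (Ty 0) e" for d e
  proof -
    have v: "valid (\<sigma>(y := d, z := e))" using App.prems that n by (auto intro!: valid_upd)
    have "ev (\<sigma>(y := d, z := e)) t = ev \<sigma> t" "ev (\<sigma>(y := d, z := e)) u = ev \<sigma> u"
      using n by (auto intro!: ev_coincidence)
    moreover have "slash M (evalto t y) (\<sigma>(y := d, z := e)) \<longleftrightarrow>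
        ev (\<sigma>(y := d, z := e)) t ((\<sigma>(y := d, z := e)) y)"
      "slash M (evalto u z) (\<sigma>(y := d, z := e)) \<longleftrightarrow>
        ev (\<sigma>(y := d, z := e)) u ((\<sigma>(y := d, z := e)) z)"
      by (rule App.IH(1)[OF v n(4)] App.IH(2)[OF v n(5)])+
    ultimately show "slash M (evalto t y) (\<sigma>(y := d, z := e)) \<longleftrightarrow> ev \<sigma> t d"
      "slash M (evalto u z) (\<sigma>(y := d, z := e)) \<longleftrightarrow> ev \<sigma> u e"
      using n by simp_all
  qed
  then have "slash M (app_formula t u y z x) \<sigma> \<longleftrightarrow>
      (\<exists>d. dom (Ty 0) d \<and> (\<exists>e. dom (Ty 0) e \<and> ev \<sigma> t d \<and> ev \<sigma> u e \<and> eval d e (\<sigma> x)))"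
    using n \<open>x \<noteq> y\<close> \<open>x \<noteq> z\<close> by (simp cong: conj_cong)
  \<comment> \<open>Values of external terms always lie in type 0, so the bounds on d and e may be
    dropped.\<close>
  then show ?case
    unfolding E using ev_dom[OF App.prems(1), of t] ev_dom[OF App.prems(1), of u] by auto
qed simp

lemma slash_simeq:
  assumes "valid \<sigma>"
  shows "slash M (t \<^bold>\<simeq> u) \<sigma> \<longleftrightarrow> (\<exists>d. ev \<sigma> t d \<and> ev \<sigma> u d)"
proof -
  let ?x = "ovar (fresh_idx (ext_vars t \<union> ext_vars u))"
  have x: "?x \<notin> ext_vars t \<union> ext_vars u" by (intro fresh_idx_notin) auto
  have E: "t \<^bold>\<simeq> u = Exists ?x (evalto t ?x \<^bold>\<and> evalto u ?x)" by (simp add: simeq_def Let_def)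
  have "slash M (evalto w ?x) (\<sigma>(?x := d)) \<longleftrightarrow> ev \<sigma> w d" if "dom (Ty 0) d" "w = t \<or> w = u" for d w
  proof -
    have "ev (\<sigma>(?x := d)) w = ev \<sigma> w" using x that by (intro ev_coincidence) auto
    then show ?thesis using slash_evalto[OF valid_upd[OF assms, of ?x d], of ?x M w] that by simp
  qed
  then show ?thesis unfolding E using ev_dom[OF assms, of t] by (simp cong: conj_cong) blast
qed

lemma slash_defined:
  assumes "valid \<sigma>"
  shows "slash M (defined t) \<sigma> \<longleftrightarrow> (\<exists>d. ev \<sigma> t d)"
proof -
  let ?x = "ovar (fresh_idx (ext_vars t))"
  have x: "?x \<notin> ext_vars t" by (intro fresh_idx_notin) auto
  have E: "defined t = Exists ?x (evalto t ?x)" by (simp add: defined_def Let_def)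
  have "slash M (evalto t ?x) (\<sigma>(?x := d)) \<longleftrightarrow> ev \<sigma> t d" if "dom (Ty 0) d" for d
  proof -
    have "ev (\<sigma>(?x := d)) t = ev \<sigma> t" using x that by (intro ev_coincidence) auto
    then show ?thesis using slash_evalto[OF valid_upd[OF assms, of ?x d], of ?x M t] that by simp
  qed
  then show ?thesis unfolding E using ev_dom[OF assms, of t] by (simp cong: conj_cong) blast
qed

lemma prov_AndD:
  assumes "prov \<sigma> (\<phi> \<^bold>\<and> \<psi>)"
  shows "prov \<sigma> \<phi>" "prov \<sigma> \<psi>"
  using assms unfolding prov_def by (auto intro: AndE1 AndE2)

text \<open>Derivability is a premise because the quantifier and both implications inside demand it;
  what remains is agreement of values.\<close>

lemma slash_kleene_eq:
  assumes "valid \<sigma>" "\<turnstile>\<^sub>B\<^sub>T t \<^bold>\<cong> u" "\<And>d. ev \<sigma> t d \<longleftrightarrow> ev \<sigma> u d"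
  shows "slash M (t \<^bold>\<cong> u) \<sigma>"
proof -
  let ?x = "ovar (fresh_idx (ext_vars t \<union> ext_vars u))"
  have x: "?x \<notin> ext_vars t \<union> ext_vars u" by (intro fresh_idx_notin) auto
  have E: "t \<^bold>\<cong> u = Forall ?x (evalto t ?x \<^bold>\<longleftrightarrow> evalto u ?x)" by (simp add: kleene_eq_def Let_def)
  have p: "prov \<sigma> (Forall ?x (evalto t ?x \<^bold>\<longleftrightarrow> evalto u ?x))"
    using prov_theorem[OF assms(2)] unfolding E .
  have "slash M (evalto t ?x \<^bold>\<longleftrightarrow> evalto u ?x) (\<sigma>(?x := d))" if "dom (Ty 0) d" for d
  proof -
    have v: "valid (\<sigma>(?x := d))" using assms(1) that by (auto intro: valid_upd)
    have "ev (\<sigma>(?x := d)) t = ev \<sigma> t" "ev (\<sigma>(?x := d)) u = ev \<sigma> u"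
      using x by (auto intro!: ev_coincidence)
    moreover have "prov (\<sigma>(?x := d)) (evalto t ?x \<^bold>\<longleftrightarrow> evalto u ?x)"
      using prov_Forall[OF assms(1) p] .
    ultimately show ?thesis using v assms(3) by (auto simp: slash_evalto dest: prov_AndD)
  qed
  with p show ?thesis unfolding E by simp
qed

text \<open>Offers derivability of the antecedent as an extra assumption; in nested implications it
  makes the inner ones derivable by modus ponens.\<close>

lemma slash_ImpI:
  assumes "valid \<sigma>" "prov \<sigma> (\<phi> \<^bold>\<longrightarrow> \<psi>)" "wff \<phi>"
    and "slash M \<phi> \<sigma> \<Longrightarrow> prov \<sigma> \<phi> \<Longrightarrow> slash M \<psi> \<sigma>"
  shows "slash M (\<phi> \<^bold>\<longrightarrow> \<psi>) \<sigma>"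
  using assms slash_prov by auto

section \<open>The axioms are slashed\<close>

lemma free_for_const: "free_for (Con c) v \<phi>"
  by (induction \<phi>) auto

lemma slash_logic_ax:
  assumes "logic_ax \<phi>" "wff \<phi>" "valid \<sigma>"
  shows "slash M \<phi> \<sigma>"
proof -
  have p: "prov \<sigma> \<phi>" using assms by (intro prov_theorem by_logic)
  from assms(1) show ?thesis
  proof cases
    case (ax_impK \<phi>' \<psi>)
    then show ?thesis using p assms unfolding ax_impK
      by (intro slash_ImpI) (auto intro: prov_mp)
  next
    case (ax_impS \<phi>' \<psi> \<chi>)
    then show ?thesis using p assms unfolding ax_impS
      by (intro slash_ImpI) (auto intro: prov_mp)
  next
    case (ax_andI \<phi>' \<psi>)
    then show ?thesis using p assms unfolding ax_andI
      by (intro slash_ImpI) (auto intro: prov_mp)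
  next
    case (ax_orE \<phi>' \<chi> \<psi>)
    then show ?thesis using p assms unfolding ax_orE
      by (intro slash_ImpI) (auto intro: prov_mp)
  next
    case (ax_allE t v \<phi>')
    have "dom (vty v) (tval \<sigma> t)" using dom_tval[OF assms(3), of t] ax_allE by simp
    with ax_allE p assms show ?thesis by (simp add: slash_subst)
  next
    case (ax_exI t v \<phi>')
    have "dom (vty v) (tval \<sigma> t)" using dom_tval[OF assms(3), of t] ax_exI by simp
    with ax_exI p assms show ?thesis by (auto simp: slash_subst)
  qed (use p assms in auto)
qed

text \<open>With identity of values as equality nothing is left to compute. For membership,
  derivability of the conclusion follows by modus ponens from the axiom.\<close>

lemma slash_eq_ax:
  assumes "eq_ax \<phi>" "wff \<phi>" "valid \<sigma>"
  shows "slash M \<phi> \<sigma>"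
proof -
  have p: "prov \<sigma> \<phi>" using assms by (intro prov_theorem by_equality)
  from assms(1) show ?thesis
  proof cases
    case (eq_Mem A k a U b B c W d)
    then show ?thesis using p assms unfolding eq_Mem(1)
      by (intro slash_ImpI) (auto simp: slash_simeq intro: prov_mp)
  qed (use p assms in auto)
qed

inductive_simps eval_simps:
  "eval (cst CS) x y" "eval (cst CS \<cdot> z) x y" "eval (cst CS \<cdot> u \<cdot> z) x y"
  "eval (cst CP) x y" "eval (cst CP \<cdot> z) x y"

lemma slash_comb_ax:
  assumes "comb_ax \<phi>" "wff \<phi>" "valid \<sigma>"
  shows "slash M \<phi> \<sigma>"
proof -
  have t: "\<turnstile>\<^sub>B\<^sub>T \<phi>" using assms by (intro by_combinatorial)
  then have p: "prov \<sigma> \<phi>" by (rule prov_theorem)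
  have dm: "dom (vty v) (\<sigma> v)" for v using assms(3) by (simp add: valid_def)
  from assms(1) show ?thesis
  proof cases
    case (Ap_functional f h x i y j z l)
    then show ?thesis using p by (auto dest: eval_functional)
  next
    case (k_eq x i y j)
    have "ev \<sigma> (cst CK \<cdot> vr x \<cdot> vr y) (\<sigma> x)"
      by (rule evI[OF evI[OF ev_cst ev_vr eval_k1] ev_vr eval_k2])
    with k_eq assms show ?thesis by (simp add: slash_evalto)
  next
    case (s_def x i y j)
    have "ev \<sigma> (cst CS \<cdot> vr x \<cdot> vr y) (cst CS \<cdot> \<sigma> x \<cdot> \<sigma> y)"
      by (rule evI[OF evI[OF ev_cst ev_vr eval_s1] ev_vr eval_s2])
    with s_def assms show ?thesis by (auto simp: slash_defined simp del: ev.simps)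
  next
    case (s_eq x i y j z l)
    show ?thesis unfolding s_eq(1)
      by (rule slash_kleene_eq) (use t s_eq assms in \<open>auto simp: eval_simps\<close>)
  next
    case (p_def x i y j)
    have "ev \<sigma> (cst CP \<cdot> vr x \<cdot> vr y) (cst CP \<cdot> \<sigma> x \<cdot> \<sigma> y)"
      by (rule evI[OF evI[OF ev_cst ev_vr eval_p1] ev_vr eval_p2])
    with p_def assms show ?thesis by (auto simp: slash_defined simp del: ev.simps)
  next
    case (p_nonzero x i y j)
    \<comment> \<open>The two sides differ as syntax: a pair is not a constant.\<close>
    with p assms show ?thesis by (auto simp: slash_simeq eval_simps)
  next
    case (p1_def x i)
    \<comment> \<open>A pair is projected; on any other value the projection stays as it is and is
      itself a value.\<close>
    have "\<exists>d. eval (cst CP1) (\<sigma> x) d" using eval_proj1 eval_proj1' by metis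
    with p1_def assms show ?thesis by (auto simp: slash_defined)
  next
    case (p2_def x i)
    have "\<exists>d. eval (cst CP2) (\<sigma> x) d" using eval_proj2 eval_proj2' by metis
    with p2_def assms show ?thesis by (auto simp: slash_defined)
  next
    case (p1_eq x i y j)
    have "ev \<sigma> (cst CP1 \<cdot> (cst CP \<cdot> vr x \<cdot> vr y)) (\<sigma> x)"
      by (rule evI[OF ev_cst evI[OF evI[OF ev_cst ev_vr eval_p1] ev_vr eval_p2] eval_proj1])
    with p1_eq assms show ?thesis by (simp add: slash_evalto)
  next
    case (p2_eq x i y j)
    have "ev \<sigma> (cst CP2 \<cdot> (cst CP \<cdot> vr x \<cdot> vr y)) (\<sigma> y)"
      by (rule evI[OF ev_cst evI[OF evI[OF ev_cst ev_vr eval_p1] ev_vr eval_p2] eval_proj2])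
    with p2_eq assms show ?thesis by (simp add: slash_evalto)
  next
    case (p_num n i m j)
    let ?d = "cst CP \<cdot> \<sigma> n \<cdot> cst Zero"
    have d: "dom (vty m) ?d" using dm[of n] p_num by (auto intro: dom_Suc)
    have "ev (\<sigma>(m := ?d)) (cst CP \<cdot> vr n \<cdot> cst Zero) ?d" "ev (\<sigma>(m := ?d)) (vr m) ?d"
      using p_num by (auto simp: eval_simps)
    then have "slash M (cst CP \<cdot> vr n \<cdot> cst Zero \<^bold>\<simeq> vr m) (\<sigma>(m := ?d))"
      using slash_simeq[OF valid_upd[OF assms(3) d]] by blast
    with d show ?thesis unfolding p_num(1) by auto
  next
    case (p_type x i A k a B b)
    let ?d = "cst CP \<cdot> \<sigma> x \<cdot> \<sigma> A"
    \<comment> \<open>For \<open>k = 0\<close> the pair is a value by \<open>dom_p2\<close>, for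
      larger \<open>k\<close> by \<open>dom_pair_type\<close>.\<close>
    have d: "dom (vty B) ?d"
      using dm[of x] dm[of A] p_type by (cases k) (auto intro: dom_p2 dom_pair_type)
    have "ev (\<sigma>(B := ?d)) (cst CP \<cdot> vr x \<cdot> vr A) ?d" "ev (\<sigma>(B := ?d)) (vr B) ?d"
      using p_type by (auto simp: eval_simps)
    then have "slash M (cst CP \<cdot> vr x \<cdot> vr A \<^bold>\<simeq> vr B) (\<sigma>(B := ?d))"
      using slash_simeq[OF valid_upd[OF assms(3) d]] by blast
    with d show ?thesis unfolding p_type(1) by auto
  next
    case (d_eq x i y j n h m l)
    \<comment> \<open>Number variables are assigned numerals, as \<open>eval_d3\<close> and
      \<open>eval_d_eq\<close> require.\<close>
    have "ev \<sigma> (cst CD \<cdot> vr x \<cdot> vr y \<cdot> vr n \<cdot> vr m) (\<sigma> x)" if "\<sigma> n = \<sigma> m"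
      using dm[of n] that d_eq
      by (intro evI[OF evI[OF evI[OF evI[OF ev_cst ev_vr eval_d1] ev_vr eval_d2] ev_vr eval_d3] ev_vr])
        (auto intro: eval_d_eq)
    with d_eq p assms show ?thesis by (simp add: slash_simeq slash_evalto del: ev.simps(2))
  next
    case (d_neq x i y j n h m l)
    \<comment> \<open>The slashed negation excludes identical numerals, which is just the condition
      of \<open>eval_d_neq\<close>.\<close>
    have "ev \<sigma> (cst CD \<cdot> vr x \<cdot> vr y \<cdot> vr n \<cdot> vr m) (\<sigma> y)" if "\<sigma> n \<noteq> \<sigma> m"
      using dm[of n] dm[of m] that d_neq
      by (intro evI[OF evI[OF evI[OF evI[OF ev_cst ev_vr eval_d1] ev_vr eval_d2] ev_vr eval_d3] ev_vr])
        (auto intro: eval_d_neq)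
    with d_neq p assms show ?thesis by (auto simp: slash_simeq slash_evalto simp del: ev.simps(2))
  next
    case (num_op x i n j)
    have "dom (Ty 0) (\<sigma> n)" using dm[of n] by (rule dom_type)
    with num_op show ?thesis by auto
  next
    case (type_op x i A k a)
    have "dom (Ty 0) (\<sigma> A)" using dm[of A] by (rule dom_type)
    with type_op show ?thesis by auto
  qed
qed

text \<open>Pairing produces the tuple of values as it stands; the premise is used for the last
  application, since \<open>eval_c\<close> accepts only results that are sets.\<close>

lemma ev_app_tuple:
  assumes "dom (Ty (Suc k)) (app_tuple (cst (CC n)) (map \<sigma> Xs))"
  shows "ev \<sigma> (app_tuple (cst (CC n)) (map vr Xs)) (app_tuple (cst (CC n)) (map \<sigma> Xs))"
proof -
  have "ev \<sigma> (foldl (\<lambda>a b. cst CP \<cdot> a \<cdot> b) t (map vr Xs)) (foldl (\<lambda>a b. cst CP \<cdot> a \<cdot> b) d (map \<sigma> Xs))"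
    if "ev \<sigma> t d" for t d Xs
    using that
  proof (induction Xs arbitrary: t d)
    case (Cons X Xs)
    have "ev \<sigma> (cst CP \<cdot> t \<cdot> vr X) (cst CP \<cdot> d \<cdot> \<sigma> X)"
      by (rule evI[OF evI[OF ev_cst Cons.prems eval_p1] ev_vr eval_p2])
    then show ?case using Cons.IH[of "cst CP \<cdot> t \<cdot> vr X"] by simp
  qed simp
  with assms show ?thesis
    by (cases Xs) (auto intro!: evI[OF ev_cst] eval_c simp del: ev.simps intro: ev_vr ev_cst)
qed

text \<open>The axiom supplies some set with the right elements, while U is already fixed. Both
  equal the comprehension term, so membership is transferred from one to the other.\<close>

lemma prov_comprehension:
  assumes "compr k Z Xs \<phi>" "valid \<sigma>" "vty U = Ty (Suc k)" "U \<notin> set Xs"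
    and "\<sigma> U = compr_term Z Xs \<phi> (map \<sigma> Xs)"
  shows "prov \<sigma> (Forall Z (Mem k (Var Z) (Var U) \<^bold>\<longleftrightarrow> \<phi>))"
proof (rule prov_if_hyps)
  \<comment> \<open>Z is left out, so that it can be generalised at the end.\<close>
  let ?W = "insert U (set Xs)" let ?H = "hyps \<sigma> ?W"
  obtain j where j: "V (Ty (Suc k)) j \<notin> ?W" using ex_fresh[of ?W] by blast
  let ?U = "V (Ty (Suc k)) j"
  let ?B = "compr_term Z Xs \<phi> (map vr Xs) \<^bold>\<simeq> vr ?U" and ?C = "\<lambda>U. Mem k (Var Z) (Var U) \<^bold>\<longleftrightarrow> \<phi>"
  have Z: "vty Z = Ty k" "Z \<notin> set Xs" "fv \<phi> \<subseteq> insert Z (set Xs)" "wff \<phi>"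
    using assms(1) by (auto simp: compr_def)
  have ne: "Z \<noteq> U" "Z \<noteq> ?U" using Z assms(3) by auto
  have fin: "finite ?H" by (simp add: hyps_def)
  have fH: "fv \<gamma> \<subseteq> ?W" if "\<gamma> \<in> ?H" for \<gamma>
    using that valid_closed[OF assms(2)] by (auto simp: hyps_def)
  have E: "?H \<tturnstile> Exists ?U (?B \<^bold>\<and> Forall Z (?C ?U))"
    using j by (intro theorem_ compr_axiom assms) auto
  let ?D = "insert (?B \<^bold>\<and> Forall Z (?C ?U)) ?H"
  have "?D \<tturnstile> ?B \<^bold>\<and> Forall Z (?C ?U)" using Z by (auto intro: hyp)
  then have B: "?D \<tturnstile> ?B" and C: "?D \<tturnstile> Forall Z (?C ?U)" by (blast intro: AndE1 AndE2)+
  have n: "keq ?D (\<sigma> v) (vr v)" if "v \<in> ?W" for v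
    using that by (intro keq_name) (auto simp: hyps_def)
  have "keq ?D (compr_term Z Xs \<phi> (map \<sigma> Xs)) (compr_term Z Xs \<phi> (map vr Xs))"
    using fin n by (intro keq_app_tuple) (auto simp: list_all2_conv_all_nth)
  from keq_sym[OF this] have "keq ?D (compr_term Z Xs \<phi> (map vr Xs)) (vr U)"
    by (rule keq_trans) (use n[of U] assms(5) in simp)
  then have "?D \<tturnstile> vr U \<^bold>\<simeq> vr ?U" using fin by (intro simeq_keq[OF _ B _ keq_refl]) auto
  then have U: "?D \<union> \<Delta> \<tturnstile> vr U \<^bold>\<simeq> vr ?U" for \<Delta> by (rule weaken) blast
  have C': "?D \<union> \<Delta> \<tturnstile> Mem k (Var Z) (Var ?U) \<^bold>\<longrightarrow> \<phi>" "?D \<union> \<Delta> \<tturnstile> \<phi> \<^bold>\<longrightarrow> Mem k (Var Z) (Var ?U)" for \<Delta>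
    by (rule AndE1[OF weaken[OF ForallE[OF C]]] AndE2[OF weaken[OF ForallE[OF C]]]; blast)+
  have "?D \<tturnstile> Mem k (Var Z) (Var U) \<^bold>\<longrightarrow> \<phi>"
  proof (rule ImpI)
    let ?E = "?D \<union> {Mem k (Var Z) (Var U)}"
    have "?E \<tturnstile> Mem k (Var Z) (Var U)" using Z assms(3) by (auto intro: hyp)
    then have "?E \<tturnstile> Mem k (Var Z) (Var ?U)"
      using Z assms(3) by (intro Mem_simeq[OF _ _ _ _ simeq_At_refl U]) auto
    with C'(1) have "?E \<tturnstile> \<phi>" by (rule mp)
    then show "insert (Mem k (Var Z) (Var U)) ?D \<tturnstile> \<phi>" by simp
  qed (use Z assms(3) in auto)
  moreover have "?D \<tturnstile> \<phi> \<^bold>\<longrightarrow> Mem k (Var Z) (Var U)"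
  proof (rule ImpI)
    let ?E = "?D \<union> {\<phi>}"
    have "?E \<tturnstile> \<phi>" using Z by (auto intro: hyp)
    with C'(2) have "?E \<tturnstile> Mem k (Var Z) (Var ?U)" by (rule mp)
    then have "?E \<tturnstile> Mem k (Var Z) (Var U)"
      using Z assms(3) by (intro Mem_simeq[OF _ _ _ _ simeq_At_refl simeq_sym[OF U]]) auto
    then show "insert \<phi> ?D \<tturnstile> Mem k (Var Z) (Var U)" by simp
  qed (use Z in auto)
  ultimately have "?D \<tturnstile> ?C U" by (rule AndI)
  then have D: "?D \<tturnstile> Forall Z (?C U)"
  proof (rule ForallI)
    fix \<gamma> assume "\<gamma> \<in> ?D"
    then show "Z \<notin> fv \<gamma>"
      using fH[of \<gamma>] Z ne by (auto simp: app_tuple_vars)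
  qed
  show "?H \<tturnstile> Forall Z (?C U)"
    by (rule ExistsE[OF E D]) (use j fH Z in auto)
qed

lemma slash_compr_ax:
  assumes "compr_ax \<phi>" "wff \<phi>" "valid \<sigma>"
  shows "slash mem \<phi> \<sigma>"
  using assms(1)
proof cases
  case (comprehension Z k i U j Xs \<psi> n)
  have c: "compr k Z Xs \<psi>" using comprehension assms(2) by (auto simp: compr_def)
  \<comment> \<open>The witness for U: the comprehension term itself, with the current values of its
    parameters.\<close>
  let ?u = "compr_term Z Xs \<psi> (map \<sigma> Xs)"
  have u: "dom (vty U) ?u"
    using c assms(3) comprehension
    by (auto intro!: dom_compr simp: list_all2_conv_all_nth valid_def)
  define \<tau> where "\<tau> = \<sigma>(U := ?u)"
  have \<tau>: "valid \<tau>" unfolding \<tau>_def using assms(3) u by (rule valid_upd)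
  have m: "map \<tau> Xs = map \<sigma> Xs" "\<tau> U = ?u" using comprehension by (auto simp: \<tau>_def)
  have p: "prov \<tau> (Forall Z (Mem k (Var Z) (Var U) \<^bold>\<longleftrightarrow> \<psi>))"
    by (rule prov_comprehension[OF c \<tau>]) (use comprehension m(2) in \<open>simp_all add: m(1)\<close>)
  have "ev \<tau> (compr_term Z Xs \<psi> (map vr Xs)) ?u"
    using ev_app_tuple[of k "goedel Z Xs \<psi>" \<tau> Xs] u m comprehension by auto
  then have A: "slash mem (compr_term Z Xs \<psi> (map vr Xs) \<^bold>\<simeq> vr U) \<tau>"
    using m by (auto simp: slash_simeq[OF \<tau>])
  have B: "slash mem (Mem k (Var Z) (Var U) \<^bold>\<longleftrightarrow> \<psi>) (\<tau>(Z := d))" if d: "dom (Ty k) d" for d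
  proof -
    let ?\<rho> = "\<tau>(Z := d)"
    have \<rho>: "valid ?\<rho>" using \<tau> d comprehension by (auto intro: valid_upd)
    have pr: "prov ?\<rho> (Mem k (Var Z) (Var U) \<^bold>\<longrightarrow> \<psi>)" "prov ?\<rho> (\<psi> \<^bold>\<longrightarrow> Mem k (Var Z) (Var U))"
      using prov_Forall[OF \<tau> p, of d] prov_AndD by blast+
    have m': "map ?\<rho> Xs = map \<sigma> Xs" "?\<rho> U = ?u"
      using comprehension by (auto simp: \<tau>_def)
    have "mem k (tval ?\<rho> (Var Z)) (tval ?\<rho> (Var U)) \<longleftrightarrow> slash mem \<psi> ?\<rho>"
      using mem_compr_term[OF c \<rho>] by (simp only: tval.simps m')
    \<comment> \<open>The derivability demanded of membership: \<psi> is derivable because it is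
      slashed, and the derivable comprehension clause turns it into membership.\<close>
    moreover have "prov ?\<rho> (Mem k (Var Z) (Var U))" if "slash mem \<psi> ?\<rho>"
      using slash_prov[OF \<rho> _ that] c pr(2) by (auto simp: compr_def intro: prov_mp)
    ultimately show ?thesis using pr by auto
  qed
  have "vty Z = Ty k" using c by (simp add: compr_def)
  then have "slash mem (Forall Z (Mem k (Var Z) (Var U) \<^bold>\<longleftrightarrow> \<psi>)) \<tau>"
    unfolding slash.simps(8) using p B by metis
  with A have "slash mem (compr_term Z Xs \<psi> (map vr Xs) \<^bold>\<simeq> vr U \<^bold>\<and>
      Forall Z (Mem k (Var Z) (Var U) \<^bold>\<longleftrightarrow> \<psi>)) \<tau>"
    unfolding slash.simps(5) by (rule conjI)
  then have "slash mem (Exists U (compr_term Z Xs \<psi> (map vr Xs) \<^bold>\<simeq> vr U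
      \<^bold>\<and> Forall Z (Mem k (Var Z) (Var U) \<^bold>\<longleftrightarrow> \<psi>))) \<sigma>"
    using u unfolding \<tau>_def slash.simps(9) by blast
  then show ?thesis using comprehension(1) comprehension(9) by simp
qed

section \<open>The rules of inference and the disjunction property\<close>

lemma slash_upd_fresh:
  assumes "valid \<sigma>" "dom (vty v) d" "v \<notin> fv \<phi>"
  shows "slash M \<phi> (\<sigma>(v := d)) \<longleftrightarrow> slash M \<phi> \<sigma>"
  by (rule slash_coincidence[OF valid_upd[OF assms(1,2)] assms(1)]) (use assms(3) in auto)

text \<open>\<sigma> is arbitrary because the quantifier and induction rules use their premises
  under updated assignments. The induction rule is met by an inner induction on numerals, the only
  values of type \<omega>.\<close>

lemma slash_sound: "\<turnstile>\<^sub>B\<^sub>T \<phi> \<Longrightarrow> valid \<sigma> \<Longrightarrow> slash mem \<phi> \<sigma>"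
proof (induction arbitrary: \<sigma> rule: BT.induct)
  case (by_logic \<phi>)
  then show ?case by (intro slash_logic_ax)
next
  case (by_equality \<phi>)
  then show ?case by (intro slash_eq_ax)
next
  case (by_combinatorial \<phi>)
  then show ?case by (intro slash_comb_ax)
next
  case (by_comprehension \<phi>)
  then show ?case by (intro slash_compr_ax)
next
  case (rule_mp \<phi> \<psi>)
  then show ?case by simp
next
  case (rule_all \<psi> \<phi> v)
  have p: "prov \<sigma> (\<psi> \<^bold>\<longrightarrow> Forall v \<phi>)" using rule_all by (intro prov_theorem BT.rule_all)
  have w: "wff \<psi>" using BT_wff[OF rule_all(1)] by simp
  from rule_all(4) p w show ?case
  proof (rule slash_ImpI)
    assume s: "slash mem \<psi> \<sigma>" "prov \<sigma> \<psi>"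
    have "slash mem \<phi> (\<sigma>(v := d))" if "dom (vty v) d" for d
    proof -
      have val: "valid (\<sigma>(v := d))" using rule_all(4) that by (rule valid_upd)
      moreover have "slash mem \<psi> (\<sigma>(v := d))"
        using s(1) slash_upd_fresh[OF rule_all(4) that rule_all(2)] by simp
      moreover have "slash mem (\<psi> \<^bold>\<longrightarrow> \<phi>) (\<sigma>(v := d))" by (rule rule_all.IH[OF val])
      ultimately show ?thesis by simp
    qed
    then show "slash mem (Forall v \<phi>) \<sigma>" using prov_mp[OF p s(2)] by simp
  qed
next
  case (rule_ex \<phi> \<psi> v)
  have p: "prov \<sigma> (Exists v \<phi> \<^bold>\<longrightarrow> \<psi>)" using rule_ex by (intro prov_theorem BT.rule_ex)
  have "slash mem \<psi> \<sigma>" if "dom (vty v) d" "slash mem \<phi> (\<sigma>(v := d))" for d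
  proof -
    have val: "valid (\<sigma>(v := d))" using rule_ex(4) that(1) by (rule valid_upd)
    have "slash mem (\<phi> \<^bold>\<longrightarrow> \<psi>) (\<sigma>(v := d))" by (rule rule_ex.IH[OF val])
    then have "slash mem \<psi> (\<sigma>(v := d))" using that(2) by simp
    then show ?thesis using slash_upd_fresh[OF rule_ex(4) that(1) rule_ex(2)] by simp
  qed
  with p show ?case by auto
next
  case (rule_induction n i m j \<phi>)
  have w: "wff \<phi>" using BT_wff[OF rule_induction(6)] rule_induction(1) by simp
  have "slash mem \<phi> (\<sigma>(n := d))" if "dom Omega d" for d
    using that
  proof (induction Omega d rule: dom.induct)
    case dom_zero
    have "slash mem (subst n (Con Zero) \<phi>) \<sigma>" using rule_induction by blast
    then show ?case
      using slash_subst[of "Con Zero" n \<sigma> \<phi> mem] rule_induction w free_for_const by simp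
  next
    case (dom_Suc d)
    let ?\<tau> = "\<sigma>(n := d)"
    have \<tau>: "valid ?\<tau>" using rule_induction(1,10) dom_Suc(1) by (auto intro: valid_upd)
    have "slash mem (\<phi> \<^bold>\<longrightarrow> Exists m (cst CP \<cdot> vr n \<cdot> cst Zero \<^bold>\<simeq> vr m \<^bold>\<and> subst n (Var m) \<phi>)) ?\<tau>"
      by (rule rule_induction(9)[OF \<tau>])
    then obtain e where e: "dom Omega e" "slash mem (cst CP \<cdot> vr n \<cdot> cst Zero \<^bold>\<simeq> vr m) (?\<tau>(m := e))"
      "slash mem (subst n (Var m) \<phi>) (?\<tau>(m := e))"
      using dom_Suc(2) rule_induction(2) by auto
    have val: "valid (?\<tau>(m := e))" using \<tau> e(1) rule_induction(2) by (auto intro: valid_upd)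
    \<comment> \<open>The left-hand side can only evaluate to the successor of d, which fixes the
      value of m.\<close>
    have e_eq: "e = cst CP \<cdot> d \<cdot> cst Zero"
      using e(2) rule_induction(3) by (auto simp: slash_simeq[OF val] eval_simps)
    \<comment> \<open>Substituting m for n amounts to giving n the value of m. Afterwards the value
      of m is irrelevant, as m is not free in \<phi>.\<close>
    have "slash mem \<phi> (?\<tau>(m := e, n := e))"
      using e(3) slash_subst[of "Var m" n "?\<tau>(m := e)" \<phi> mem] val rule_induction(1-5) w by simp
    moreover have "?\<tau>(m := e, n := e) = \<sigma>(n := e, m := e)"
      using rule_induction(3) by (simp add: fun_upd_twist)
    moreover have "valid (\<sigma>(n := e))"
      using valid_upd[OF rule_induction(10), of n e] rule_induction(1) e(1) by simp
    ultimately have "slash mem \<phi> (\<sigma>(n := e))"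
      using slash_upd_fresh[of "\<sigma>(n := e)" m e \<phi> mem] e(1) rule_induction(2,4) by simp
    then show ?case unfolding e_eq .
  qed
  moreover have "dom Omega (\<sigma> n)" using dom_tval[OF rule_induction(10), of "Var n"] rule_induction(1) by simp
  ultimately have "slash mem \<phi> (\<sigma>(n := \<sigma> n))" by blast
  then show ?case by simp
qed

text \<open>Assignments are total, so even for sentences every type must have a value.\<close>

lemma ex_valid: "\<exists>\<sigma>. valid \<sigma>"
proof -
  have "\<forall>s. \<exists>d. dom s d"
  proof
    fix s
    show "\<exists>d. dom s d"
    proof (cases s)
      case Omega
      then show ?thesis using dom_zero by blast
    next
      case (Ty k)
      show ?thesis
      proof (cases k)
        case 0
        then show ?thesis using Ty dom_type[OF dom_zero] by blast
      next
        case (Suc k')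
        \<comment> \<open>The empty set, defined without parameters, is a value of each higher
          type.\<close>
        have "compr k' (V (Ty k') 0) [] \<^bold>\<bottom>" by (simp add: compr_def)
        then have "dom s (compr_term (V (Ty k') 0) [] \<^bold>\<bottom> [])"
          unfolding Ty Suc by (rule dom_compr) simp
        then show ?thesis by blast
      qed
    qed
  qed
  then obtain f where "dom s (f s)" for s by (metis (full_types))
  then show ?thesis unfolding valid_def by (intro exI[of _ "\<lambda>v. f (vty v)"]) blast
qed

theorem theorem4:
  fixes \<phi> \<psi> :: form
  assumes "closed_form \<phi>" and "closed_form \<psi>"
    and "\<turnstile>\<^sub>B\<^sub>T (\<phi> \<^bold>\<or> \<psi>)"
  shows "(\<turnstile>\<^sub>B\<^sub>T \<phi>) \<or> (\<turnstile>\<^sub>B\<^sub>T \<psi>)"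
proof -
  \<comment> \<open>Sentences do not depend on the assignment, so any one will do.\<close>
  obtain \<sigma> where \<sigma>: "valid \<sigma>" using ex_valid by blast
  have "slash mem \<phi> \<sigma> \<or> slash mem \<psi> \<sigma>" using slash_sound[OF assms(3) \<sigma>] by simp
  then show ?thesis
    using assms(1,2) \<sigma> slash_prov prov_closed unfolding closed_form_def by blast
qed

end
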